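(* Let $h^*$ be an additive multiplicative generalized cohomology theory. Let $M$ be a smooth $h^*$-oriented manifold of dimension $m$ and let $e_{TM}\in h^m(M)$ be the Euler class of its tangent bundle. Let $g:N\to M$ be a map, let $g^*LM$ be the relative free loop space of $g$, with projection $p:g^*LM\to N$, $(n,w)\mapsto n$, and section $\sigma:N\hookrightarrow g^*LM$, $n\mapsto(n,\text{constant loop at }g(n))$. Suppose that $g$ is the composite $N\xrightarrow{g_1}L\xrightarrow{g_2}M$, where a) $L$ is a smooth manifold without boundary and $g_2$ is smooth, and b) $g_1$ is a (Serre) fibration. Then for any $b\in h^*(g^*LM)$, $$b\cup p^*\circ g^*(e_{TM})=p^*\circ\sigma^*(b)\cup p^*\circ g^*(e_{TM}).$$ In particular, if there is an integer $\dim N$ such that $h^i(N)=\{0\}$ for all $i>\dim N$, then for all $b\in h^*(g^*LM)$ of degree $|b|>\dim N-m$, $b\cup p^*\circ g^*(e_{TM})=0$.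
   Context: Manifolds are without boundary. $LM=\mathrm{map}(S^1,M)$ and $ev:LM\to M$ is evaluation at the base point. The relative free loop space is the pull-back $g^*LM=\{(n,w)\in N\times LM: g(n)=ev(w)\}$. The Euler class of an $h^*$-oriented vector bundle is the restriction of its Thom class to the zero section. Convention: fibrations are Hurewicz fibrations; Serre fibrations are allowed when $h^*$ sends weak equivalences to isomorphisms. *)

theory Defs
  imports "HOL-Analysis.Analysis" "HOL-Algebra.Coset"
begin

section \<open>Generalized cohomology theories\<close>

text \<open>
  A cohomology theory is given on pairs \<open>(X, A)\<close>, where \<open>X\<close> is a topology whose points have
  type \<open>'u\<close> and \<open>A\<close> is a subset of its carrier (with the subspace topology).
  As in HOL-Homology, the abelian groups are written multiplicatively: the operation of
  \<open>Grp h n X A\<close> is the sum of cohomology classes, and its \<open>\<one>\<close> is the class \<open>0\<close>.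
  The argument order of \<open>Map\<close> is that of \<open>hom_induced\<close>: a map of pairs
  \<open>f : (X, A) \<rightarrow> (Y, B)\<close> gives \<open>Map h n X A Y B f : Grp h n Y B \<rightarrow> Grp h n X A\<close>.
  The connecting map is \<open>Del h n X A : Grp h n A {} \<rightarrow> Grp h (n+1) X A\<close>, and the cup product
  \<open>Cup h p q X A B\<close> sends \<open>Grp h p X A\<close> and \<open>Grp h q X B\<close> to \<open>Grp h (p+q) X (A \<union> B)\<close>.
\<close>

record ('u, 'g) cohomology =
  Grp :: "int \<Rightarrow> 'u topology \<Rightarrow> 'u set \<Rightarrow> 'g monoid"
  Map :: "int \<Rightarrow> 'u topology \<Rightarrow> 'u set \<Rightarrow> 'u topology \<Rightarrow> 'u set \<Rightarrow> ('u \<Rightarrow> 'u) \<Rightarrow> 'g \<Rightarrow> 'g"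
  Del :: "int \<Rightarrow> 'u topology \<Rightarrow> 'u set \<Rightarrow> 'g \<Rightarrow> 'g"
  Cup :: "int \<Rightarrow> int \<Rightarrow> 'u topology \<Rightarrow> 'u set \<Rightarrow> 'u set \<Rightarrow> 'g \<Rightarrow> 'g \<Rightarrow> 'g"
  Unit :: "'u topology \<Rightarrow> 'g"

definition pair_map :: "'a topology \<Rightarrow> 'a set \<Rightarrow> 'b topology \<Rightarrow> 'b set \<Rightarrow> ('a \<Rightarrow> 'b) \<Rightarrow> bool" where
  "pair_map X A Y B f \<longleftrightarrow>
     A \<subseteq> topspace X \<and> B \<subseteq> topspace Y \<and> continuous_map X Y f \<and> f \<in> A \<rightarrow> B"

text \<open>
  HOL cannot quantify over all types, so \<open>'u\<close> plays the role of a universe of points.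
  The two \<open>universe\<close> axioms say that it is closed, up to bijection, under forming function spaces
  with domain the reals, hence under products, path and loop spaces, and products with manifolds;
  \<open>'u = real \<Rightarrow> 'x\<close> is such a universe whenever \<open>'x\<close> has at least two elements. A theory
  defined on all spaces restricts to one on the spaces with points in \<open>'u\<close>.
\<close>

locale additive_cohomology =
  fixes h :: "('u, 'g) cohomology"
  assumes universe_nontrivial: "\<exists>a b :: 'u. a \<noteq> b"
    and universe_closed: "\<exists>code :: (real \<Rightarrow> 'u) \<Rightarrow> 'u. inj code"
    and Grp_group: "A \<subseteq> topspace X \<Longrightarrow> comm_group (Grp h n X A)"
    and Map_hom: "pair_map X A Y B f \<Longrightarrow> Map h n X A Y B f \<in> hom (Grp h n Y B) (Grp h n X A)"
    and Map_id: "A \<subseteq> topspace X \<Longrightarrow> x \<in> carrier (Grp h n X A) \<Longrightarrow> Map h n X A X A id x = x"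
    and Map_comp: "pair_map X A Y B f \<Longrightarrow> pair_map Y B Z C k \<Longrightarrow> z \<in> carrier (Grp h n Z C) \<Longrightarrow>
          Map h n X A Z C (k \<circ> f) z = Map h n X A Y B f (Map h n Y B Z C k z)"
    and homotopy: "A \<subseteq> topspace X \<Longrightarrow> B \<subseteq> topspace Y \<Longrightarrow>
          homotopic_with (\<lambda>k. k \<in> A \<rightarrow> B) X Y f f' \<Longrightarrow> y \<in> carrier (Grp h n Y B) \<Longrightarrow>
          Map h n X A Y B f y = Map h n X A Y B f' y"
    and Del_hom: "A \<subseteq> topspace X \<Longrightarrow>
          Del h n X A \<in> hom (Grp h n (subtopology X A) {}) (Grp h (n + 1) X A)"
    and Del_natural: "pair_map X A Y B f \<Longrightarrow> y \<in> carrier (Grp h n (subtopology Y B) {}) \<Longrightarrow>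
          Del h n X A (Map h n (subtopology X A) {} (subtopology Y B) {} f y) =
          Map h (n + 1) X A Y B f (Del h n Y B y)"
    and exact_space: "A \<subseteq> topspace X \<Longrightarrow>
          Map h n X {} X A id ` carrier (Grp h n X A) =
          kernel (Grp h n X {}) (Grp h n (subtopology X A) {}) (Map h n (subtopology X A) {} X {} id)"
    and exact_subspace: "A \<subseteq> topspace X \<Longrightarrow>
          Map h n (subtopology X A) {} X {} id ` carrier (Grp h n X {}) =
          kernel (Grp h n (subtopology X A) {}) (Grp h (n + 1) X A) (Del h n X A)"
    and exact_pair: "A \<subseteq> topspace X \<Longrightarrow>
          Del h n X A ` carrier (Grp h n (subtopology X A) {}) =
          kernel (Grp h (n + 1) X A) (Grp h (n + 1) X {}) (Map h (n + 1) X {} X A id)"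
    and excision: "U \<subseteq> A \<Longrightarrow> A \<subseteq> topspace X \<Longrightarrow> X closure_of U \<subseteq> X interior_of A \<Longrightarrow>
          Map h n (subtopology X (topspace X - U)) (A - U) X A id
            \<in> iso (Grp h n X A) (Grp h n (subtopology X (topspace X - U)) (A - U))"
    and additivity: "A \<subseteq> topspace X \<Longrightarrow> (\<forall>U\<in>\<U>. openin X U) \<Longrightarrow> pairwise disjnt \<U> \<Longrightarrow>
          \<Union>\<U> = topspace X \<Longrightarrow>
          bij_betw (\<lambda>x. \<lambda>U\<in>\<U>. Map h n (subtopology X U) (A \<inter> U) X A id x)
            (carrier (Grp h n X A)) (\<Pi>\<^sub>E U\<in>\<U>. carrier (Grp h n (subtopology X U) (A \<inter> U)))"

text \<open>
  Cup products are only required for subspaces that are open in their union; this contains the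
  cases \<open>A = {}\<close> and \<open>B = {}\<close>, and such triads are excisive for every theory.
\<close>

definition cup_triad :: "'a topology \<Rightarrow> 'a set \<Rightarrow> 'a set \<Rightarrow> bool" where
  "cup_triad X A B \<longleftrightarrow> A \<subseteq> topspace X \<and> B \<subseteq> topspace X \<and>
     openin (subtopology X (A \<union> B)) A \<and> openin (subtopology X (A \<union> B)) B"

text \<open>
  Axiom \<open>Cup_Del\<close> is \<open>\<delta>\<^sub>A (x \<union> y|A) = \<delta> x \<union> y\<close>, where \<open>\<delta>\<^sub>A\<close> is the composite
  \<open>h(A, A \<inter> B) \<cong> h(A \<union> B, B) \<rightarrow> h(A \<union> B) \<rightarrow> h(X, A \<union> B)\<close>; the inverse of the excision isomorphism
  is expressed by the element \<open>w\<close>. The mirrored axiom (with its sign) follows by commutativity.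
\<close>

locale multiplicative_cohomology = additive_cohomology h
  for h :: "('u, 'g) cohomology" +
  assumes Cup_hom_left: "cup_triad X A B \<Longrightarrow> y \<in> carrier (Grp h q X B) \<Longrightarrow>
          (\<lambda>x. Cup h p q X A B x y) \<in> hom (Grp h p X A) (Grp h (p + q) X (A \<union> B))"
    and Cup_hom_right: "cup_triad X A B \<Longrightarrow> x \<in> carrier (Grp h p X A) \<Longrightarrow>
          (\<lambda>y. Cup h p q X A B x y) \<in> hom (Grp h q X B) (Grp h (p + q) X (A \<union> B))"
    and Cup_natural: "cup_triad X A B \<Longrightarrow> cup_triad Y C D \<Longrightarrow>
          pair_map X A Y C f \<Longrightarrow> pair_map X B Y D f \<Longrightarrow>
          x \<in> carrier (Grp h p Y C) \<Longrightarrow> y \<in> carrier (Grp h q Y D) \<Longrightarrow>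
          Map h (p + q) X (A \<union> B) Y (C \<union> D) f (Cup h p q Y C D x y) =
          Cup h p q X A B (Map h p X A Y C f x) (Map h q X B Y D f y)"
    and Cup_assoc: "cup_triad X A B \<Longrightarrow> cup_triad X (A \<union> B) C \<Longrightarrow>
          cup_triad X B C \<Longrightarrow> cup_triad X A (B \<union> C) \<Longrightarrow>
          x \<in> carrier (Grp h p X A) \<Longrightarrow> y \<in> carrier (Grp h q X B) \<Longrightarrow> z \<in> carrier (Grp h r X C) \<Longrightarrow>
          Cup h (p + q) r X (A \<union> B) C (Cup h p q X A B x y) z =
          Cup h p (q + r) X A (B \<union> C) x (Cup h q r X B C y z)"
    and Cup_commute: "cup_triad X A B \<Longrightarrow>
          x \<in> carrier (Grp h p X A) \<Longrightarrow> y \<in> carrier (Grp h q X B) \<Longrightarrow>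
          Cup h q p X B A y x =
            (if even p \<or> even q then Cup h p q X A B x y
             else inv\<^bsub>Grp h (p + q) X (A \<union> B)\<^esub> (Cup h p q X A B x y))"
    and Unit_closed: "Unit h X \<in> carrier (Grp h 0 X {})"
    and Unit_natural: "continuous_map X Y f \<Longrightarrow> Map h 0 X {} Y {} f (Unit h Y) = Unit h X"
    and Cup_Unit: "A \<subseteq> topspace X \<Longrightarrow> x \<in> carrier (Grp h p X A) \<Longrightarrow>
          Cup h 0 p X {} A (Unit h X) x = x"
    and Cup_Del: "cup_triad X A B \<Longrightarrow>
          x \<in> carrier (Grp h p (subtopology X A) {}) \<Longrightarrow> y \<in> carrier (Grp h q X B) \<Longrightarrow>
          w \<in> carrier (Grp h (p + q) (subtopology X (A \<union> B)) B) \<Longrightarrow>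
          Map h (p + q) (subtopology X A) (A \<inter> B) (subtopology X (A \<union> B)) B id w =
            Cup h p q (subtopology X A) {} (A \<inter> B) x (Map h q (subtopology X A) (A \<inter> B) X B id y) \<Longrightarrow>
          Del h (p + q) X (A \<union> B)
            (Map h (p + q) (subtopology X (A \<union> B)) {} (subtopology X (A \<union> B)) B id w) =
          Cup h (p + 1) q X A B (Del h p X A x) y"


section \<open>Weak equivalences and fibrations\<close>

definition cube :: "nat \<Rightarrow> (nat \<Rightarrow> real) topology" where
  "cube n = subtopology (Euclidean_space n) {x. \<forall>i<n. 0 \<le> x i \<and> x i \<le> 1}"

definition cube_boundary :: "nat \<Rightarrow> (nat \<Rightarrow> real) set" where
  "cube_boundary n = {x \<in> topspace (cube n). \<exists>i<n. x i = 0 \<or> x i = 1}"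

text \<open>
  The set \<open>\<pi>\<^sub>n(X, x)\<close> is the quotient of \<open>spheroids n X x\<close> by \<open>spheroid_homotopic n X x\<close>.
  For \<open>n = 0\<close> the boundary of the cube is empty, and this is the set of path components.
\<close>

definition spheroids :: "nat \<Rightarrow> 'a topology \<Rightarrow> 'a \<Rightarrow> ((nat \<Rightarrow> real) \<Rightarrow> 'a) set" where
  "spheroids n X x = {c. continuous_map (cube n) X c \<and> c \<in> cube_boundary n \<rightarrow> {x}}"

definition spheroid_homotopic ::
    "nat \<Rightarrow> 'a topology \<Rightarrow> 'a \<Rightarrow> ((nat \<Rightarrow> real) \<Rightarrow> 'a) \<Rightarrow> ((nat \<Rightarrow> real) \<Rightarrow> 'a) \<Rightarrow> bool" where
  "spheroid_homotopic n X x = homotopic_with (\<lambda>c. c \<in> cube_boundary n \<rightarrow> {x}) (cube n) X"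

text \<open>
  Bijectivity of \<open>\<pi>\<^sub>n(X, x) \<rightarrow> \<pi>\<^sub>n(Y, f x)\<close> for all \<open>n \<ge> 0\<close> and all \<open>x\<close>. The condition on
  nonemptiness is needed because there is no base point if \<open>X\<close> is empty.
\<close>

definition weak_equivalence :: "'a topology \<Rightarrow> 'b topology \<Rightarrow> ('a \<Rightarrow> 'b) \<Rightarrow> bool" where
  "weak_equivalence X Y f \<longleftrightarrow> continuous_map X Y f \<and>
     (topspace X = {} \<longrightarrow> topspace Y = {}) \<and>
     (\<forall>n. \<forall>x\<in>topspace X.
        (\<forall>c\<in>spheroids n X x. \<forall>d\<in>spheroids n X x.
           spheroid_homotopic n Y (f x) (f \<circ> c) (f \<circ> d) \<longrightarrow> spheroid_homotopic n X x c d) \<and>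
        (\<forall>e\<in>spheroids n Y (f x). \<exists>c\<in>spheroids n X x. spheroid_homotopic n Y (f x) (f \<circ> c) e))"

definition weak_equivalence_invariant :: "('u, 'g) cohomology \<Rightarrow> bool" where
  "weak_equivalence_invariant h \<longleftrightarrow>
     (\<forall>X Y f n. weak_equivalence X Y f \<longrightarrow> Map h n X {} Y {} f \<in> iso (Grp h n Y {}) (Grp h n X {}))"

definition homotopy_lifting ::
    "'w topology \<Rightarrow> 'e topology \<Rightarrow> 'b topology \<Rightarrow> ('e \<Rightarrow> 'b) \<Rightarrow> bool" where
  "homotopy_lifting W E B p \<longleftrightarrow>
     (\<forall>f H. continuous_map W E f \<and> continuous_map (prod_topology W (top_of_set {0..1::real})) B H \<and>
            (\<forall>w\<in>topspace W. H (w, 0) = p (f w)) \<longrightarrow>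
        (\<exists>G. continuous_map (prod_topology W (top_of_set {0..1::real})) E G \<and>
             (\<forall>w\<in>topspace W. G (w, 0) = f w) \<and>
             (\<forall>w\<in>topspace W. \<forall>t\<in>{0..1}. p (G (w, t)) = H (w, t))))"

text \<open>
  Test spaces with points in \<open>'e \<times> (real \<Rightarrow> 'b)\<close> suffice for the homotopy lifting property with
  respect to all spaces: they include the universal one, the space of pairs \<open>(e, \<gamma>)\<close> of a point
  \<open>e\<close> of \<open>E\<close> and a path \<open>\<gamma>\<close> in \<open>B\<close> starting at \<open>p e\<close>.
\<close>

definition hurewicz_fibration :: "'e topology \<Rightarrow> 'b topology \<Rightarrow> ('e \<Rightarrow> 'b) \<Rightarrow> bool" where
  "hurewicz_fibration E B p \<longleftrightarrow> continuous_map E B p \<and>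
     (\<forall>W :: ('e \<times> (real \<Rightarrow> 'b)) topology. homotopy_lifting W E B p)"

definition serre_fibration :: "'e topology \<Rightarrow> 'b topology \<Rightarrow> ('e \<Rightarrow> 'b) \<Rightarrow> bool" where
  "serre_fibration E B p \<longleftrightarrow> continuous_map E B p \<and> (\<forall>n. homotopy_lifting (cube n) E B p)"


section \<open>Smooth manifolds\<close>

definition partial_deriv :: "nat \<Rightarrow> ((nat \<Rightarrow> real) \<Rightarrow> real) \<Rightarrow> (nat \<Rightarrow> real) \<Rightarrow> real" where
  "partial_deriv i f x = deriv (\<lambda>t. f (x(i := t))) (x i)"

text \<open>\<open>S\<close> is meant to be open in \<open>Euclidean_space m\<close>.\<close>

primrec C_k_on :: "nat \<Rightarrow> nat \<Rightarrow> (nat \<Rightarrow> real) set \<Rightarrow> ((nat \<Rightarrow> real) \<Rightarrow> real) \<Rightarrow> bool" where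
  "C_k_on 0 m S f \<longleftrightarrow> continuous_map (subtopology (Euclidean_space m) S) euclideanreal f"
| "C_k_on (Suc k) m S f \<longleftrightarrow>
     continuous_map (subtopology (Euclidean_space m) S) euclideanreal f \<and>
     (\<forall>i<m. (\<forall>x\<in>S. (\<lambda>t. f (x(i := t))) differentiable (at (x i))) \<and>
            C_k_on k m S (partial_deriv i f))"

definition smooth_on ::
    "nat \<Rightarrow> nat \<Rightarrow> (nat \<Rightarrow> real) set \<Rightarrow> ((nat \<Rightarrow> real) \<Rightarrow> nat \<Rightarrow> real) \<Rightarrow> bool" where
  "smooth_on m n S f \<longleftrightarrow> (\<forall>j<n. \<forall>k. C_k_on k m S (\<lambda>x. f x j))"

text \<open>A chart is a pair of its domain and its coordinate map.\<close>

type_synonym 'a chart = "'a set \<times> ('a \<Rightarrow> nat \<Rightarrow> real)"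

definition chart_change :: "'a chart \<Rightarrow> 'a chart \<Rightarrow> (nat \<Rightarrow> real) \<Rightarrow> nat \<Rightarrow> real" where
  "chart_change c d y = snd d (inv_into (fst c) (snd c) y)"

definition smooth_manifold :: "nat \<Rightarrow> 'a topology \<Rightarrow> 'a chart set \<Rightarrow> bool" where
  "smooth_manifold m M \<A> \<longleftrightarrow>
     Hausdorff_space M \<and>
     (\<exists>\<B>. countable \<B> \<and> (\<forall>V\<in>\<B>. openin M V) \<and>
          (\<forall>U x. openin M U \<and> x \<in> U \<longrightarrow> (\<exists>V\<in>\<B>. x \<in> V \<and> V \<subseteq> U))) \<and>
     topspace M = (\<Union>c\<in>\<A>. fst c) \<and>
     (\<forall>c\<in>\<A>. openin M (fst c) \<and> openin (Euclidean_space m) (snd c ` fst c) \<and>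
        homeomorphic_map (subtopology M (fst c)) (subtopology (Euclidean_space m) (snd c ` fst c)) (snd c)) \<and>
     (\<forall>c\<in>\<A>. \<forall>d\<in>\<A>. smooth_on m m (snd c ` (fst c \<inter> fst d)) (chart_change c d))"

definition smooth_map ::
    "nat \<Rightarrow> 'a topology \<Rightarrow> 'a chart set \<Rightarrow> nat \<Rightarrow> 'b topology \<Rightarrow> 'b chart set \<Rightarrow> ('a \<Rightarrow> 'b) \<Rightarrow> bool" where
  "smooth_map l L \<A> m M \<B> f \<longleftrightarrow> continuous_map L M f \<and>
     (\<forall>c\<in>\<A>. \<forall>d\<in>\<B>.
        smooth_on l m (snd c ` (fst c \<inter> f -` fst d)) (\<lambda>y. snd d (f (inv_into (fst c) (snd c) y))))"


section \<open>Tangent bundles, Thom classes and Euler classes\<close>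

definition charts_at :: "'a chart set \<Rightarrow> 'a \<Rightarrow> 'a chart set" where
  "charts_at \<A> x = {c \<in> \<A>. x \<in> fst c}"

text \<open>
  A tangent vector at \<open>x\<close> assigns to each chart around \<open>x\<close> its coordinates in that chart,
  the coordinates being related by the Jacobian matrices of the chart changes.
\<close>

definition tangent_space :: "nat \<Rightarrow> 'a chart set \<Rightarrow> 'a \<Rightarrow> ('a chart \<Rightarrow> nat \<Rightarrow> real) set" where
  "tangent_space m \<A> x =
     {v \<in> (\<Pi>\<^sub>E c\<in>charts_at \<A> x. topspace (Euclidean_space m)).
        \<forall>c\<in>charts_at \<A> x. \<forall>d\<in>charts_at \<A> x. \<forall>j<m.
          v d j = (\<Sum>i<m. partial_deriv i (\<lambda>y. chart_change c d y j) (snd c x) * v c i)}"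

text \<open>
  The topology of the total space is the one for which the maps \<open>(x, v) \<mapsto> (snd c x, v c)\<close>
  are homeomorphisms from the open subsets over the domains of the charts \<open>c\<close>.
\<close>

definition tangent_bundle ::
    "nat \<Rightarrow> 'a chart set \<Rightarrow> ('a \<times> ('a chart \<Rightarrow> nat \<Rightarrow> real)) topology" where
  "tangent_bundle m \<A> = topology_generated_by
     {{(x, v). x \<in> fst c \<and> v \<in> tangent_space m \<A> x \<and> (snd c x, v c) \<in> V} | c V.
        c \<in> \<A> \<and> openin (prod_topology (Euclidean_space m) (Euclidean_space m)) V}"

definition tangent_zero :: "'a chart set \<Rightarrow> 'a \<Rightarrow> 'a \<times> ('a chart \<Rightarrow> nat \<Rightarrow> real)" where
  "tangent_zero \<A> x = (x, \<lambda>c\<in>charts_at \<A> x. \<lambda>i. 0)"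

text \<open>
  Let \<open>\<pi> : E \<rightarrow> B\<close> be a vector bundle of rank \<open>m\<close> with zero section \<open>z\<close>.
  A class in \<open>h\<^sup>m(E, E - z(B))\<close> is a Thom class if its restriction to each fibre
  \<open>(E\<^sub>x, E\<^sub>x - 0)\<close> is a basis of \<open>h\<^sup>*(E\<^sub>x, E\<^sub>x - 0)\<close> as a module over \<open>h\<^sup>*({x})\<close>.
\<close>

definition thom_class ::
    "('u, 'g) cohomology \<Rightarrow> nat \<Rightarrow> 'u topology \<Rightarrow> 'u topology \<Rightarrow> ('u \<Rightarrow> 'u) \<Rightarrow> ('u \<Rightarrow> 'u) \<Rightarrow> 'g \<Rightarrow> bool" where
  "thom_class h m B E \<pi> z u \<longleftrightarrow>
     u \<in> carrier (Grp h (int m) E (topspace E - z ` topspace B)) \<and>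
     (\<forall>x\<in>topspace B.
        let F = {e \<in> topspace E. \<pi> e = x};
            Ex = subtopology E F;
            ux = Map h (int m) Ex (F - {z x}) E (topspace E - z ` topspace B) id u
        in \<forall>k. bij_betw
             (\<lambda>a. Cup h k (int m) Ex {} (F - {z x}) (Map h k Ex {} (subtopology B {x}) {} \<pi> a) ux)
             (carrier (Grp h k (subtopology B {x}) {}))
             (carrier (Grp h (k + int m) Ex (F - {z x}))))"

definition euler_class ::
    "('u, 'g) cohomology \<Rightarrow> nat \<Rightarrow> 'u topology \<Rightarrow> 'u topology \<Rightarrow> ('u \<Rightarrow> 'u) \<Rightarrow> 'g \<Rightarrow> 'g" where
  "euler_class h m B E z u = Map h (int m) B {} E (topspace E - z ` topspace B) z u"


section \<open>Free loop spaces\<close>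

definition mapping_space :: "'a topology \<Rightarrow> 'b topology \<Rightarrow> ('a \<Rightarrow> 'b) topology" where
  "mapping_space X Y = topology_generated_by
     {{f \<in> extensional (topspace X). continuous_map X Y f \<and> f ` K \<subseteq> U} | K U.
        compactin X K \<and> openin Y U}"

abbreviation circle :: "complex set" where
  "circle \<equiv> sphere 0 1"

definition free_loop_space :: "'a topology \<Rightarrow> (complex \<Rightarrow> 'a) topology" where
  "free_loop_space M = mapping_space (top_of_set circle) M"

definition relative_loop_space ::
    "'b topology \<Rightarrow> 'a topology \<Rightarrow> ('b \<Rightarrow> 'a) \<Rightarrow> ('b \<times> (complex \<Rightarrow> 'a)) topology" where
  "relative_loop_space N M g =
     subtopology (prod_topology N (free_loop_space M)) {(n, w). g n = w 1}"

definition constant_loop_section :: "('b \<Rightarrow> 'a) \<Rightarrow> 'b \<Rightarrow> 'b \<times> (complex \<Rightarrow> 'a)" where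
  "constant_loop_section g n = (n, \<lambda>s\<in>circle. g n)"

end

theory Submission
  imports Defs
begin

text \<open>
  For a loop \<open>w\<close> and \<open>t \<in> [0, 1]\<close> let \<open>D\<close> be the closed
  set of pairs \<open>(t, w)\<close> with \<open>w 0 = w t\<close>, and \<open>U\<close> the open set on which \<open>(w 0, w t)\<close> lies in a
  neighbourhood \<open>\<Omega>\<close> of the diagonal of \<open>M\<close>. On \<open>\<Omega>\<close> there are a continuous choice of paths from \<open>y\<close>
  to \<open>x\<close>, constant if \<open>x = y\<close>, and a continuous vector \<open>\<phi> (x, y)\<close> tangent at \<open>x\<close> that vanishes only if
  \<open>x = y\<close>. Over \<open>U\<close> the loop \<open>w\<close> restricted to \<open>[0, t]\<close> can be closed to a loop \<open>r (t, w)\<close>, and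
  \<open>\<phi> (w 0, w t)\<close> pulls the Thom class back to \<open>(U, U - D)\<close>. By excision \<open>r\<^sup>* b \<union> \<phi>\<^sup>* u\<close> extends
  by zero to all pairs \<open>(t, w)\<close>. Its restrictions to \<open>t = 0\<close> and \<open>t = 1\<close> agree by homotopy; they are
  \<open>p\<^sup>* \<sigma>\<^sup>* b \<union> p\<^sup>* g\<^sup>* e\<close>, as \<open>r (0, w)\<close> is constant, and \<open>b \<union> p\<^sup>* g\<^sup>* e\<close>, as \<open>r (1, w)\<close> is \<open>w\<close>
  up to reparametrization.
\<close>

section \<open>Products of supported classes\<close>

text \<open>The obstacle is that an initial segment of a loop is not a loop, so shrinking a loop
  along its own parameter leaves the loop space. The Euler class helps because it is the restriction
  of a class supported near the zero section: the product has to be defined only where the gap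
  between the ends of the segment is small. The paths and the vector \<phi> take the place of a
  tubular neighbourhood of the diagonal and of the inverse of an exponential map. No metric is
  chosen; both come from straight lines in countably many charts, and the problem is to combine
  different charts. For the paths, the moves along the charts are made one after the other. For the
  vectors, the displacements are added with weights; their sum cannot cancel, since near the
  diagonal each has a positive scalar product with the difference of coordinates in one fixed chart.
  That comparison must hold uniformly for all pairs of points near a given one, hence the use of
  strict differentiability. Since \<open>h\<close> accepts only spaces with points in
  \<open>'u\<close>, the space of pairs of a time and a loop is finally copied into
  \<open>'u\<close>.\<close>

lemma (in additive_cohomology) Map_closed:
  assumes "pair_map X A Y B f" "y \<in> carrier (Grp h n Y B)"
  shows "Map h n X A Y B f y \<in> carrier (Grp h n X A)"
  using Map_hom[OF assms(1)] assms(2) by (auto simp: hom_def)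

lemma (in additive_cohomology) Map_one:
  assumes "pair_map X A Y B f"
  shows "Map h n X A Y B f \<one>\<^bsub>Grp h n Y B\<^esub> = \<one>\<^bsub>Grp h n X A\<^esub>"
proof -
  have "A \<subseteq> topspace X" "B \<subseteq> topspace Y"
    using assms by (auto simp: pair_map_def)
  then interpret group_hom "Grp h n Y B" "Grp h n X A" "Map h n X A Y B f"
    using Grp_group Map_hom[OF assms] by (simp add: group_hom_def group_hom_axioms_def comm_group_def)
  show ?thesis by (rule hom_one)
qed

lemma (in additive_cohomology) Map_cong:
  assumes "pair_map X A Y B f" "\<And>x. x \<in> topspace X \<Longrightarrow> f x = f' x" "y \<in> carrier (Grp h n Y B)"
  shows "Map h n X A Y B f y = Map h n X A Y B f' y"
proof (rule homotopy)
  have "f' \<in> A \<rightarrow> B"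
    using assms(1,2) by (metis (no_types, lifting) Pi_iff pair_map_def subsetD)
  with assms(1,2) show "homotopic_with (\<lambda>k. k \<in> A \<rightarrow> B) X Y f f'"
    by (intro homotopic_with_equal) (auto simp: pair_map_def)
qed (use assms in \<open>auto simp: pair_map_def\<close>)

text \<open>
  The product of a class on \<open>U\<close> with one on \<open>(U, U - D)\<close> extends to \<open>(Z, Z - D)\<close> by excision, so
  its pullbacks along homotopic maps into \<open>Z\<close> agree even though the homotopy leaves \<open>U\<close>.
\<close>

lemma (in multiplicative_cohomology) Cup_supported_homotopy:
  fixes X Y Z T :: "'u topology"
  assumes D: "closedin Z D" and U: "openin Z U" and DU: "D \<subseteq> U"
    and i: "homotopic_with (\<lambda>_. True) X Z i j"
    and iD: "i \<in> topspace X \<rightarrow> D" and jD: "j \<in> topspace X \<rightarrow> D"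
    and r: "continuous_map (subtopology Z U) Y r" and b: "b \<in> carrier (Grp h k Y {})"
    and \<phi>: "pair_map (subtopology Z U) (U - D) T B \<phi>" and u: "u \<in> carrier (Grp h n T B)"
  shows "Cup h k n X {} {} (Map h k X {} Y {} (r \<circ> i) b) (Map h n X {} T B (\<phi> \<circ> i) u) =
         Cup h k n X {} {} (Map h k X {} Y {} (r \<circ> j) b) (Map h n X {} T B (\<phi> \<circ> j) u)"
proof -
  let ?ZU = "subtopology Z U" and ?A = "topspace Z - D"
  have UZ: "U \<subseteq> topspace Z" using U by (rule openin_subset)
  have r': "pair_map ?ZU {} Y {} r" using r by (simp add: pair_map_def)
  define R where "R = Map h k ?ZU {} Y {} r b"
  define S where "S = Map h n ?ZU (U - D) T B \<phi> u"
  have R: "R \<in> carrier (Grp h k ?ZU {})" unfolding R_def by (rule Map_closed[OF r' b])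
  have S: "S \<in> carrier (Grp h n ?ZU (U - D))" unfolding S_def by (rule Map_closed[OF \<phi> u])
  have triad: "cup_triad ?ZU {} (U - D)"
    using UZ by (auto simp: cup_triad_def openin_subtopology_refl)
  have "Cup h k n ?ZU {} (U - D) R S \<in> carrier (Grp h (k + n) ?ZU (U - D))"
    using Cup_hom_left[OF triad S] R by (auto simp: hom_def)
  moreover have "Map h (k + n) ?ZU (U - D) Z ?A id \<in> iso (Grp h (k + n) Z ?A) (Grp h (k + n) ?ZU (U - D))"
  proof -
    \<comment> \<open>The complement of \<open>U\<close> is excised: it is closed and, as
      \<open>D \<subseteq> U\<close>, contained in the open set \<open>?A\<close>.\<close>
    have "topspace Z - (topspace Z - U) = U" "?A - (topspace Z - U) = U - D"
      using UZ by auto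
    moreover have "Z closure_of (topspace Z - U) = topspace Z - U"
      using U UZ by (simp add: closure_of_eq closedin_def double_diff)
       
    moreover have "Z interior_of ?A = ?A"
      using D by (simp add: interior_of_openin closedin_def)
    moreover have "topspace Z - U \<subseteq> ?A" using DU by blast
    ultimately show ?thesis
      using excision[of "topspace Z - U" ?A Z "k + n"] by simp
  qed
  ultimately have "Cup h k n ?ZU {} (U - D) R S \<in> Map h (k + n) ?ZU (U - D) Z ?A id ` carrier (Grp h (k + n) Z ?A)"
    by (simp add: iso_def bij_betw_def)
  then obtain c where c: "c \<in> carrier (Grp h (k + n) Z ?A)"
    and cR: "Map h (k + n) ?ZU (U - D) Z ?A id c = Cup h k n ?ZU {} (U - D) R S"
    by (elim imageE) auto
  \<comment> \<open>The image of \<open>l\<close> lies in \<open>D \<subseteq> U\<close>, so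
    \<open>l\<close> factors through \<open>U\<close>, where \<open>c\<close> restricts to the
    product; naturality then evaluates the pullback of \<open>c\<close>.\<close>
  have restrict: "Cup h k n X {} {} (Map h k X {} Y {} (r \<circ> l) b) (Map h n X {} T B (\<phi> \<circ> l) u) =
      Map h (k + n) X {} Z ?A l c"
    if l: "continuous_map X Z l" "l \<in> topspace X \<rightarrow> D" for l
  proof -
    have lU: "continuous_map X ?ZU l"
      using l DU by (auto simp: continuous_map_in_subtopology)
    have pm: "pair_map X {} ?ZU {} l" "pair_map X {} ?ZU (U - D) l"
      "pair_map ?ZU (U - D) Z ?A id"
      using lU UZ by (auto simp: pair_map_def continuous_map_from_subtopology)
    have "Map h (k + n) X {} Z ?A l c = Map h (k + n) X {} ?ZU (U - D) l (Cup h k n ?ZU {} (U - D) R S)"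
      using Map_comp[OF pm(2,3) c] cR by simp
    also have "\<dots> = Cup h k n X {} {} (Map h k X {} ?ZU {} l R) (Map h n X {} ?ZU (U - D) l S)"
      using Cup_natural[of X "{}" "{}" ?ZU "{}" "U - D" l R k S n] triad pm R S
      by (simp add: cup_triad_def)
    also have "Map h k X {} ?ZU {} l R = Map h k X {} Y {} (r \<circ> l) b"
      unfolding R_def using Map_comp[OF pm(1) r' b] by simp
    also have "Map h n X {} ?ZU (U - D) l S = Map h n X {} T B (\<phi> \<circ> l) u"
      unfolding S_def using Map_comp[OF pm(2) \<phi> u] by simp
    finally show ?thesis by (simp add: o_def)
  qed
  \<comment> \<open>No subspace of \<open>X\<close> has to be preserved, so an arbitrary homotopy in
    \<open>Z\<close> is enough.\<close>
  have "Map h (k + n) X {} Z ?A i c = Map h (k + n) X {} Z ?A j c"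
    using i c by (intro homotopy) auto
  moreover have "continuous_map X Z i" "continuous_map X Z j"
    using i by (auto dest: homotopic_with_imp_continuous_maps)
  ultimately show ?thesis
    using restrict iD jD by simp
qed

section \<open>Copies of spaces inside the universe\<close>

lemma (in additive_cohomology) inj_real_prod:
  "\<exists>f :: real \<times> 'u \<Rightarrow> 'u. inj f"
proof -
  obtain a b :: 'u where ab: "a \<noteq> b" using universe_nontrivial by blast
  obtain code :: "(real \<Rightarrow> 'u) \<Rightarrow> 'u" where code: "inj code" using universe_closed by blast
  \<comment> \<open>A real \<open>t\<close> is coded by the indicator function of
    \<open>{t}\<close>; the outer function stores \<open>x\<close> at \<open>0\<close> and the code
    of \<open>t\<close> at every other argument.\<close>
  define f where "f = (\<lambda>(t, x). code (\<lambda>s. if s = 0 then x else code (\<lambda>s. if s = t then a else b)))"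
  have "t = t' \<and> x = x'" if "f (t, x) = f (t', x')" for t t' :: real and x x' :: 'u
  proof -
    have "(\<lambda>s :: real. if s = 0 then x else code (\<lambda>s. if s = t then a else b)) =
        (\<lambda>s. if s = 0 then x' else code (\<lambda>s. if s = t' then a else b))"
      by (rule injD[OF code]) (use that in \<open>simp add: f_def\<close>)
    note eq = fun_cong[OF this]
    have "(\<lambda>s :: real. if s = t then a else b) = (\<lambda>s. if s = t' then a else b)"
      by (rule injD[OF code]) (use eq[of 1] in simp)
    from fun_cong[OF this, of t] ab have "t = t'" by (simp split: if_splits)
    with eq[of 0] show ?thesis by simp
  qed
  then have "inj f" by (auto simp: inj_def)
  then show ?thesis by blast
qed

text \<open>Pulling the topology back along the inverse of \<open>f\<close> transports it to the
  image. This makes \<open>h\<close> applicable to a space of another type once its points inject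
  into \<open>'u\<close>.\<close>

lemma homeomorphic_copy:
  assumes "inj_on f (topspace X)"
  shows "\<exists>Y f'. homeomorphic_maps X Y f f'"
proof -
  let ?f' = "inv_into (topspace X) f"
  define Y where "Y = pullback_topology (f ` topspace X) ?f' X"
  have inv: "?f' (f x) = x" if "x \<in> topspace X" for x
    using that assms by (rule inv_into_f_f[rotated])
  have "topspace Y = f ` topspace X"
    unfolding Y_def topspace_pullback_topology using inv by auto
  moreover have "continuous_map Y X ?f'"
    using continuous_map_pullback[OF continuous_map_id[of X], of "f ` topspace X" ?f']
    by (simp add: Y_def)
  moreover have "continuous_map X Y f"
    unfolding Y_def using inv
    by (intro continuous_map_pullback') (auto intro!: continuous_map_eq[OF continuous_map_id])
  ultimately have "homeomorphic_maps X Y f ?f'"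
    using inv by (auto simp: homeomorphic_maps_def)
  then show ?thesis by blast
qed

section \<open>Strict differentiability in Euclidean space\<close>

text \<open>A basic open set of the product topology constrains each coordinate separately, and the
  coordinates from \<open>m\<close> on are fixed at \<open>0\<close>. So only the first
  \<open>m\<close> constraints matter, and their radii have a positive minimum.\<close>

lemma Euclidean_space_box:
  assumes "openin (Euclidean_space m) U" "a \<in> U"
  shows "\<exists>d>0. \<forall>x\<in>topspace (Euclidean_space m). (\<forall>i<m. \<bar>x i - a i\<bar> < d) \<longrightarrow> x \<in> U"
proof -
  have a: "a \<in> topspace (Euclidean_space m)"
    using assms openin_subset by blast
  obtain T where T: "openin (powertop_real UNIV) T" "U = T \<inter> {x. \<forall>i\<ge>m. x i = 0}"
    using assms(1) by (auto simp: Euclidean_space_def openin_subtopology)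
  then obtain V where V: "finite {i. V i \<noteq> UNIV}" "\<And>i. open (V i)" "a \<in> Pi\<^sub>E UNIV V" "Pi\<^sub>E UNIV V \<subseteq> T"
    using assms(2) unfolding openin_product_topology_alt by (auto; metis)
  have "\<forall>i. \<exists>d>0. \<forall>y. \<bar>y - a i\<bar> < d \<longrightarrow> y \<in> V i"
  proof
    fix i
    have "a i \<in> V i" using V(3) by auto
    with V(2)[of i] obtain d where "d > 0" "ball (a i) d \<subseteq> V i"
      unfolding open_contains_ball by blast
    then show "\<exists>d>0. \<forall>y. \<bar>y - a i\<bar> < d \<longrightarrow> y \<in> V i"
      by (intro exI[of _ d]) (auto simp: subset_iff dist_real_def abs_minus_commute)
  qed
  then obtain d where d: "\<And>i. d i > 0" "\<And>i y. \<bar>y - a i\<bar> < d i \<Longrightarrow> y \<in> V i"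
    by metis
  \<comment> \<open>The element \<open>1\<close> keeps the set nonempty when
    \<open>m = 0\<close>.\<close>
  let ?d = "Min (insert 1 (d ` {..<m}))"
  show ?thesis
  proof (intro exI[of _ ?d] conjI ballI impI)
    show "?d > 0" using d(1) by (subst Min_gr_iff) auto
    fix x assume x: "x \<in> topspace (Euclidean_space m)" "\<forall>i<m. \<bar>x i - a i\<bar> < ?d"
    have "x i \<in> V i" for i
    proof (cases "i < m")
      case True
      then have "?d \<le> d i" by (intro Min_le) auto
      with x(2) True have "\<bar>x i - a i\<bar> < d i" by (meson less_le_trans)
      then show ?thesis by (rule d(2))
    next
      case False
      then have "x i = a i" using x(1) a by (simp add: topspace_Euclidean_space)
      then show ?thesis using d(1)[of i] by (intro d(2)) simp
    qed
    then show "x \<in> U" using V(4) T(2) x(1) by (auto simp: topspace_Euclidean_space)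
  qed
qed

lemma continuous_map_Euclidean_coordinate:
  "continuous_map (Euclidean_space m) euclideanreal (\<lambda>x. x i)"
  unfolding Euclidean_space_def
  by (intro continuous_map_from_subtopology continuous_map_product_coordinates) auto

lemma continuous_map_into_Euclidean_space:
  assumes "\<And>i. i < m \<Longrightarrow> continuous_map X euclideanreal (\<lambda>x. f x i)"
    and "\<And>x i. x \<in> topspace X \<Longrightarrow> m \<le> i \<Longrightarrow> f x i = 0"
  shows "continuous_map X (Euclidean_space m) f"
proof (rule continuous_map_eq)
  show "continuous_map X (Euclidean_space m) (\<lambda>x i. if i < m then f x i else 0)"
    using assms(1) by (simp add: continuous_map_componentwise_Euclidean_space)
qed (use assms(2) in auto)

text \<open>Telescoping along the coordinates and the mean value theorem in each of them.\<close>

lemma strict_differentiability: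
  assumes S: "openin (Euclidean_space m) S" "a \<in> S" and f: "C_k_on 1 m S f" and e: "e > 0"
  shows "\<exists>d>0. \<forall>x\<in>topspace (Euclidean_space m). \<forall>y\<in>topspace (Euclidean_space m).
      (\<forall>i<m. \<bar>x i - a i\<bar> < d) \<longrightarrow> (\<forall>i<m. \<bar>y i - a i\<bar> < d) \<longrightarrow>
      \<bar>f y - f x - (\<Sum>i<m. partial_deriv i f x * (y i - x i))\<bar> \<le> e * (\<Sum>i<m. \<bar>y i - x i\<bar>)"
proof -
  let ?E = "Euclidean_space m"
  \<comment> \<open>On \<open>G\<close> all partial derivatives are within \<open>e/2\<close> of
    their values at \<open>a\<close>. This is spent twice: on the mean value estimate with slopes at
    \<open>a\<close>, and on replacing the slopes at \<open>a\<close> by those at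
    \<open>x\<close>.\<close>
  define G where "G = S \<inter> (\<Inter>i\<in>{..<m}. {x \<in> S. partial_deriv i f x \<in> ball (partial_deriv i f a) (e/2)})"
  have St: "S \<subseteq> topspace ?E" using S(1) by (rule openin_subset)
  have diff: "(\<lambda>t. f (x(i := t))) differentiable (at (x i))" if "i < m" "x \<in> S" for i x
    using f that by simp
  have cont: "continuous_map (subtopology ?E S) euclideanreal (partial_deriv i f)" if "i < m" for i
    using f that by simp
  have "openin ?E {x \<in> S. partial_deriv i f x \<in> ball (partial_deriv i f a) (e/2)}" if "i < m" for i
  proof -
    have "openin (subtopology ?E S) {x \<in> topspace (subtopology ?E S). partial_deriv i f x \<in> ball (partial_deriv i f a) (e/2)}"
      by (rule openin_continuous_map_preimage[OF cont[OF that]]) simp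
    moreover have "topspace (subtopology ?E S) = S" using St by auto
    ultimately have "openin (subtopology ?E S) {x \<in> S. partial_deriv i f x \<in> ball (partial_deriv i f a) (e/2)}"
      by (simp only: topspace_subtopology)
    from openin_trans_full[OF this S(1)] show ?thesis .
  qed
  then have "openin ?E G"
    \<comment> \<open>An empty indexed intersection is the whole type, so \<open>m = 0\<close> is
      treated apart.\<close>
    unfolding G_def by (cases "m = 0") (use S(1) in \<open>auto intro!: openin_Int openin_INT2\<close>)
  moreover have "a \<in> G" unfolding G_def using S(2) e by auto
  ultimately obtain d where d: "d > 0"
    and G: "\<forall>x\<in>topspace ?E. (\<forall>i<m. \<bar>x i - a i\<bar> < d) \<longrightarrow> x \<in> G"
    using Euclidean_space_box by metis
  have dS: "x \<in> S" if "x \<in> topspace ?E" "\<And>i. i < m \<Longrightarrow> \<bar>x i - a i\<bar> < d" for x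
    using G that by (simp add: G_def)
  have dp: "\<bar>partial_deriv i f x - partial_deriv i f a\<bar> \<le> e/2"
    if "x \<in> topspace ?E" "\<And>i. i < m \<Longrightarrow> \<bar>x i - a i\<bar> < d" "i < m" for x i
  proof -
    have "partial_deriv i f x \<in> ball (partial_deriv i f a) (e/2)"
      using G that unfolding G_def by blast
    then show ?thesis by (simp add: dist_real_def abs_minus_commute)
  qed
  show ?thesis
  proof (intro exI[of _ d] conjI d ballI impI)
    fix x y assume xy: "x \<in> topspace ?E" "y \<in> topspace ?E" "\<forall>i<m. \<bar>x i - a i\<bar> < d" "\<forall>i<m. \<bar>y i - a i\<bar> < d"
    then have x: "x \<in> topspace ?E" "\<And>i. i < m \<Longrightarrow> \<bar>x i - a i\<bar> < d"
      and y: "y \<in> topspace ?E" "\<And>i. i < m \<Longrightarrow> \<bar>y i - a i\<bar> < d"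
      by auto
    \<comment> \<open>Corners of a path from \<open>x\<close> to \<open>y\<close> that changes one
      coordinate at a time, so that one-variable calculus applies between consecutive
      corners.\<close>
    define z where "z = (\<lambda>k i. if i < k then y i else x i)"
    have seg: "(z k)(k := t) \<in> topspace ?E \<and> (\<forall>i<m. \<bar>((z k)(k := t)) i - a i\<bar> < d)"
      if "k < m" "min (x k) (y k) \<le> t" "t \<le> max (x k) (y k)" for k t
    proof -
      have "\<bar>t - a k\<bar> < d" using that x(2)[OF that(1)] y(2)[OF that(1)] by linarith
      with that(1) x y show ?thesis by (simp add: z_def topspace_Euclidean_space)
    qed
    have step: "\<bar>f (z (Suc k)) - f (z k) - partial_deriv k f a * (y k - x k)\<bar> \<le> e/2 * \<bar>y k - x k\<bar>"
      if k: "k < m" for k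
    proof -
      \<comment> \<open>Subtracting the linear function with slope at \<open>a\<close> leaves a
        function whose derivative is at most \<open>e/2\<close> in absolute value.\<close>
      let ?g = "\<lambda>t. f ((z k)(k := t)) - partial_deriv k f a * t"
      have der: "(?g has_real_derivative (partial_deriv k f ((z k)(k := t)) - partial_deriv k f a)) (at t)"
        if t: "min (x k) (y k) \<le> t" "t \<le> max (x k) (y k)" for t
      proof -
        have "(z k)(k := t) \<in> S" using seg[OF k t] dS by blast
        from diff[OF k this] have "(\<lambda>t'. f ((z k)(k := t'))) differentiable (at t)"
          by simp
        then have "((\<lambda>t'. f ((z k)(k := t'))) has_real_derivative partial_deriv k f ((z k)(k := t))) (at t)"
          unfolding partial_deriv_def
          by (simp add: DERIV_deriv_iff_real_differentiable)
        then show ?thesis by (auto intro!: derivative_eq_intros)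
      qed
      have "norm (?g (y k) - ?g (x k)) \<le> e/2 * norm (y k - x k)"
      proof (rule field_differentiable_bound[where S = "{min (x k) (y k)..max (x k) (y k)}"])
        fix t assume "t \<in> {min (x k) (y k)..max (x k) (y k)}"
        then have t: "min (x k) (y k) \<le> t" "t \<le> max (x k) (y k)" by simp_all
        show "(?g has_field_derivative (partial_deriv k f ((z k)(k := t)) - partial_deriv k f a))
            (at t within {min (x k) (y k)..max (x k) (y k)})"
          by (rule has_field_derivative_at_within[OF der[OF t]])
        have "(z k)(k := t) \<in> topspace ?E" "\<And>i. i < m \<Longrightarrow> \<bar>((z k)(k := t)) i - a i\<bar> < d"
          using seg[OF k t] by blast+
        from dp[OF this k] show "norm (partial_deriv k f ((z k)(k := t)) - partial_deriv k f a) \<le> e/2"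
          by (simp only: real_norm_def)
      qed simp_all
      moreover have "(z k)(k := y k) = z (Suc k)" "(z k)(k := x k) = z k"
        by (auto simp: z_def fun_eq_iff less_Suc_eq)
      ultimately show ?thesis by (simp add: algebra_simps)
    qed
    have "z m = y" "z 0 = x"
      using x y by (auto simp: z_def fun_eq_iff topspace_Euclidean_space)
    then have tel: "f y - f x = (\<Sum>k<m. f (z (Suc k)) - f (z k))"
      using sum_lessThan_telescope[of "\<lambda>k. f (z k)" m] by simp
    have "\<bar>f y - f x - (\<Sum>i<m. partial_deriv i f x * (y i - x i))\<bar> =
        \<bar>\<Sum>k<m. (f (z (Suc k)) - f (z k) - partial_deriv k f a * (y k - x k)) -
           (partial_deriv k f x - partial_deriv k f a) * (y k - x k)\<bar>"
      unfolding tel by (simp add: sum_subtractf[symmetric] algebra_simps)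
    also have "\<dots> \<le> (\<Sum>k<m. e * \<bar>y k - x k\<bar>)"
    proof (intro order.trans[OF sum_abs] sum_mono)
      fix k assume "k \<in> {..<m}"
      then have k: "k < m" by simp
      have "\<bar>(partial_deriv k f x - partial_deriv k f a) * (y k - x k)\<bar> \<le> e/2 * \<bar>y k - x k\<bar>"
        unfolding abs_mult by (intro mult_right_mono dp[OF x k]) auto
      with step[OF k]
      show "\<bar>(f (z (Suc k)) - f (z k) - partial_deriv k f a * (y k - x k)) -
           (partial_deriv k f x - partial_deriv k f a) * (y k - x k)\<bar> \<le> e * \<bar>y k - x k\<bar>"
        by linarith
    qed
    finally show "\<bar>f y - f x - (\<Sum>i<m. partial_deriv i f x * (y i - x i))\<bar> \<le> e * (\<Sum>i<m. \<bar>y i - x i\<bar>)"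
      by (simp add: sum_distrib_left)
  qed
qed

text \<open>The difference quotient of \<open>f\<close> along the curve is compared with the
  corresponding combination of the quotients of the coordinates. Strict differentiability makes the
  remainder a small multiple of the sum of their absolute values, which stays bounded near
  \<open>t0\<close>.\<close>

lemma partial_deriv_chain:
  assumes S: "openin (Euclidean_space m) S" "\<gamma> t0 \<in> S" and f: "C_k_on 1 m S f"
    and \<gamma>: "\<And>i. i < m \<Longrightarrow> ((\<lambda>t. \<gamma> t i) has_real_derivative \<gamma>' i) (at t0)"
    and E: "\<forall>\<^sub>F t in at t0. \<gamma> t \<in> topspace (Euclidean_space m)"
  shows "((\<lambda>t. f (\<gamma> t)) has_real_derivative (\<Sum>i<m. partial_deriv i f (\<gamma> t0) * \<gamma>' i)) (at t0)"
proof -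
  let ?a = "\<gamma> t0"
  let ?q = "\<lambda>i t. (\<gamma> t i - ?a i) / (t - t0)"
  let ?p = "\<lambda>i. partial_deriv i f ?a"
  let ?r = "\<lambda>t. (f (\<gamma> t) - f ?a) / (t - t0) - (\<Sum>i<m. ?p i * ?q i t)"
  have a: "?a \<in> topspace (Euclidean_space m)" using S openin_subset by blast
  have q: "(?q i \<longlongrightarrow> \<gamma>' i) (at t0)" if "i < m" for i
    using \<gamma>[OF that] by (simp add: has_field_derivative_iff)
  have lim: "((\<lambda>t. \<Sum>i<m. ?p i * ?q i t) \<longlongrightarrow> (\<Sum>i<m. ?p i * \<gamma>' i)) (at t0)"
    by (intro tendsto_sum tendsto_mult tendsto_const q) auto
  have "(?r \<longlongrightarrow> 0) (at t0)"
  proof (rule tendstoI)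
    fix \<epsilon> :: real assume \<epsilon>: "\<epsilon> > 0"
    \<comment> \<open>A bound for the sum of the absolute quotients near \<open>t0\<close>; the
      summand \<open>1\<close> makes it strict and positive. The factor \<open>2\<close> used with
      it below leaves \<open>\<epsilon>/2 < \<epsilon>\<close>.\<close>
    define B where "B = (\<Sum>i<m. \<bar>\<gamma>' i\<bar>) + 1"
    have B: "B > 0" unfolding B_def by (intro add_nonneg_pos sum_nonneg) auto
    have "((\<lambda>t. \<Sum>i<m. \<bar>?q i t\<bar>) \<longlongrightarrow> (\<Sum>i<m. \<bar>\<gamma>' i\<bar>)) (at t0)"
      by (intro tendsto_sum tendsto_rabs q) auto
    then have ev1: "\<forall>\<^sub>F t in at t0. (\<Sum>i<m. \<bar>?q i t\<bar>) < B"
      by (rule order_tendstoD) (simp add: B_def)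
    have \<epsilon>B: "\<epsilon> / (2 * B) > 0" using \<epsilon> B by simp
    obtain d where d: "d > 0" and strict: "\<forall>x\<in>topspace (Euclidean_space m). \<forall>y\<in>topspace (Euclidean_space m).
      (\<forall>i<m. \<bar>x i - ?a i\<bar> < d) \<longrightarrow> (\<forall>i<m. \<bar>y i - ?a i\<bar> < d) \<longrightarrow>
      \<bar>f y - f x - (\<Sum>i<m. partial_deriv i f x * (y i - x i))\<bar> \<le> \<epsilon> / (2 * B) * (\<Sum>i<m. \<bar>y i - x i\<bar>)"
      using strict_differentiability[OF S f \<epsilon>B] by blast
    have "\<forall>\<^sub>F t in at t0. \<bar>\<gamma> t i - ?a i\<bar> < d" if "i < m" for i
    proof -
      have "((\<lambda>t. \<gamma> t i) \<longlongrightarrow> ?a i) (at t0)"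
        using DERIV_isCont[OF \<gamma>[OF that]] by (simp add: isCont_def)
      from tendstoD[OF this d] show ?thesis by (simp add: dist_real_def)
    qed
    then have ev2: "\<forall>\<^sub>F t in at t0. \<forall>i\<in>{..<m}. \<bar>\<gamma> t i - ?a i\<bar> < d"
      by (subst eventually_ball_finite_distrib) auto
    have "\<forall>\<^sub>F t in at t0. t \<noteq> t0" by (rule eventually_neq_at_within)
    with ev1 ev2 E show "\<forall>\<^sub>F t in at t0. dist (?r t) 0 < \<epsilon>"
    proof eventually_elim
      case (elim t)
      have s: "\<bar>f (\<gamma> t) - f ?a - (\<Sum>i<m. ?p i * (\<gamma> t i - ?a i))\<bar> \<le> \<epsilon> / (2 * B) * (\<Sum>i<m. \<bar>\<gamma> t i - ?a i\<bar>)"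
        using strict elim a d by auto
      have "(\<Sum>i<m. ?p i * ?q i t) = (\<Sum>i<m. ?p i * (\<gamma> t i - ?a i)) / (t - t0)"
        by (simp add: sum_divide_distrib)
      then have "?r t = (f (\<gamma> t) - f ?a - (\<Sum>i<m. ?p i * (\<gamma> t i - ?a i))) / (t - t0)"
        by (simp only: diff_divide_distrib)
      then have "\<bar>?r t\<bar> = \<bar>f (\<gamma> t) - f ?a - (\<Sum>i<m. ?p i * (\<gamma> t i - ?a i))\<bar> / \<bar>t - t0\<bar>"
        by (simp add: abs_divide)
      also have "\<dots> \<le> \<epsilon> / (2 * B) * (\<Sum>i<m. \<bar>\<gamma> t i - ?a i\<bar>) / \<bar>t - t0\<bar>"
        by (intro divide_right_mono s) auto
      also have "\<dots> = \<epsilon> / (2 * B) * (\<Sum>i<m. \<bar>?q i t\<bar>)"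
        by (simp only: sum_divide_distrib[symmetric] abs_divide times_divide_eq_right)
      also have "\<dots> \<le> \<epsilon> / (2 * B) * B"
        using elim \<epsilon> B by (intro mult_left_mono) auto
      also have "\<dots> < \<epsilon>" using \<epsilon> B by simp
      finally show ?case by (simp add: dist_real_def)
    qed
  qed
  from tendsto_add[OF this lim] show ?thesis
    by (simp add: has_field_derivative_iff)
qed

section \<open>Chart changes and their Jacobians\<close>

text \<open>The matrix occurring in \<open>tangent_space\<close>, with row index \<open>j\<close>
  before column index \<open>i\<close>, but evaluated at a point of the manifold instead of at its
  coordinates.\<close>

definition chart_jacobian :: "'a chart \<Rightarrow> 'a chart \<Rightarrow> 'a \<Rightarrow> nat \<Rightarrow> nat \<Rightarrow> real" where
  "chart_jacobian c d x j i = partial_deriv i (\<lambda>y. chart_change c d y j) (snd c x)"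

lemma eventually_fun_upd_in_open:
  assumes "openin (Euclidean_space m) S" "a \<in> S" "i < m"
  shows "\<forall>\<^sub>F t in nhds (a i). a(i := t) \<in> S"
proof -
  have a: "a \<in> topspace (Euclidean_space m)"
    using assms openin_subset by blast
  obtain d where d: "d > 0"
    "\<forall>x\<in>topspace (Euclidean_space m). (\<forall>i<m. \<bar>x i - a i\<bar> < d) \<longrightarrow> x \<in> S"
    using Euclidean_space_box[OF assms(1,2)] by blast
  have "a(i := t) \<in> S" if "dist t (a i) < d" for t
    using a assms(3) d(1) that by (intro d(2)[rule_format]) (auto simp: topspace_Euclidean_space dist_real_def)
  with d(1) show ?thesis by (auto simp: eventually_nhds_metric)
qed

locale smooth_atlas =
  fixes m :: nat and M :: "'a topology" and \<A> :: "'a chart set"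
  assumes smooth: "smooth_manifold m M \<A>"
begin

lemma Hausdorff: "Hausdorff_space M"
  using smooth by (simp add: smooth_manifold_def)

lemma second_countable: "second_countable M"
  using smooth by (simp add: smooth_manifold_def second_countable_def)

lemma topspace_atlas: "topspace M = (\<Union>c\<in>\<A>. fst c)"
  using smooth by (simp add: smooth_manifold_def)

lemma chart_open: "c \<in> \<A> \<Longrightarrow> openin M (fst c)"
  using smooth by (simp add: smooth_manifold_def)

lemma chart_subset: "c \<in> \<A> \<Longrightarrow> fst c \<subseteq> topspace M"
  by (simp add: chart_open openin_subset)

lemma chart_image_open: "c \<in> \<A> \<Longrightarrow> openin (Euclidean_space m) (snd c ` fst c)"
  using smooth by (simp add: smooth_manifold_def)

lemma chart_inj: "c \<in> \<A> \<Longrightarrow> inj_on (snd c) (fst c)"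
  using smooth chart_subset[of c]
  by (fastforce simp: smooth_manifold_def homeomorphic_eq_everything_map Int_absorb1)

lemma chart_inv: "c \<in> \<A> \<Longrightarrow> x \<in> fst c \<Longrightarrow> inv_into (fst c) (snd c) (snd c x) = x"
  by (simp add: chart_inj)

lemma continuous_chart: "c \<in> \<A> \<Longrightarrow> continuous_map (subtopology M (fst c)) (Euclidean_space m) (snd c)"
  using smooth
  by (force simp: smooth_manifold_def homeomorphic_eq_everything_map continuous_map_in_subtopology)

lemma continuous_chart_coordinate:
  assumes "c \<in> \<A>"
  shows "continuous_map (subtopology M (fst c)) euclideanreal (\<lambda>x. snd c x i)"
  using continuous_map_compose[OF continuous_chart[OF assms] continuous_map_Euclidean_coordinate]
  by (simp add: o_def)

lemma chart_Euclidean: "c \<in> \<A> \<Longrightarrow> x \<in> fst c \<Longrightarrow> snd c x \<in> topspace (Euclidean_space m)"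
  using chart_image_open openin_subset by blast

lemma continuous_chart_inv:
  assumes c: "c \<in> \<A>"
  shows "continuous_map (subtopology (Euclidean_space m) (snd c ` fst c)) M (inv_into (fst c) (snd c))"
proof -
  obtain k where k: "homeomorphic_maps (subtopology M (fst c)) (subtopology (Euclidean_space m) (snd c ` fst c)) (snd c) k"
    using smooth c by (auto simp: smooth_manifold_def homeomorphic_map_maps)
  then have "continuous_map (subtopology (Euclidean_space m) (snd c ` fst c)) M k"
    by (simp add: homeomorphic_maps_def continuous_map_in_subtopology)
  moreover have "k y = inv_into (fst c) (snd c) y" if "y \<in> snd c ` fst c" for y
    using that k chart_inv[OF c] chart_subset[OF c] by (auto simp: homeomorphic_maps_def)
  ultimately show ?thesis
    by (auto intro: continuous_map_eq)
qed

lemma chart_change: "c \<in> \<A> \<Longrightarrow> x \<in> fst c \<Longrightarrow> chart_change c d (snd c x) = snd d x"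
  by (simp add: chart_change_def chart_inv)

lemma chart_overlap_open:
  assumes c: "c \<in> \<A>" and V: "openin M V"
  shows "openin (Euclidean_space m) (snd c ` (fst c \<inter> V))"
proof -
  have "openin (subtopology (Euclidean_space m) (snd c ` fst c))
      {y \<in> topspace (subtopology (Euclidean_space m) (snd c ` fst c)). inv_into (fst c) (snd c) y \<in> V}"
    by (rule openin_continuous_map_preimage[OF continuous_chart_inv[OF c] V])
  moreover have "{y \<in> topspace (subtopology (Euclidean_space m) (snd c ` fst c)). inv_into (fst c) (snd c) y \<in> V} = snd c ` (fst c \<inter> V)"
    using chart_inv[OF c] chart_Euclidean[OF c] by force
  ultimately have "openin (subtopology (Euclidean_space m) (snd c ` fst c)) (snd c ` (fst c \<inter> V))"
    by (simp only:)
  then show ?thesis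
    using chart_image_open[OF c] by (rule openin_trans_full)
qed

lemma chart_change_C1:
  assumes "c \<in> \<A>" "d \<in> \<A>" "j < m"
  shows "C_k_on 1 m (snd c ` (fst c \<inter> fst d)) (\<lambda>y. chart_change c d y j)"
  using smooth assms by (simp add: smooth_manifold_def smooth_on_def del: C_k_on.simps One_nat_def)

lemma continuous_jacobian:
  assumes c: "c \<in> \<A>" "d \<in> \<A>" "j < m" "i < m"
  shows "continuous_map (subtopology M (fst c \<inter> fst d)) euclideanreal (\<lambda>x. chart_jacobian c d x j i)"
proof -
  have "continuous_map (subtopology (Euclidean_space m) (snd c ` (fst c \<inter> fst d))) euclideanreal
      (partial_deriv i (\<lambda>y. chart_change c d y j))"
    using chart_change_C1[OF c(1-3)] c(4) by simp
  moreover have "continuous_map (subtopology M (fst c \<inter> fst d))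
      (subtopology (Euclidean_space m) (snd c ` (fst c \<inter> fst d))) (snd c)"
    using continuous_map_from_subtopology_mono[OF continuous_chart[OF c(1)], of "fst c \<inter> fst d"]
    by (auto simp: continuous_map_in_subtopology)
  ultimately show ?thesis
    unfolding chart_jacobian_def using continuous_map_compose by (force simp: o_def)
qed

lemma DERIV_chart_change:
  assumes c: "c \<in> \<A>" "d \<in> \<A>" "j < m" "i < m" and x: "x \<in> fst c \<inter> fst d"
  shows "((\<lambda>t. chart_change c d ((snd c x)(i := t)) j) has_real_derivative chart_jacobian c d x j i) (at (snd c x i))"
proof -
  have "(\<lambda>t. chart_change c d ((snd c x)(i := t)) j) differentiable (at (snd c x i))"
    using chart_change_C1[OF c(1-3)] c(4) x by auto
  then show ?thesis
    by (simp add: chart_jacobian_def partial_deriv_def DERIV_deriv_iff_real_differentiable)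
qed

text \<open>A partial derivative depends only on the coordinate line close to the point, and
  openness of chart images keeps that line inside the image of \<open>c\<close>. So any local
  formula for \<open>d\<close> in the coordinates of \<open>c\<close> may be differentiated instead
  of \<open>chart_change\<close>.\<close>

lemma jacobian_eqI:
  assumes c: "c \<in> \<A>" "i < m" and V: "openin M V" and x: "x \<in> fst c \<inter> V"
    and eq: "\<And>x'. x' \<in> fst c \<inter> V \<Longrightarrow> f (snd c x') = snd d x' j"
    and D: "((\<lambda>t. f ((snd c x)(i := t))) has_real_derivative D) (at (snd c x i))"
  shows "chart_jacobian c d x j i = D"
proof -
  have "\<forall>\<^sub>F t in nhds (snd c x i). (snd c x)(i := t) \<in> snd c ` (fst c \<inter> V)"
    using x by (intro eventually_fun_upd_in_open[OF chart_overlap_open[OF c(1) V] _ c(2)]) simp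
  then have "\<forall>\<^sub>F t in nhds (snd c x i). f ((snd c x)(i := t)) = chart_change c d ((snd c x)(i := t)) j"
  proof eventually_elim
    case (elim t)
    then obtain x' where "x' \<in> fst c \<inter> V" "(snd c x)(i := t) = snd c x'" by blast
    then show ?case using eq chart_change[OF c(1)] by simp
  qed
  then have "((\<lambda>t. chart_change c d ((snd c x)(i := t)) j) has_real_derivative D) (at (snd c x i))"
    using D by (subst (asm) DERIV_cong_ev[OF refl _ refl]) auto
  then show ?thesis
    unfolding chart_jacobian_def partial_deriv_def by (rule DERIV_imp_deriv)
qed

lemma jacobian_self:
  assumes "c \<in> \<A>" "i < m" "x \<in> fst c"
  shows "chart_jacobian c c x j i = (if i = j then 1 else 0)"
proof (rule jacobian_eqI)
  show "((\<lambda>t. ((snd c x)(i := t)) j) has_real_derivative (if i = j then 1 else 0)) (at (snd c x i))"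
    by auto
  show "openin M (topspace M)" by simp
qed (use assms chart_subset[OF assms(1)] in auto)

text \<open>On the triple overlap the change from \<open>c\<close> to \<open>d\<close> is the
  composite through \<open>c'\<close>; the chain rule is applied to the image under
  \<open>chart_change c c'\<close> of a coordinate line of \<open>c\<close>.\<close>

lemma jacobian_chain:
  assumes c: "c \<in> \<A>" "c' \<in> \<A>" "d \<in> \<A>" "j < m" "i < m" and x: "x \<in> fst c" "x \<in> fst c'" "x \<in> fst d"
  shows "chart_jacobian c d x j i = (\<Sum>l<m. chart_jacobian c' d x j l * chart_jacobian c c' x l i)"
proof (rule jacobian_eqI)
  show V: "openin M (fst c' \<inter> fst d)" using c by (simp add: chart_open openin_Int)
  show "x \<in> fst c \<inter> (fst c' \<inter> fst d)" using x by simp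
  show "chart_change c' d (chart_change c c' (snd c x')) j = snd d x' j"
    if "x' \<in> fst c \<inter> (fst c' \<inter> fst d)" for x'
    using that c by (simp add: chart_change)
  let ?\<gamma> = "\<lambda>t. chart_change c c' ((snd c x)(i := t))"
  have \<gamma>0: "?\<gamma> (snd c x i) = snd c' x" using c x by (simp add: chart_change)
  have "((\<lambda>t. chart_change c' d (?\<gamma> t) j) has_real_derivative
      (\<Sum>l<m. partial_deriv l (\<lambda>y. chart_change c' d y j) (?\<gamma> (snd c x i)) * chart_jacobian c c' x l i)) (at (snd c x i))"
  proof (rule partial_deriv_chain[where f = "\<lambda>y. chart_change c' d y j" and S = "snd c' ` (fst c' \<inter> fst d)"])
    show "openin (Euclidean_space m) (snd c' ` (fst c' \<inter> fst d))"
      using c by (intro chart_overlap_open chart_open)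
    show "?\<gamma> (snd c x i) \<in> snd c' ` (fst c' \<inter> fst d)"
      unfolding \<gamma>0 using x by simp
    show "C_k_on 1 m (snd c' ` (fst c' \<inter> fst d)) (\<lambda>y. chart_change c' d y j)"
      using c by (intro chart_change_C1)
    show "((\<lambda>t. ?\<gamma> t l) has_real_derivative chart_jacobian c c' x l i) (at (snd c x i))" if "l < m" for l
      using c x that by (intro DERIV_chart_change) auto
    \<comment> \<open>Close to \<open>snd c x\<close> the coordinate line consists of images of
      points of \<open>fst c \<inter> fst c'\<close>, so the curve takes values in genuine
      coordinate vectors, zero from index \<open>m\<close> on.\<close>
    have "\<forall>\<^sub>F t in nhds (snd c x i). (snd c x)(i := t) \<in> snd c ` (fst c \<inter> fst c')"
      using x by (intro eventually_fun_upd_in_open[OF chart_overlap_open[OF c(1) chart_open[OF c(2)]] _ c(5)]) simp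
    then have "\<forall>\<^sub>F t in nhds (snd c x i). ?\<gamma> t \<in> topspace (Euclidean_space m)"
    proof eventually_elim
      case (elim t)
      then obtain x' where "x' \<in> fst c \<inter> fst c'" "(snd c x)(i := t) = snd c x'" by blast
      then show ?case using chart_change[OF c(1)] chart_Euclidean[OF c(2)] by simp
    qed
    then show "\<forall>\<^sub>F t in at (snd c x i). ?\<gamma> t \<in> topspace (Euclidean_space m)"
      unfolding eventually_at_filter by eventually_elim simp
  qed
  then show "((\<lambda>t. chart_change c' d (chart_change c c' ((snd c x)(i := t))) j) has_real_derivative
      (\<Sum>l<m. chart_jacobian c' d x j l * chart_jacobian c c' x l i)) (at (snd c x i))"
    unfolding \<gamma>0 by (simp only: chart_jacobian_def)
qed (use c in auto)

text \<open>
  In the chart \<open>d\<close>, the vector at \<open>x\<close> pointing to \<open>y\<close> along the chart \<open>c\<close> differs from the one along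
  \<open>d\<close> by an error of first order small in their length.
\<close>

lemma jacobian_displacement_positive:
  assumes c: "c \<in> \<A>" "d \<in> \<A>" and x0: "x0 \<in> fst c \<inter> fst d"
  shows "\<exists>W. openin M W \<and> x0 \<in> W \<and> W \<subseteq> fst c \<inter> fst d \<and> (\<forall>x\<in>W. \<forall>y\<in>W. x \<noteq> y \<longrightarrow>
    0 < (\<Sum>j<m. (\<Sum>i<m. chart_jacobian c d x j i * (snd c y i - snd c x i)) * (snd d y j - snd d x j)))"
proof -
  \<comment> \<open>Exceeds the absolute value of every Jacobian entry at \<open>x0\<close>
    strictly, hence also nearby by continuity.\<close>
  define C where "C = 1 + (\<Sum>j<m. \<Sum>i<m. \<bar>chart_jacobian c d x0 j i\<bar>)"
  have Cpos: "C > 0" unfolding C_def by (intro add_pos_nonneg sum_nonneg) auto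
  \<comment> \<open>Chosen so that \<open>m^2 * C * \<epsilon> < 1\<close>: the error below is at
    most \<open>m * C * \<epsilon> * n^2\<close>, and \<open>n^2\<close> is at most \<open>m\<close>
    times the sum of the squares of the \<open>\<Delta> j\<close> by Cauchy-Schwarz.\<close>
  define \<epsilon> where "\<epsilon> = 1 / ((real m)\<^sup>2 * C + 1)"
  have den: "(real m)\<^sup>2 * C + 1 > 0" using Cpos by (intro add_nonneg_pos) auto
  then have \<epsilon>: "\<epsilon> > 0" by (simp add: \<epsilon>_def)
  let ?O = "fst c \<inter> fst d"
  have Oo: "openin M ?O" using c by (simp add: chart_open openin_Int)
  have Oto: "topspace (subtopology M ?O) = ?O" using chart_subset[OF c(1)] by auto
  let ?W1 = "\<lambda>j i. {x \<in> ?O. chart_jacobian c d x j i \<in> {-C<..<C}}"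
  have W1: "openin M (?W1 j i) \<and> x0 \<in> ?W1 j i" if "j < m" "i < m" for j i
  proof
    have "openin (subtopology M ?O) {x \<in> topspace (subtopology M ?O). chart_jacobian c d x j i \<in> {-C<..<C}}"
      by (rule openin_continuous_map_preimage[OF continuous_jacobian[OF c that]]) simp
    then show "openin M (?W1 j i)" unfolding Oto using Oo by (rule openin_trans_full)
    have "\<bar>chart_jacobian c d x0 j i\<bar> \<le> (\<Sum>i<m. \<bar>chart_jacobian c d x0 j i\<bar>)"
      using that by (intro member_le_sum) auto
    also have "\<dots> \<le> (\<Sum>j<m. \<Sum>i<m. \<bar>chart_jacobian c d x0 j i\<bar>)"
      using that by (intro member_le_sum[where f = "\<lambda>j. \<Sum>i<m. \<bar>chart_jacobian c d x0 j i\<bar>"] sum_nonneg) auto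
    finally have "\<bar>chart_jacobian c d x0 j i\<bar> < C" by (simp add: C_def)
    then show "x0 \<in> ?W1 j i" using x0 by auto
  qed
  \<comment> \<open>Strict differentiability of the change from \<open>d\<close> back to
    \<open>c\<close>, because lengths are measured in \<open>d\<close>, where the scalar product is
    taken.\<close>
  define Q where "Q = (\<lambda>i \<delta>. \<forall>a\<in>topspace (Euclidean_space m). \<forall>b\<in>topspace (Euclidean_space m).
      (\<forall>l<m. \<bar>a l - snd d x0 l\<bar> < \<delta>) \<longrightarrow> (\<forall>l<m. \<bar>b l - snd d x0 l\<bar> < \<delta>) \<longrightarrow>
      \<bar>chart_change d c b i - chart_change d c a i -
        (\<Sum>l<m. partial_deriv l (\<lambda>y. chart_change d c y i) a * (b l - a l))\<bar> \<le> \<epsilon> * (\<Sum>l<m. \<bar>b l - a l\<bar>))"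
  have "\<exists>\<delta>>0. Q i \<delta>" if "i < m" for i
  proof -
    have "C_k_on 1 m (snd d ` (fst d \<inter> fst c)) (\<lambda>y. chart_change d c y i)"
      using c that by (intro chart_change_C1)
    moreover have "openin (Euclidean_space m) (snd d ` (fst d \<inter> fst c))"
      by (rule chart_overlap_open[OF c(2) chart_open[OF c(1)]])
    ultimately show ?thesis
      unfolding Q_def using x0 \<epsilon> by (intro strict_differentiability) auto
  qed
  then obtain \<delta> where \<delta>: "\<And>i. i < m \<Longrightarrow> \<delta> i > 0" and Q: "\<And>i. i < m \<Longrightarrow> Q i (\<delta> i)"
    by metis
  let ?W2 = "\<lambda>i l. {x \<in> ?O. snd d x l \<in> {snd d x0 l - \<delta> i<..<snd d x0 l + \<delta> i}}"
  have W2: "openin M (?W2 i l) \<and> x0 \<in> ?W2 i l" if "i < m" for i l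
  proof
    have "continuous_map (subtopology M ?O) euclideanreal (\<lambda>x. snd d x l)"
      by (rule continuous_map_from_subtopology_mono[OF continuous_chart_coordinate[OF c(2)]]) simp
    then have "openin (subtopology M ?O) {x \<in> topspace (subtopology M ?O). snd d x l \<in> {snd d x0 l - \<delta> i<..<snd d x0 l + \<delta> i}}"
      by (rule openin_continuous_map_preimage) simp
    then show "openin M (?W2 i l)" unfolding Oto using Oo by (rule openin_trans_full)
    show "x0 \<in> ?W2 i l" using x0 \<delta>[OF that] by auto
  qed
  define W where "W = ?O \<inter> (\<Inter>(j, i)\<in>{..<m} \<times> {..<m}. ?W1 j i \<inter> ?W2 i j)"
  have "openin M W"
    unfolding W_def using W1 W2 by (cases "m = 0") (use Oo in \<open>auto intro!: openin_Int openin_INT2 Oo chart_open c\<close>)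
  moreover have "x0 \<in> W" unfolding W_def using x0 W1 W2 by auto
  moreover have "W \<subseteq> ?O" unfolding W_def by auto
  moreover have "0 < (\<Sum>j<m. (\<Sum>i<m. chart_jacobian c d x j i * (snd c y i - snd c x i)) * (snd d y j - snd d x j))"
    if x: "x \<in> W" and y: "y \<in> W" and xy: "x \<noteq> y" for x y
  proof -
    define \<Delta> where "\<Delta> = (\<lambda>j. snd d y j - snd d x j)"
    define v where "v = (\<lambda>j. \<Sum>i<m. chart_jacobian c d x j i * (snd c y i - snd c x i))"
    define n where "n = (\<Sum>j<m. \<bar>\<Delta> j\<bar>)"
    have xO: "x \<in> fst c" "x \<in> fst d" "y \<in> fst c" "y \<in> fst d" using x y by (auto simp: W_def)
    define R where "R = (\<lambda>i. (snd c y i - snd c x i) - (\<Sum>l<m. chart_jacobian d c x i l * \<Delta> l))"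
    have R: "\<bar>R i\<bar> \<le> \<epsilon> * n" if i: "i < m" for i
    proof -
      have "x \<in> ?W2 i l \<and> y \<in> ?W2 i l" if "l < m" for l
        using x y i that unfolding W_def by blast
      then have "\<forall>l<m. \<bar>snd d x l - snd d x0 l\<bar> < \<delta> i" "\<forall>l<m. \<bar>snd d y l - snd d x0 l\<bar> < \<delta> i"
        by (simp_all add: abs_less_iff algebra_simps)
      then have "\<bar>chart_change d c (snd d y) i - chart_change d c (snd d x) i -
          (\<Sum>l<m. partial_deriv l (\<lambda>y. chart_change d c y i) (snd d x) * (snd d y l - snd d x l))\<bar>
          \<le> \<epsilon> * (\<Sum>l<m. \<bar>snd d y l - snd d x l\<bar>)"
        using Q[OF i] chart_Euclidean[OF c(2)] xO unfolding Q_def by blast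
      then show ?thesis
        using xO c by (simp add: chart_change R_def n_def \<Delta>_def chart_jacobian_def)
    qed
    have J: "\<bar>chart_jacobian c d x j i\<bar> \<le> C" if "i < m" "j < m" for i j
    proof -
      have "x \<in> ?W1 j i" using x that unfolding W_def by blast
      then show ?thesis by (simp add: abs_le_iff)
    qed
    \<comment> \<open>The Jacobians from \<open>c\<close> to \<open>d\<close> and from
      \<open>d\<close> to \<open>c\<close> are inverse to each other, so the former turns the
      displacement in \<open>c\<close> into \<open>\<Delta>\<close> up to the image of the error
      \<open>R\<close>.\<close>
    have v\<Delta>: "\<bar>v j - \<Delta> j\<bar> \<le> m * (C * (\<epsilon> * n))" if j: "j < m" for j
    proof -
      have "(\<Sum>i<m. chart_jacobian c d x j i * (\<Sum>l<m. chart_jacobian d c x i l * \<Delta> l)) =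
          (\<Sum>l<m. (\<Sum>i<m. chart_jacobian c d x j i * chart_jacobian d c x i l) * \<Delta> l)"
        by (simp only: sum_distrib_left sum_distrib_right mult.assoc) (rule sum.swap)
      also have "\<dots> = (\<Sum>l<m. (if l = j then 1 else 0) * \<Delta> l)"
        using c xO j by (intro sum.cong refl) (simp add: jacobian_chain[symmetric] jacobian_self)
      also have "\<dots> = \<Delta> j" using j by (simp add: if_distrib[of "\<lambda>a. a * _"] cong: if_cong)
      finally have "v j - \<Delta> j = (\<Sum>i<m. chart_jacobian c d x j i * R i)"
        unfolding v_def R_def by (simp add: right_diff_distrib sum_subtractf)
      also have "\<bar>\<dots>\<bar> \<le> (\<Sum>i<m. C * (\<epsilon> * n))"
        using J[OF _ j] R Cpos unfolding abs_mult
        by (intro order.trans[OF sum_abs] sum_mono) (auto simp: abs_mult intro!: mult_mono)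
      finally show ?thesis by simp
    qed
    have "\<exists>j<m. \<Delta> j \<noteq> 0"
    proof (rule ccontr)
      assume "\<not> ?thesis"
      then have "snd d x j = snd d y j" for j
        using chart_Euclidean[OF c(2)] xO by (cases "j < m") (auto simp: \<Delta>_def topspace_Euclidean_space)
      then have "snd d x = snd d y" by blast
      then show False using chart_inj[OF c(2)] xO xy by (auto simp: inj_on_def)
    qed
    then obtain j where "j < m" "\<Delta> j \<noteq> 0" by blast
    then have pos: "(\<Sum>j<m. (\<Delta> j)\<^sup>2) > 0"
      by (intro sum_pos2[of _ j]) auto
    have "n\<^sup>2 \<le> m * (\<Sum>j<m. (\<Delta> j)\<^sup>2)"
      unfolding n_def using sum_squared_le_sum_of_squares[where I = "{..<m}" and f = "\<lambda>j. \<bar>\<Delta> j\<bar>"]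
      by (simp add: mult.commute)
    then have "m * (C * \<epsilon>) * n\<^sup>2 \<le> m * (C * \<epsilon>) * (m * (\<Sum>j<m. (\<Delta> j)\<^sup>2))"
      using Cpos \<epsilon> by (intro mult_left_mono) auto
    also have "\<dots> = ((real m)\<^sup>2 * C * \<epsilon>) * (\<Sum>j<m. (\<Delta> j)\<^sup>2)"
      by (simp add: power2_eq_square mult_ac)
    also have "\<dots> < 1 * (\<Sum>j<m. (\<Delta> j)\<^sup>2)"
      using den pos by (intro mult_strict_right_mono) (auto simp: \<epsilon>_def)
    finally have small: "m * (C * (\<epsilon> * n)) * n < (\<Sum>j<m. (\<Delta> j)\<^sup>2)"
      by (simp add: power2_eq_square mult_ac)
    have "(\<Sum>j<m. (\<Delta> j)\<^sup>2) - m * (C * (\<epsilon> * n)) * n = (\<Sum>j<m. (\<Delta> j)\<^sup>2 - m * (C * (\<epsilon> * n)) * \<bar>\<Delta> j\<bar>)"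
      by (simp add: sum_subtractf n_def sum_distrib_left)
    also have "\<dots> \<le> (\<Sum>j<m. v j * \<Delta> j)"
    proof (rule sum_mono)
      fix j assume "j \<in> {..<m}"
      then have "\<bar>(v j - \<Delta> j) * \<Delta> j\<bar> \<le> m * (C * (\<epsilon> * n)) * \<bar>\<Delta> j\<bar>"
        unfolding abs_mult by (intro mult_right_mono v\<Delta>) auto
      then show "(\<Delta> j)\<^sup>2 - m * (C * (\<epsilon> * n)) * \<bar>\<Delta> j\<bar> \<le> v j * \<Delta> j"
        by (simp add: power2_eq_square left_diff_distrib abs_le_iff)
    qed
    finally show ?thesis using small by (simp add: v_def \<Delta>_def)
  qed
  ultimately show ?thesis by (intro exI[of _ W]) auto
qed

end

section \<open>Locally finite bump functions\<close>

lemma continuous_map_open_cover: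
  assumes "\<And>x. x \<in> topspace X \<Longrightarrow> \<exists>V. openin X V \<and> x \<in> V \<and> continuous_map (subtopology X V) Y f"
  shows "continuous_map X Y f"
proof (rule pasting_lemma[where I = "{V. openin X V \<and> continuous_map (subtopology X V) Y f}" and T = id and f = "\<lambda>_. f"])
  show "\<exists>V. V \<in> {V. openin X V \<and> continuous_map (subtopology X V) Y f} \<and> x \<in> id V \<and> f x = f x"
    if "x \<in> topspace X" for x
    using assms[OF that] by auto
qed auto

text \<open>These bumps do not form a partition of unity: at each point one of them equals
  \<open>1\<close>, so that a full move along its chart can reach its target. In the last assumption
  a single \<open>W\<close> decides for every \<open>k\<close> whether \<open>B k\<close> contains
  it or \<open>b k\<close> vanishes on it, and \<open>n\<close> bounds the indices, so that moves
  made in order may stop at \<open>n\<close>.\<close>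

locale bump_atlas = smooth_atlas m M \<A>
  for m and M :: "'a topology" and \<A> +
  fixes c :: "nat \<Rightarrow> 'a chart" and B :: "nat \<Rightarrow> 'a set" and b :: "nat \<Rightarrow> 'a \<Rightarrow> real"
  assumes c: "c k \<in> \<A>" and B_open: "openin M (B k)" and B_chart: "B k \<subseteq> fst (c k)"
    and B_convex: "x \<in> B k \<Longrightarrow> y \<in> B k \<Longrightarrow> s \<in> {0..1} \<Longrightarrow>
      (\<lambda>i. (1 - s) * snd (c k) x i + s * snd (c k) y i) \<in> snd (c k) ` B k"
    and b_continuous: "continuous_map M euclideanreal (b k)"
    and b_range: "b k x \<in> {0..1}"
    and b_one: "x \<in> topspace M \<Longrightarrow> \<exists>k. b k x = 1"
    and b_locally_finite: "x \<in> topspace M \<Longrightarrow> \<exists>W n. openin M W \<and> x \<in> W \<and>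
      (\<forall>k\<ge>n. \<forall>y\<in>W. b k y = 0) \<and> (\<forall>k. W \<subseteq> B k \<or> (\<forall>y\<in>W. b k y = 0))"

text \<open>In coordinates \<open>B\<close> is an open cube around \<open>x\<close>,
  \<open>S\<close> the closed cube of half the size, and \<open>\<beta>\<close> a tent over the sum
  norm.\<close>

lemma (in smooth_atlas) local_bump:
  assumes x: "x \<in> topspace M"
  shows "\<exists>c B S \<beta>. c \<in> \<A> \<and> openin M B \<and> B \<subseteq> fst c \<and>
    (\<forall>y\<in>B. \<forall>z\<in>B. \<forall>s\<in>{0..1}. (\<lambda>i. (1 - s) * snd c y i + s * snd c z i) \<in> snd c ` B) \<and>
    closedin M S \<and> S \<subseteq> B \<and> continuous_map M euclideanreal \<beta> \<and>
    (\<forall>y. 0 \<le> \<beta> y \<and> \<beta> y \<le> 1) \<and> (\<forall>y. y \<notin> S \<longrightarrow> \<beta> y = 0) \<and> \<beta> x = 1"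
proof -
  let ?E = "Euclidean_space m"
  obtain c where c: "c \<in> \<A>" "x \<in> fst c" using x topspace_atlas by auto
  define a where "a = snd c x"
  obtain d where d: "d > 0" and box: "\<forall>y\<in>topspace ?E. (\<forall>i<m. \<bar>y i - a i\<bar> < d) \<longrightarrow> y \<in> snd c ` fst c"
    using Euclidean_space_box[OF chart_image_open[OF c(1)], of a] c(2) by (auto simp: a_def)
  let ?C = "subtopology M (fst c)"
  have Cto: "topspace ?C = fst c" using chart_subset[OF c(1)] by auto
  let ?\<Delta> = "\<lambda>y i. \<bar>snd c y i - a i\<bar>"
  have \<Delta>_cont: "continuous_map ?C euclideanreal (\<lambda>y. ?\<Delta> y i)" for i
    by (intro continuous_map_real_abs continuous_map_diff continuous_chart_coordinate[OF c(1)]) simp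
  define B where "B = {y \<in> fst c. \<forall>i<m. ?\<Delta> y i < d}"
  define S where "S = {y \<in> fst c. \<forall>i<m. ?\<Delta> y i \<le> d / 2}"
  \<comment> \<open>The slope \<open>2 / d\<close> makes \<open>\<beta>\<close> vanish as soon as a
    single coordinate deviates by \<open>d / 2\<close>, hence outside \<open>S\<close>.\<close>
  define \<beta> where "\<beta> = (\<lambda>y. if y \<in> fst c then max 0 (1 - 2 / d * (\<Sum>i<m. ?\<Delta> y i)) else 0)"
  have B: "openin M B"
  proof -
    have "openin ?C {y \<in> topspace ?C. ?\<Delta> y i \<in> {..<d}}" for i
      by (rule openin_continuous_map_preimage[OF \<Delta>_cont]) simp
    then have "openin M {y \<in> fst c. ?\<Delta> y i < d}" for i
      unfolding Cto lessThan_iff using chart_open[OF c(1)] by (rule openin_trans_full)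
    then have "openin M (fst c \<inter> (\<Inter>i\<in>{..<m}. {y \<in> fst c. ?\<Delta> y i < d}))"
      using chart_open[OF c(1)] by (cases "{..<m} = {}") (simp_all only: INF_empty Int_UNIV_right openin_Int openin_INT2 finite_lessThan not_False_eq_True)
    moreover have "fst c \<inter> (\<Inter>i\<in>{..<m}. {y \<in> fst c. ?\<Delta> y i < d}) = B"
      by (auto simp: B_def)
    ultimately show ?thesis by (simp only:)
  qed
  \<comment> \<open>Closed in \<open>M\<close> and not merely in the chart domain, being the image
    of a compact cube in a Hausdorff space. This makes the extension of \<open>\<beta>\<close> by
    zero continuous.\<close>
  have S: "closedin M S"
  proof -
    define K where "K = Pi\<^sub>E UNIV (\<lambda>i. if i < m then {a i - d/2..a i + d/2} else {0})"
    have "compactin (powertop_real UNIV) K"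
      unfolding K_def compactin_PiE by (auto simp: compactin_euclidean_iff)
    moreover have K: "K \<subseteq> topspace ?E"
    proof
      fix y assume "y \<in> K"
      then have "y i \<in> (if i < m then {a i - d/2..a i + d/2} else {0})" for i
        unfolding K_def by (rule PiE_mem) simp
      then have "y i = 0" if "i \<ge> m" for i
        using that by (metis not_less singletonD)
      then show "y \<in> topspace ?E" by (simp add: topspace_Euclidean_space)
    qed
    ultimately have "compactin ?E K"
      by (simp add: Euclidean_space_def compactin_subtopology topspace_Euclidean_space)
    moreover have Kbox: "y \<in> K \<longleftrightarrow> y \<in> topspace ?E \<and> (\<forall>i<m. \<bar>y i - a i\<bar> \<le> d/2)" for y
    proof -
      have "y i \<in> (if i < m then {a i - d/2..a i + d/2} else {0}) \<longleftrightarrow>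
          (if i < m then \<bar>y i - a i\<bar> \<le> d/2 else y i = 0)" for i
        by (simp only: abs_diff_le_iff atLeastAtMost_iff singleton_iff split: if_split) simp
      then have "y \<in> K \<longleftrightarrow> (\<forall>i. if i < m then \<bar>y i - a i\<bar> \<le> d/2 else y i = 0)"
        by (simp only: K_def PiE_UNIV_domain Pi_iff ball_UNIV)
      also have "\<dots> \<longleftrightarrow> y \<in> topspace ?E \<and> (\<forall>i<m. \<bar>y i - a i\<bar> \<le> d/2)"
        by (simp only: topspace_Euclidean_space mem_Collect_eq if_bool_eq_conj not_less) blast
      finally show ?thesis .
    qed
    then have Kim: "K \<subseteq> snd c ` fst c"
      using box d by fastforce
    ultimately have "compactin (subtopology ?E (snd c ` fst c)) K"
      by (simp add: compactin_subtopology)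
    from image_compactin[OF this continuous_chart_inv[OF c(1)]]
    have "compactin M (inv_into (fst c) (snd c) ` K)" .
    moreover have "inv_into (fst c) (snd c) ` K = S"
    proof (intro equalityI subsetI)
      fix y assume "y \<in> inv_into (fst c) (snd c) ` K"
      then obtain z where z: "z \<in> K" "y = inv_into (fst c) (snd c) z" by blast
      with Kim obtain y' where "y' \<in> fst c" "z = snd c y'" by blast
      with z Kbox show "y \<in> S" by (simp add: S_def chart_inv[OF c(1)])
    next
      fix y assume y: "y \<in> S"
      then have "snd c y \<in> K" using Kbox chart_Euclidean[OF c(1)] by (simp add: S_def)
      moreover have "y = inv_into (fst c) (snd c) (snd c y)"
        using y by (simp add: S_def chart_inv[OF c(1)])
      ultimately show "y \<in> inv_into (fst c) (snd c) ` K" by (metis imageI)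
    qed
    ultimately show ?thesis using compactin_imp_closedin[OF Hausdorff] by simp
  qed
  have zero: "\<beta> y = 0" if "y \<notin> S" for y
  proof (cases "y \<in> fst c")
    case True
    with that obtain i where i: "i < m" "?\<Delta> y i > d/2" by (auto simp: S_def not_le)
    have "?\<Delta> y i \<le> (\<Sum>i<m. ?\<Delta> y i)" using i by (intro member_le_sum) auto
    then have "2 / d * (d/2) \<le> 2 / d * (\<Sum>i<m. ?\<Delta> y i)"
      using i d by (intro mult_left_mono) auto
    then show ?thesis using d by (simp add: \<beta>_def)
  qed (simp add: \<beta>_def)
  have cont: "continuous_map M euclideanreal \<beta>"
  proof (rule continuous_map_open_cover)
    fix y assume y: "y \<in> topspace M"
    show "\<exists>V. openin M V \<and> y \<in> V \<and> continuous_map (subtopology M V) euclideanreal \<beta>"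
    proof (cases "y \<in> fst c")
      case True
      have "continuous_map ?C euclideanreal (\<lambda>y. max 0 (1 - 2 / d * (\<Sum>i<m. ?\<Delta> y i)))"
        by (intro continuous_map_real_max continuous_map_diff continuous_map_real_mult continuous_map_sum \<Delta>_cont) simp_all
      then have "continuous_map ?C euclideanreal \<beta>"
        by (rule continuous_map_eq) (simp add: \<beta>_def)
      with True chart_open[OF c(1)] show ?thesis by blast
    next
      case False
      have "continuous_map (subtopology M (topspace M - S)) euclideanreal \<beta>"
        by (rule continuous_map_eq[of _ _ "\<lambda>_. 0"]) (simp_all add: zero)
      moreover have "openin M (topspace M - S)" using S by (simp add: closedin_def)
      moreover have "y \<in> topspace M - S" using y False by (simp add: S_def)
      ultimately show ?thesis by blast
    qed
  qed
  have range: "0 \<le> \<beta> y" "\<beta> y \<le> 1" for y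
    using d by (simp_all add: \<beta>_def sum_nonneg)
  have one: "\<beta> x = 1" using c(2) by (simp add: \<beta>_def a_def)
  have SB: "S \<subseteq> B" using d by (force simp: S_def B_def)
  have convex: "(\<lambda>i. (1 - s) * snd c y i + s * snd c z i) \<in> snd c ` B"
    if yz: "y \<in> B" "z \<in> B" "s \<in> {0..1}" for y z s
  proof -
    let ?p = "\<lambda>i. (1 - s) * snd c y i + s * snd c z i"
    have near: "\<bar>?p i - a i\<bar> < d" if "i < m" for i
    proof -
      have "?p i \<in> ball (a i) d"
        using convexD[OF convex_ball, of "snd c y i" "a i" d "snd c z i" "1 - s" s] yz that
        by (simp add: B_def dist_real_def abs_minus_commute)
      then show ?thesis by (simp add: dist_real_def abs_minus_commute)
    qed
    have "?p \<in> topspace ?E"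
      using chart_Euclidean[OF c(1)] yz by (simp add: B_def topspace_Euclidean_space)
    then have "?p \<in> snd c ` fst c"
      by (rule box[rule_format]) (rule near)
    then obtain p where p: "?p = snd c p" "p \<in> fst c" by (rule imageE)
    with near have "p \<in> B" by (simp add: B_def fun_eq_iff)
    then have "snd c p \<in> snd c ` B" by (rule imageI)
    then show ?thesis by (simp only: p(1))
  qed
  have Bc: "B \<subseteq> fst c" by (auto simp: B_def)
  show ?thesis
    by (intro exI[of _ c] exI[of _ B] exI[of _ S] exI[of _ \<beta>] conjI ballI allI impI)
      (fact c(1) B Bc S SB cont range one | rule convex zero; assumption)+
qed

text \<open>
  From bumps \<open>\<beta> k\<close> such that the sets \<open>\<beta> k > 2/3\<close> cover \<open>M\<close>, a locally finite family is
  obtained by multiplying \<open>min 1 (3 * \<beta> k)\<close> with a factor that vanishes where some \<open>\<beta> j > 2/3\<close>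
  with \<open>j < k\<close>, and is \<open>1\<close> where all of them are at most \<open>1/3\<close>.
\<close>

lemma (in smooth_atlas) bump_atlas_exists:
  assumes "topspace M \<noteq> {}"
  shows "\<exists>c B b. bump_atlas m M \<A> c B b"
proof -
  define good where "good = (\<lambda>x (c :: 'a chart) B S \<beta>. c \<in> \<A> \<and> openin M B \<and> B \<subseteq> fst c \<and>
    (\<forall>y\<in>B. \<forall>z\<in>B. \<forall>s\<in>{0..1}. (\<lambda>i. (1 - s) * snd c y i + s * snd c z i) \<in> snd c ` B) \<and>
    closedin M S \<and> S \<subseteq> B \<and> continuous_map M euclideanreal \<beta> \<and>
    (\<forall>y. 0 \<le> \<beta> y \<and> \<beta> y \<le> 1) \<and> (\<forall>y. y \<notin> S \<longrightarrow> \<beta> y = 0) \<and> \<beta> x = (1::real))"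
  have "\<forall>x\<in>topspace M. \<exists>c B S \<beta>. good x c B S \<beta>"
    using local_bump unfolding good_def by blast
  then obtain c B S \<beta> where good: "\<And>x. x \<in> topspace M \<Longrightarrow> good x (c x) (B x) (S x) (\<beta> x)"
    by metis
  define V where "V = (\<lambda>x. {y \<in> topspace M. \<beta> x y > 2/3})"
  have V: "openin M (V x) \<and> x \<in> V x" if x: "x \<in> topspace M" for x
  proof
    have "openin M {y \<in> topspace M. \<beta> x y \<in> {2/3<..}}"
      by (rule openin_continuous_map_preimage[where Y = euclideanreal]) (use good[OF x] in \<open>simp_all add: good_def\<close>)
    then show "openin M (V x)" by (simp add: V_def)
    show "x \<in> V x" using x good[OF x] by (simp add: good_def V_def)
  qed
  have "Lindelof_space M"
    using second_countable by (rule second_countable_imp_Lindelof_space)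
  moreover have "(\<forall>U\<in>V ` topspace M. openin M U) \<and> \<Union>(V ` topspace M) = topspace M"
    using V openin_subset by blast
  ultimately have "\<exists>\<V>. countable \<V> \<and> \<V> \<subseteq> V ` topspace M \<and> \<Union>\<V> = topspace M"
    unfolding Lindelof_space_def by (elim allE[of _ "V ` topspace M"] impE)
  then obtain \<V> where \<V>: "countable \<V> \<and> \<V> \<subseteq> V ` topspace M" "\<Union>\<V> = topspace M"
    by (elim exE conjE) simp
  obtain X where X: "countable X" "X \<subseteq> topspace M" "\<Union>(V ` X) = topspace M"
    using iffD1[OF countable_subset_image \<V>(1)] \<V>(2) by (elim exE conjE) simp
  have Xne: "X \<noteq> {}" using X(3) assms by (metis Union_empty image_empty)
  \<comment> \<open>The bumps have to be ordered, as each is suppressed by its predecessors;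
    repetitions for finite \<open>X\<close> are harmless.\<close>
  define p where "p = from_nat_into X"
  have pX: "p k \<in> topspace M" for k
    using from_nat_into[OF Xne] X(2) by (auto simp: p_def)
  note good_p = good[OF pX, unfolded good_def]
  have cover: "\<exists>k. \<beta> (p k) y > 2/3" if y: "y \<in> topspace M" for y
  proof -
    obtain x where "x \<in> X" "\<beta> x y > 2/3"
    proof -
      have "y \<in> \<Union>(V ` X)" unfolding X(3) by (rule y)
      then show thesis using that by (elim UN_E) (simp add: V_def)
    qed
    moreover from this obtain k where "p k = x"
      using from_nat_into_surj[OF X(1)] unfolding p_def by blast
    ultimately show ?thesis by blast
  qed
  \<comment> \<open>A summand is \<open>0\<close> where its bump is at most \<open>1/3\<close> and
    \<open>1\<close> where it is at least \<open>2/3\<close>, so one predecessor above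
    \<open>2/3\<close> already gives \<open>r k y \<ge> 1\<close>.\<close>
  define r where "r = (\<lambda>k y. \<Sum>j<k. max 0 (min 1 (3 * \<beta> (p j) y - 1)))"
  define b where "b = (\<lambda>k y. min 1 (3 * \<beta> (p k) y) * max 0 (1 - r k y))"
  have r0: "r k y \<ge> 0" for k y unfolding r_def by (rule sum_nonneg) simp
  have "bump_atlas m M \<A> (\<lambda>k. c (p k)) (\<lambda>k. B (p k)) b"
  proof unfold_locales
    show "c (p k) \<in> \<A>" "openin M (B (p k))" "B (p k) \<subseteq> fst (c (p k))" for k
      by (rule good_p[THEN conjunct1]) (rule good_p[THEN conjunct2, THEN conjunct1],
        rule good_p[THEN conjunct2, THEN conjunct2, THEN conjunct1])
    show "(\<lambda>i. (1 - s) * snd (c (p k)) x i + s * snd (c (p k)) y i) \<in> snd (c (p k)) ` B (p k)"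
      if "x \<in> B (p k)" "y \<in> B (p k)" "s \<in> {0..1}" for x y s k
      by (rule good_p[THEN conjunct2, THEN conjunct2, THEN conjunct2, THEN conjunct1,
        THEN bspec, THEN bspec, THEN bspec, OF that])
    have "continuous_map M euclideanreal (\<beta> (p k))" for k using good_p[of k] by (elim conjE)
    then show "continuous_map M euclideanreal (b k)" for k
      unfolding b_def r_def
      by (intro continuous_map_real_mult continuous_map_real_max continuous_map_real_min continuous_map_diff continuous_map_sum) simp_all
    show "b k x \<in> {0..1}" for k x
    proof -
      have "0 \<le> min 1 (3 * \<beta> (p k) x)" using good_p[of k] by simp
      moreover have "min 1 (3 * \<beta> (p k) x) \<le> 1" "0 \<le> max 0 (1 - r k x)" "max 0 (1 - r k x) \<le> 1"
        using r0[of k x] by simp_all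
      ultimately show ?thesis by (simp only: b_def atLeastAtMost_iff mult_nonneg_nonneg mult_le_one)
    qed
    show "\<exists>k. b k x = 1" if x: "x \<in> topspace M" for x
    proof -
      \<comment> \<open>For the first index with value at least \<open>1/3\<close>, no predecessor
        contributes to \<open>r\<close>, and \<open>3 * \<beta>\<close> is cut off at
        \<open>1\<close>.\<close>
      define k where "k = (LEAST k. \<beta> (p k) x \<ge> 1/3)"
      have "\<exists>k. \<beta> (p k) x \<ge> 1/3" proof -
        obtain k where "\<beta> (p k) x > 2/3" using cover[OF x] by blast
        then show ?thesis by (intro exI[of _ k]) simp
      qed
      then have k: "\<beta> (p k) x \<ge> 1/3" unfolding k_def by (rule LeastI_ex)
      have "max 0 (min 1 (3 * \<beta> (p j) x - 1)) = 0" if "j < k" for j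
        using not_less_Least[of j "\<lambda>k. \<beta> (p k) x \<ge> 1/3"] that by (simp add: k_def)
      then have "r k x = 0" unfolding r_def by (intro sum.neutral) simp
      with k show ?thesis by (intro exI[of _ k]) (simp add: b_def)
    qed
    show "\<exists>W n. openin M W \<and> x \<in> W \<and> (\<forall>k\<ge>n. \<forall>y\<in>W. b k y = 0) \<and>
        (\<forall>k. W \<subseteq> B (p k) \<or> (\<forall>y\<in>W. b k y = 0))" if x: "x \<in> topspace M" for x
    proof -
      obtain n where n: "\<beta> (p n) x > 2/3" using cover[OF x] by blast
      have late: "b k y = 0" if "\<beta> (p n) y > 2/3" "k > n" for k y
      proof -
        have "max 0 (min 1 (3 * \<beta> (p n) y - 1)) \<le> r k y"
          unfolding r_def using that(2)
          by (intro member_le_sum[of n "{..<k}" "\<lambda>j. max 0 (min 1 (3 * \<beta> (p j) y - 1))"]) auto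
        with that(1) have "r k y \<ge> 1" by simp
        then show ?thesis by (simp add: b_def)
      qed
      \<comment> \<open>As \<open>S\<close> is closed, \<open>B\<close> open and
        \<open>S \<subseteq> B\<close>, each point has a neighbourhood inside \<open>B\<close> or
        disjoint from \<open>S\<close>. Finitely many of these are intersected, since the bumps
        after \<open>n\<close> vanish on \<open>V (p n)\<close>.\<close>
      define A where "A = (\<lambda>k. if x \<in> S (p k) then B (p k) else topspace M - S (p k))"
      have A: "openin M (A k) \<and> x \<in> A k" for k
        using good_p[of k] x by (auto simp: A_def closedin_def)
      let ?W = "V (p n) \<inter> (\<Inter>k\<in>{..n}. A k)"
      have "openin M ?W" using V[OF pX] A by (intro openin_Int openin_INT2) auto
      moreover have "x \<in> ?W" using n x A by (simp add: V_def)
      moreover have late': "\<forall>k\<ge>Suc n. \<forall>y\<in>?W. b k y = 0" using late by (simp add: V_def)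
      moreover have "?W \<subseteq> B (p k) \<or> (\<forall>y\<in>?W. b k y = 0)" for k
      proof (cases "k \<le> n")
        case True
        then have "?W \<subseteq> A k" by blast
        moreover have "b k y = 0" if "y \<notin> S (p k)" for y
          using good_p[of k] that by (simp add: b_def)
        ultimately show ?thesis by (auto simp: A_def split: if_splits)
      next
        case False
        then show ?thesis using late' by (simp add: not_le Suc_le_eq)
      qed
      ultimately show ?thesis by (intro exI[of _ ?W] exI[of _ "Suc n"] conjI) auto
    qed
  qed
  then show ?thesis by blast
qed

section \<open>A neighbourhood of the diagonal\<close>

context bump_atlas
begin

text \<open>A straight line in the chart \<open>c k\<close> from \<open>z\<close> towards
  \<open>x\<close>, of which the fraction \<open>s * b k x\<close> is covered. Staying at
  \<open>z\<close> is consistent for \<open>x\<close> outside \<open>B k\<close>, where the weight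
  is zero; the case of \<open>z\<close> outside and \<open>x\<close> inside is avoided by staying
  close to the diagonal.\<close>

definition move :: "nat \<Rightarrow> real \<Rightarrow> 'a \<Rightarrow> 'a \<Rightarrow> 'a" where
  "move k s x z = (if x \<in> B k \<and> z \<in> B k
     then inv_into (fst (c k)) (snd (c k)) (\<lambda>i. (1 - s * b k x) * snd (c k) z i + s * b k x * snd (c k) x i)
     else z)"

text \<open>A step with \<open>b k x = 1\<close> ends in \<open>x\<close>, and all later steps stay there.\<close>

primrec moves :: "nat \<Rightarrow> ('a \<times> 'a) \<times> real \<Rightarrow> 'a" where
  "moves 0 p = snd (fst p)"
| "moves (Suc k) p = move k (snd p) (fst (fst p)) (moves k p)"

lemma chart_inv_B: "z \<in> B k \<Longrightarrow> inv_into (fst (c k)) (snd (c k)) (snd (c k) z) = z"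
  using B_chart c chart_inv by blast

lemma move_zero:
  assumes "s * b k x = 0"
  shows "move k s x z = z"
  unfolding move_def assms by (simp add: chart_inv_B)

lemma move_self: "move k s x x = x"
proof -
  have "(\<lambda>i. (1 - s * b k x) * snd (c k) x i + s * b k x * snd (c k) x i) = snd (c k) x"
    by (simp add: algebra_simps)
  then show ?thesis by (simp add: move_def chart_inv_B)
qed

lemma move_one:
  assumes "x \<in> B k" "z \<in> B k" "s * b k x = 1"
  shows "move k s x z = x"
  unfolding move_def assms(3) using assms(1,2) by (simp add: chart_inv_B)

lemma moves_start: "moves n ((x, y), 0) = y"
  by (induction n) (simp_all add: move_zero)

lemma moves_diag: "moves n ((x, x), s) = x"
  by (induction n) (simp_all add: move_self)

lemma moves_stable:
  assumes "\<forall>k\<ge>n. b k x = 0" "n \<le> n'"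
  shows "moves n' ((x, y), s) = moves n ((x, y), s)"
  using assms(2) by (induction n' rule: dec_induct) (simp_all add: move_zero assms(1))

abbreviation square :: "'a set \<Rightarrow> (('a \<times> 'a) \<times> real) topology" where
  "square W \<equiv> subtopology (prod_topology (prod_topology M M) (top_of_set {0..1})) ((W \<times> W) \<times> UNIV)"

text \<open>At \<open>x = y = x0\<close> the intermediate points never leave \<open>x0\<close>. By
  compactness of \<open>[0, 1]\<close> they remain in \<open>B n\<close> for all \<open>s\<close>
  once \<open>x\<close> and \<open>y\<close> are close to \<open>x0\<close>, and there the next move
  is given by the chart formula. Each step costs one shrinking of the neighbourhood.\<close>

lemma moves_local:
  assumes W: "openin M W" "x0 \<in> W" and WB: "\<And>k. W \<subseteq> B k \<or> (\<forall>y\<in>W. b k y = 0)"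
  shows "\<exists>W'. openin M W' \<and> x0 \<in> W' \<and> W' \<subseteq> W \<and> continuous_map (square W') M (moves n) \<and>
    (\<forall>x\<in>W'. \<forall>y\<in>W'. (\<exists>k<n. b k x = 1) \<longrightarrow> moves n ((x, y), 1) = x)"
proof (induction n)
  case 0
  have "continuous_map (square W) M (snd \<circ> fst)"
    by (intro continuous_map_from_subtopology continuous_map_compose[OF continuous_map_fst continuous_map_snd])
  then have "continuous_map (square W) M (moves 0)"
    by (rule continuous_map_eq) simp
  with W show ?case
    by (intro exI[of _ W] conjI ballI impI) (simp_all only: order_refl not_less_zero, blast)
next
  case (Suc n)
  let ?I = "top_of_set {0..1::real}"
  obtain W' where W': "openin M W'" "x0 \<in> W'" "W' \<subseteq> W" and cont: "continuous_map (square W') M (moves n)"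
    and one: "\<forall>x\<in>W'. \<forall>y\<in>W'. (\<exists>k<n. b k x = 1) \<longrightarrow> moves n ((x, y), 1) = x"
    using Suc.IH by (elim exE conjE)
  show ?case
  proof (cases "W \<subseteq> B n")
    case False
    then have zero: "b n x = 0" if "x \<in> W'" for x
      using that WB[of n] W'(3) by blast
    have "moves (Suc n) p = moves n p" if "p \<in> topspace (square W')" for p
      using that zero[of "fst (fst p)"] by (auto simp: move_zero)
    with cont have "continuous_map (square W') M (moves (Suc n))"
      by (intro continuous_map_eq[OF cont]) simp
    moreover have "\<forall>x\<in>W'. \<forall>y\<in>W'. (\<exists>k<Suc n. b k x = 1) \<longrightarrow> moves (Suc n) ((x, y), 1) = x"
      using one zero by (auto simp: less_Suc_eq move_self)
    ultimately show ?thesis using W' by (intro exI[of _ W'] conjI)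
  next
    case True
    have x0: "x0 \<in> topspace M" using W openin_subset by blast
    let ?Q = "prod_topology (prod_topology M M) ?I"
    define V where "V = {p \<in> topspace (square W'). moves n p \<in> B n}"
    have "openin (square W') V"
      unfolding V_def by (rule openin_continuous_map_preimage[OF cont B_open])
    moreover have "square W' = subtopology ?Q ((W' \<times> W') \<times> topspace ?I)"
    proof -
      have "topspace ?Q \<inter> ((W' \<times> W') \<times> UNIV) = (W' \<times> W') \<times> topspace ?I"
        using openin_subset[OF W'(1)] by auto
      then show ?thesis by (metis subtopology_restrict)
    qed
    moreover have "openin ?Q ((W' \<times> W') \<times> topspace ?I)"
      using W'(1) by (intro openin_prod_Times_iff[THEN iffD2] disjI2 conjI openin_topspace)
    ultimately have V: "openin ?Q V"
      by (simp only: openin_open_subtopology)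
    have "{(x0, x0)} \<times> {0..1} \<subseteq> V"
      using x0 W' W True by (auto simp: V_def moves_diag)
    moreover have "compactin ?I {0..1}" by (simp add: compactin_subtopology)
    ultimately obtain A T where A: "openin (prod_topology M M) A" "(x0, x0) \<in> A" "{0..1} \<subseteq> T" "A \<times> T \<subseteq> V"
      using tube_lemma_right[OF V, of "{0..1}" "(x0, x0)"] x0 by auto
    then obtain A1 A2 where A12: "openin M A1" "openin M A2" "x0 \<in> A1" "x0 \<in> A2" "A1 \<times> A2 \<subseteq> A"
      unfolding openin_prod_topology_alt by metis
    define W'' where "W'' = W' \<inter> (A1 \<inter> A2)"
    have W'': "openin M W''" "x0 \<in> W''" "W'' \<subseteq> W'"
      using W' A12 by (auto simp: W''_def)
    have inB: "moves n p \<in> B n \<and> fst (fst p) \<in> B n" if p: "p \<in> topspace (square W'')" for p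
    proof
      have "p \<in> A \<times> T"
        using p A12(5) A(3) by (auto simp: W''_def)
      then show "moves n p \<in> B n" using A(4) by (auto simp: V_def)
      have "fst (fst p) \<in> W''" using p by auto
      then show "fst (fst p) \<in> B n" using W''(3) W'(3) True by blast
    qed
    have cont'': "continuous_map (square W'') M (moves n)"
      using W''(3) by (intro continuous_map_from_subtopology_mono[OF cont]) auto
    let ?Cn = "subtopology M (fst (c n))"
    have m: "continuous_map (square W'') ?Cn (moves n)"
      unfolding continuous_map_in_subtopology using cont'' inB B_chart[of n] by blast
    have x: "continuous_map (square W'') M (\<lambda>p. fst (fst p))"
      using continuous_map_compose[OF continuous_map_fst[of "prod_topology M M" ?I] continuous_map_fst]
      by (intro continuous_map_from_subtopology) (simp add: o_def)
    then have x': "continuous_map (square W'') ?Cn (\<lambda>p. fst (fst p))"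
      unfolding continuous_map_in_subtopology using inB B_chart[of n] by blast
    have s: "continuous_map (square W'') euclideanreal snd"
      using continuous_map_snd[of "prod_topology M M" ?I]
      by (intro continuous_map_from_subtopology) (simp add: continuous_map_in_subtopology)
    let ?comb = "\<lambda>p i. (1 - snd p * b n (fst (fst p))) * snd (c n) (moves n p) i + snd p * b n (fst (fst p)) * snd (c n) (fst (fst p)) i"
    have coord: "continuous_map (square W'') euclideanreal (\<lambda>p. snd (c n) (f p) i)"
      if "continuous_map (square W'') ?Cn f" for f i
      using continuous_map_compose[OF that continuous_chart_coordinate[OF c]] by (simp add: o_def)
    have bx: "continuous_map (square W'') euclideanreal (\<lambda>p. b n (fst (fst p)))"
      using continuous_map_compose[OF x b_continuous] by (simp add: o_def)
    have comb: "continuous_map (square W'') (Euclidean_space m) ?comb"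
    proof (rule continuous_map_into_Euclidean_space)
      show "continuous_map (square W'') euclideanreal (\<lambda>p. ?comb p i)" for i
        by (intro continuous_map_add continuous_map_real_mult continuous_map_diff coord m x' bx s) simp_all
      show "?comb p i = 0" if p: "p \<in> topspace (square W'')" and i: "m \<le> i" for p i
      proof -
        have "snd (c n) z i = 0" if "z \<in> B n" for z
          using chart_Euclidean[OF c, of z n] that i B_chart[of n] by (auto simp: topspace_Euclidean_space)
        then show ?thesis using inB[OF p] by simp
      qed
    qed
    have combB: "?comb p \<in> snd (c n) ` B n" if p: "p \<in> topspace (square W'')" for p
    proof (rule B_convex)
      have "snd p \<in> {0..1}" using p by auto
      then show "snd p * b n (fst (fst p)) \<in> {0..1}"
        using b_range[of n "fst (fst p)"] by (simp add: mult_le_one)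
    qed (use inB[OF p] in auto)
    have "continuous_map (square W'') (subtopology (Euclidean_space m) (snd (c n) ` fst (c n))) ?comb"
      unfolding continuous_map_in_subtopology using comb combB B_chart[of n] by blast
    from continuous_map_compose[OF this continuous_chart_inv[OF c]]
    have "continuous_map (square W'') M (moves (Suc n))"
      by (rule continuous_map_eq) (simp add: move_def inB)
    moreover have "moves (Suc n) ((x, y), 1) = x" if xy: "x \<in> W''" "y \<in> W''" and k: "\<exists>k<Suc n. b k x = 1" for x y
    proof (cases "b n x = 1")
      case True
      have "((x, y), 1) \<in> topspace (square W'')"
        using xy W''(1) openin_subset by fastforce
      from inB[OF this] True show ?thesis by (simp add: move_one)
    next
      case False
      with k have "\<exists>k<n. b k x = 1" by (auto simp: less_Suc_eq)
      with one xy W''(3) have "moves n ((x, y), 1) = x" by blast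
      then show ?thesis by (simp add: move_self)
    qed
    ultimately show ?thesis
      using W''(1,2) order.trans[OF W''(3) W'(3)] by (intro exI[of _ W''] conjI ballI impI)
  qed
qed

text \<open>A number of steps attached to the point itself, so that the contraction is a single
  global map. Any bound valid on a neighbourhood gives the same result, as the additional steps have
  weight zero.\<close>

definition level :: "'a \<Rightarrow> nat" where
  "level x = (LEAST n. \<forall>k\<ge>n. b k x = 0)"

lemma level_le:
  assumes "\<forall>k\<ge>n. b k x = 0"
  shows "level x \<le> n" "\<forall>k\<ge>level x. b k x = 0"
  unfolding level_def using assms by (rule Least_le, rule LeastI)

definition contraction :: "('a \<times> 'a) \<times> real \<Rightarrow> 'a" where
  "contraction p = moves (level (fst (fst p))) p"

lemma contraction_eq_moves:
  assumes "\<forall>k\<ge>n. b k x = 0"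
  shows "contraction ((x, y), s) = moves n ((x, y), s)"
  using moves_stable[OF level_le(2)[OF assms] level_le(1)[OF assms]] by (simp add: contraction_def)

lemma contraction_local:
  assumes x0: "x0 \<in> topspace M"
  shows "\<exists>W. openin M W \<and> x0 \<in> W \<and> continuous_map (square W) M contraction \<and>
    (\<forall>x\<in>W. \<forall>y\<in>W. contraction ((x, y), 1) = x)"
proof -
  obtain W n where W: "openin M W" "x0 \<in> W" and n: "\<forall>k\<ge>n. \<forall>y\<in>W. b k y = 0"
    and WB: "\<forall>k. W \<subseteq> B k \<or> (\<forall>y\<in>W. b k y = 0)"
    using b_locally_finite[OF x0] by (elim exE conjE)
  obtain W' where W': "openin M W'" "x0 \<in> W'" "W' \<subseteq> W" and cont: "continuous_map (square W') M (moves n)"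
    and one: "\<forall>x\<in>W'. \<forall>y\<in>W'. (\<exists>k<n. b k x = 1) \<longrightarrow> moves n ((x, y), 1) = x"
    using moves_local[OF W spec[OF WB], of n] by (elim exE conjE)
  have eq: "contraction ((x, y), s) = moves n ((x, y), s)" if "x \<in> W'" for x y s
    using that n W'(3) by (intro contraction_eq_moves) blast
  have "continuous_map (square W') M contraction"
  proof (rule continuous_map_eq[OF cont])
    fix p assume "p \<in> topspace (square W')"
    then show "moves n p = contraction p" by (cases p) (auto simp: eq)
  qed
  moreover have "contraction ((x, y), 1) = x" if xy: "x \<in> W'" "y \<in> W'" for x y
  proof -
    have xW: "x \<in> W" using xy W'(3) by blast
    then obtain k where k: "b k x = 1" using b_one W(1) openin_subset by blast
    have "k < n" using n xW k by (metis not_less zero_neq_one)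
    with k one xy have "moves n ((x, y), 1) = x" by blast
    then show ?thesis by (simp add: eq[OF xy(1)])
  qed
  ultimately show ?thesis using W' by (intro exI[of _ W'] conjI ballI)
qed

lemma contraction_diag: "contraction ((x, x), s) = x"
  by (simp add: contraction_def moves_diag)

lemma contraction_start: "contraction ((x, y), 0) = y"
  by (simp add: contraction_def moves_start)

text \<open>
  A substitute for the inverse of the exponential map: in a chart around \<open>x\<close>, the displacement is
  to first order a positive multiple of \<open>y - x\<close>, hence nonzero for \<open>y \<noteq> x\<close> close to \<open>x\<close>.
\<close>

definition displacement :: "nat \<Rightarrow> 'a chart \<Rightarrow> 'a \<Rightarrow> 'a \<Rightarrow> nat \<Rightarrow> real" where
  "displacement n d x y j =
     (\<Sum>k<n. b k x * (\<Sum>i<m. chart_jacobian (c k) d x j i * (snd (c k) y i - snd (c k) x i)))"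

text \<open>Restriction to \<open>charts_at\<close> and zero coordinates from \<open>m\<close> on
  give the normal form demanded by \<open>tangent_space\<close>.\<close>

definition displacement_vector :: "'a \<times> 'a \<Rightarrow> 'a \<times> ('a chart \<Rightarrow> nat \<Rightarrow> real)" where
  "displacement_vector p = (fst p, \<lambda>d\<in>charts_at \<A> (fst p). \<lambda>j.
     if j < m then displacement (level (fst p)) d (fst p) (snd p) j else 0)"

lemma displacement_stable:
  assumes "\<forall>k\<ge>n. b k x = 0"
  shows "displacement (level x) d x y j = displacement n d x y j"
  unfolding displacement_def using level_le[OF assms]
  by (intro sum.mono_neutral_left) auto

lemma displacement_vector_diag: "displacement_vector (x, x) = tangent_zero \<A> x"
  by (auto simp: displacement_vector_def tangent_zero_def displacement_def restrict_def fun_eq_iff)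

lemma b_zero_outside: "x \<in> topspace M \<Longrightarrow> x \<notin> B k \<Longrightarrow> b k x = 0"
  using b_locally_finite[of x] by blast

text \<open>Each summand is a vector with given coordinates in \<open>c k\<close>, expressed in
  \<open>d\<close>; the chain rule for Jacobians yields its transformation law. The point
  \<open>y\<close> enters only through these coordinates and may be arbitrary.\<close>

lemma displacement_vector_tangent:
  assumes x: "x \<in> topspace M"
  shows "snd (displacement_vector (x, y)) \<in> tangent_space m \<A> x"
  unfolding tangent_space_def
proof (intro CollectI conjI ballI allI impI)
  let ?v = "snd (displacement_vector (x, y))"
  show "?v \<in> (\<Pi>\<^sub>E c\<in>charts_at \<A> x. topspace (Euclidean_space m))"
    by (auto simp: displacement_vector_def topspace_Euclidean_space)
  fix d d' j assume d: "d \<in> charts_at \<A> x" and d': "d' \<in> charts_at \<A> x" and j: "j < m"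
  let ?n = "level x" and ?\<delta> = "\<lambda>k i. snd (c k) y i - snd (c k) x i"
  let ?J = "chart_jacobian"
  have "(\<Sum>l<m. ?J d d' x j l * displacement ?n d x y l) =
      (\<Sum>l<m. \<Sum>k<?n. b k x * (\<Sum>i<m. ?J d d' x j l * (?J (c k) d x l i * ?\<delta> k i)))"
    by (simp only: displacement_def sum_distrib_left mult.left_commute)
  also have "\<dots> = (\<Sum>k<?n. b k x * (\<Sum>l<m. \<Sum>i<m. ?J d d' x j l * (?J (c k) d x l i * ?\<delta> k i)))"
    by (subst sum.swap) (simp only: sum_distrib_left)
  also have "\<dots> = displacement ?n d' x y j"
    unfolding displacement_def
  proof (rule sum.cong)
    fix k
    show "b k x * (\<Sum>l<m. \<Sum>i<m. ?J d d' x j l * (?J (c k) d x l i * ?\<delta> k i)) =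
        b k x * (\<Sum>i<m. ?J (c k) d' x j i * ?\<delta> k i)"
    \<comment> \<open>The chain rule requires \<open>x\<close> in the domain of \<open>c k\<close>;
      outside \<open>B k\<close> the weight is zero.\<close>
    proof (cases "x \<in> B k")
      case True
      then have xk: "x \<in> fst (c k)" using B_chart by blast
      have "(\<Sum>l<m. \<Sum>i<m. ?J d d' x j l * (?J (c k) d x l i * ?\<delta> k i)) =
          (\<Sum>i<m. (\<Sum>l<m. ?J d d' x j l * ?J (c k) d x l i) * ?\<delta> k i)"
        by (subst sum.swap) (simp only: sum_distrib_right mult.assoc)
      also have "\<dots> = (\<Sum>i<m. ?J (c k) d' x j i * ?\<delta> k i)"
        using d d' j xk c by (intro sum.cong refl) (simp add: charts_at_def jacobian_chain[of "c k" d d'])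
      finally show ?thesis by simp
    next
      case False
      then show ?thesis using x by (simp add: b_zero_outside)
    qed
  qed simp
  finally show "?v d' j = (\<Sum>i<m. partial_deriv i (\<lambda>y. chart_change d d' y j) (snd d x) * ?v d i)"
    using d d' j by (simp add: displacement_vector_def chart_jacobian_def)
qed

text \<open>Generators of the topology of the tangent bundle are described in a single chart
  \<open>d\<close>, so it suffices to check coordinates there. On \<open>W\<close> they are sums
  over \<open>k < n\<close>, and the terms with \<open>W\<close> not inside \<open>B k\<close>
  vanish.\<close>

lemma displacement_vector_continuous:
  assumes W: "openin M W" and n: "\<forall>k\<ge>n. \<forall>y\<in>W. b k y = 0"
    and WB: "\<And>k. W \<subseteq> B k \<or> (\<forall>y\<in>W. b k y = 0)"
  shows "continuous_map (subtopology (prod_topology M M) (W \<times> W)) (tangent_bundle m \<A>) displacement_vector"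
  unfolding tangent_bundle_def continuous_on_generated_topo_iff
proof (intro conjI allI impI)
  let ?E = "Euclidean_space m" and ?S = "subtopology (prod_topology M M) (W \<times> W)"
  have WM: "W \<subseteq> topspace M" using W by (rule openin_subset)
  have Sto: "topspace ?S = W \<times> W" using WM by auto
  show "displacement_vector ` topspace ?S \<subseteq> \<Union> {{(x, v). x \<in> fst c \<and> v \<in> tangent_space m \<A> x \<and> (snd c x, v c) \<in> V} |
      c V. c \<in> \<A> \<and> openin (prod_topology ?E ?E) V}"
  proof
    fix q assume "q \<in> displacement_vector ` topspace ?S"
    then obtain x y where q: "q = displacement_vector (x, y)" and x: "x \<in> topspace M" by auto
    then obtain d where d: "d \<in> \<A>" "x \<in> fst d" using topspace_atlas by auto
    have T: "snd q \<in> tangent_space m \<A> x" unfolding q by (rule displacement_vector_tangent[OF x])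
    moreover have "d \<in> charts_at \<A> x" using d by (simp add: charts_at_def)
    ultimately have "snd q d \<in> topspace ?E" by (auto simp: tangent_space_def)
    moreover have "fst q = x" by (simp add: q displacement_vector_def)
    ultimately have "q \<in> {(x, v). x \<in> fst d \<and> v \<in> tangent_space m \<A> x \<and> (snd d x, v d) \<in> topspace (prod_topology ?E ?E)}"
      using T d chart_Euclidean[OF d] by (cases q) simp
    with d(1) show "q \<in> \<Union> {{(x, v). x \<in> fst c \<and> v \<in> tangent_space m \<A> x \<and> (snd c x, v c) \<in> V} |
      c V. c \<in> \<A> \<and> openin (prod_topology ?E ?E) V}"
      using openin_topspace[of "prod_topology ?E ?E"] by blast
  qed
  fix Y assume "Y \<in> {{(x, v). x \<in> fst c \<and> v \<in> tangent_space m \<A> x \<and> (snd c x, v c) \<in> V} |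
      c V. c \<in> \<A> \<and> openin (prod_topology ?E ?E) V}"
  then obtain d V where d: "d \<in> \<A>" and V: "openin (prod_topology ?E ?E) V"
    and Y: "Y = {(x, v). x \<in> fst d \<and> v \<in> tangent_space m \<A> x \<and> (snd d x, v d) \<in> V}" by blast
  \<comment> \<open>Only the first point has to lie in the chart \<open>d\<close>, as the vector is
    based there.\<close>
  let ?O = "(W \<inter> fst d) \<times> W"
  let ?T = "subtopology (prod_topology M M) ?O"
  have Oo: "openin (prod_topology M M) ?O"
    using W chart_open[OF d] by (simp add: openin_prod_Times_iff openin_Int)
  have Tto: "topspace ?T = ?O" using WM by auto
  have x: "continuous_map ?T M fst" and y: "continuous_map ?T M snd"
    by (intro continuous_map_from_subtopology continuous_map_fst continuous_map_snd)+
  let ?comp = "\<lambda>p j. if j < m then displacement n d (fst p) (snd p) j else 0"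
  have term_cont: "continuous_map ?T euclideanreal
      (\<lambda>p. b k (fst p) * (\<Sum>i<m. chart_jacobian (c k) d (fst p) j i * (snd (c k) (snd p) i - snd (c k) (fst p) i)))"
    if j: "j < m" for k j
  proof (cases "W \<subseteq> B k")
    case True
    then have Wk: "W \<subseteq> fst (c k)" using B_chart by blast
    have bx: "continuous_map ?T euclideanreal (\<lambda>p. b k (fst p))"
      using continuous_map_compose[OF x b_continuous] by (simp add: o_def)
    have "continuous_map ?T (subtopology M (fst (c k) \<inter> fst d)) fst"
      using x Wk by (auto simp: continuous_map_in_subtopology)
    from continuous_map_compose[OF this continuous_jacobian[OF c d j]]
    have J: "continuous_map ?T euclideanreal (\<lambda>p. chart_jacobian (c k) d (fst p) j i)" if "i < m" for i
      using that by (simp add: o_def)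
    have "continuous_map ?T (subtopology M (fst (c k))) fst" "continuous_map ?T (subtopology M (fst (c k))) snd"
      using x y Wk by (auto simp: continuous_map_in_subtopology)
    from this[THEN continuous_map_compose, OF continuous_chart_coordinate[OF c]]
    have "continuous_map ?T euclideanreal (\<lambda>p. snd (c k) (fst p) i)" "continuous_map ?T euclideanreal (\<lambda>p. snd (c k) (snd p) i)" for i
      by (simp_all add: o_def)
    then show ?thesis
      by (intro continuous_map_real_mult bx continuous_map_sum continuous_map_diff J) simp_all
  next
    case False
    then have "b k y = 0" if "y \<in> W" for y using WB[of k] that by blast
    then show ?thesis
      by (intro continuous_map_eq[OF continuous_map_const[THEN iffD2, OF disjI2], of 0]) (auto simp: Tto)
  qed
  have comp: "continuous_map ?T ?E ?comp"
  proof (rule continuous_map_into_Euclidean_space)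
    fix j assume "j < m"
    then show "continuous_map ?T euclideanreal (\<lambda>p. ?comp p j)"
      unfolding displacement_def by (simp add: continuous_map_sum term_cont)
  qed simp
  have "continuous_map ?T (subtopology M (fst d)) fst"
    using x by (auto simp: continuous_map_in_subtopology)
  from continuous_map_compose[OF this continuous_chart[OF d]] comp
  have pair: "continuous_map ?T (prod_topology ?E ?E) (\<lambda>p. (snd d (fst p), ?comp p))"
    by (simp add: continuous_map_paired o_def)
  have "openin ?T {p \<in> topspace ?T. (snd d (fst p), ?comp p) \<in> V}"
    by (rule openin_continuous_map_preimage[OF pair V])
  then have o: "openin (prod_topology M M) {p \<in> ?O. (snd d (fst p), ?comp p) \<in> V}"
    unfolding Tto using Oo by (rule openin_trans_full)
  have "displacement_vector -` Y \<inter> topspace ?S = {p \<in> ?O. (snd d (fst p), ?comp p) \<in> V}"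
  proof -
    have "displacement_vector p \<in> Y \<longleftrightarrow> fst p \<in> fst d \<and> (snd d (fst p), ?comp p) \<in> V" if p: "p \<in> W \<times> W" for p
    proof (cases "fst p \<in> fst d")
      case True
      have "fst p \<in> W" using p by auto
      then have b0: "\<forall>k\<ge>n. b k (fst p) = 0" using n by blast
      have "snd (displacement_vector p) d = ?comp p"
        using True d by (simp add: displacement_vector_def charts_at_def displacement_stable[OF b0] cong: if_cong)
      moreover have "snd (displacement_vector p) \<in> tangent_space m \<A> (fst p)"
        using displacement_vector_tangent[of "fst p" "snd p"] p WM by auto
      moreover have "displacement_vector p = (fst p, snd (displacement_vector p))"
        by (simp add: displacement_vector_def)
      ultimately show ?thesis using True unfolding Y by (metis (no_types, lifting) case_prodD case_prodI mem_Collect_eq)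
    next
      case False
      then show ?thesis by (simp add: Y displacement_vector_def)
    qed
    moreover have "p \<in> ?O \<longleftrightarrow> p \<in> W \<times> W \<and> fst p \<in> fst d" for p by auto
    ultimately show ?thesis unfolding Sto by blast
  qed
  with o have "openin (prod_topology M M) (displacement_vector -` Y \<inter> topspace ?S)" by (simp only:)
  then show "openin ?S (displacement_vector -` Y \<inter> topspace ?S)"
    unfolding openin_subtopology Sto by (intro exI[of _ "displacement_vector -` Y \<inter> (W \<times> W)"]) auto
qed

text \<open>In a fixed chart \<open>d\<close>, the scalar product of the displacement with the
  difference of coordinates is a sum of nonnegative terms, and a term of weight \<open>1\<close> is
  positive. Nonvanishing of the individual displacements would not exclude cancellation.\<close>

lemma displacement_vector_nonzero:
  assumes x0: "x0 \<in> topspace M" and W: "openin M W" "x0 \<in> W" and n: "\<forall>k\<ge>n. \<forall>y\<in>W. b k y = 0"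
    and WB: "\<And>k. W \<subseteq> B k \<or> (\<forall>y\<in>W. b k y = 0)"
  shows "\<exists>W'. openin M W' \<and> x0 \<in> W' \<and> W' \<subseteq> W \<and>
    (\<forall>x\<in>W'. \<forall>y\<in>W'. x \<noteq> y \<longrightarrow> displacement_vector (x, y) \<notin> range (tangent_zero \<A>))"
proof -
  obtain d where d: "d \<in> \<A>" "x0 \<in> fst d" using x0 topspace_atlas by auto
  define pos where "pos = (\<lambda>k x y. (\<Sum>j<m. (\<Sum>i<m. chart_jacobian (c k) d x j i * (snd (c k) y i - snd (c k) x i)) * (snd d y j - snd d x j)))"
  have "\<exists>V. openin M V \<and> x0 \<in> V \<and> (W \<subseteq> B k \<longrightarrow> (\<forall>x\<in>V. \<forall>y\<in>V. x \<noteq> y \<longrightarrow> 0 < pos k x y))" for k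
  proof (cases "W \<subseteq> B k")
    case True
    then have "x0 \<in> fst (c k) \<inter> fst d" using W(2) B_chart d by blast
    from jacobian_displacement_positive[OF c d(1) this] show ?thesis
      unfolding pos_def by blast
  qed (use W in blast)
  then obtain V where V: "\<And>k. openin M (V k)" "\<And>k. x0 \<in> V k"
    and pos: "\<And>k x y. W \<subseteq> B k \<Longrightarrow> x \<in> V k \<Longrightarrow> y \<in> V k \<Longrightarrow> x \<noteq> y \<Longrightarrow> 0 < pos k x y"
    by metis
  \<comment> \<open>The index set \<open>{..n}\<close> instead of \<open>{..<n}\<close> is nonempty
    even for \<open>n = 0\<close>.\<close>
  define W' where "W' = W \<inter> fst d \<inter> (\<Inter>k\<in>{..n}. V k)"
  have "openin M W'"
    unfolding W'_def using V W chart_open[OF d(1)] by (intro openin_Int openin_INT2) auto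
  moreover have "x0 \<in> W'" using V W d by (simp add: W'_def)
  moreover have "displacement_vector (x, y) \<notin> range (tangent_zero \<A>)"
    if x: "x \<in> W'" and y: "y \<in> W'" and xy: "x \<noteq> y" for x y
  proof
    assume "displacement_vector (x, y) \<in> range (tangent_zero \<A>)"
    then have "displacement_vector (x, y) = tangent_zero \<A> x"
      by (auto simp: displacement_vector_def tangent_zero_def)
    moreover have "d \<in> charts_at \<A> x" using x d by (simp add: W'_def charts_at_def)
    ultimately have "(if j < m then displacement (level x) d x y j else 0) = 0" for j
    proof -
      assume eq: "displacement_vector (x, y) = tangent_zero \<A> x" and dx: "d \<in> charts_at \<A> x"
      have "snd (displacement_vector (x, y)) d j = snd (tangent_zero \<A> x) d j" by (simp only: eq)
      then show ?thesis using dx by (simp add: displacement_vector_def tangent_zero_def cong: if_cong)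
    qed
    moreover have xW: "x \<in> W" using x by (simp add: W'_def)
    then have "\<forall>k\<ge>n. b k x = 0" using n by blast
    ultimately have zero: "displacement n d x y j = 0" if "j < m" for j
      using that displacement_stable by metis
    have "0 = (\<Sum>j<m. displacement n d x y j * (snd d y j - snd d x j))"
      using zero by simp
    also have "\<dots> = (\<Sum>k<n. b k x * pos k x y)"
      unfolding displacement_def pos_def sum_distrib_left sum_distrib_right
      by (subst sum.swap) (simp only: mult.assoc)
    also have "\<dots> > 0"
    proof -
      obtain k where k: "b k x = 1" using b_one xW W(1) openin_subset by blast
      have "k < n" using n xW k by (metis not_less zero_neq_one)
      moreover have nonneg: "0 \<le> b k x * pos k x y" if "k < n" for k
      proof (cases "W \<subseteq> B k")
        case True
        then have "0 < pos k x y" using x y xy that by (intro pos) (auto simp: W'_def)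
        then show ?thesis using b_range[of k x] by simp
      next
        case False
        then show ?thesis using WB[of k] xW by simp
      qed
      moreover have "0 < b k x * pos k x y"
      proof -
        have "W \<subseteq> B k" using WB[of k] xW k by force
        then have "0 < pos k x y" using x y xy \<open>k < n\<close> by (intro pos) (auto simp: W'_def)
        then show ?thesis using k by simp
      qed
      ultimately show ?thesis by (intro sum_pos2[of _ k]) auto
    qed
    finally show False by simp
  qed
  moreover have "W' \<subseteq> W" by (auto simp: W'_def)
  ultimately show ?thesis by (intro exI[of _ W'] conjI ballI impI)
qed

end

text \<open>A union of squares \<open>W \<times> W\<close> works because both maps are already
  defined globally and every assertion is either local or concerns a single pair, whose two points
  share one \<open>W\<close>.\<close>

lemma (in bump_atlas) diagonal_neighbourhood_bump:
  "\<exists>\<Omega>. openin (prod_topology M M) \<Omega> \<and> (\<forall>x\<in>topspace M. (x, x) \<in> \<Omega>) \<and>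
    continuous_map (prod_topology (subtopology (prod_topology M M) \<Omega>) (top_of_set {0..1})) M contraction \<and>
    (\<forall>x y. (x, y) \<in> \<Omega> \<longrightarrow> contraction ((x, y), 1) = x) \<and>
    continuous_map (subtopology (prod_topology M M) \<Omega>) (tangent_bundle m \<A>) displacement_vector \<and>
    (\<forall>x y. (x, y) \<in> \<Omega> \<longrightarrow> x \<noteq> y \<longrightarrow> displacement_vector (x, y) \<notin> range (tangent_zero \<A>))"
proof -
  let ?Q = "prod_topology M M" and ?I = "top_of_set {0..1::real}"
  define good where "good = (\<lambda>W. openin M W \<and> continuous_map (square W) M contraction \<and>
    (\<forall>x\<in>W. \<forall>y\<in>W. contraction ((x, y), 1) = x) \<and>
    continuous_map (subtopology ?Q (W \<times> W)) (tangent_bundle m \<A>) displacement_vector \<and>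
    (\<forall>x\<in>W. \<forall>y\<in>W. x \<noteq> y \<longrightarrow> displacement_vector (x, y) \<notin> range (tangent_zero \<A>)))"
  have good: "\<exists>W. good W \<and> x0 \<in> W" if x0: "x0 \<in> topspace M" for x0
  proof -
    obtain W n where W: "openin M W" "x0 \<in> W" and n: "\<forall>k\<ge>n. \<forall>y\<in>W. b k y = 0"
      and WB: "\<forall>k. W \<subseteq> B k \<or> (\<forall>y\<in>W. b k y = 0)"
      using b_locally_finite[OF x0] by (elim exE conjE)
    obtain W1 where W1: "openin M W1" "x0 \<in> W1" "W1 \<subseteq> W"
      and nz: "\<forall>x\<in>W1. \<forall>y\<in>W1. x \<noteq> y \<longrightarrow> displacement_vector (x, y) \<notin> range (tangent_zero \<A>)"
      using displacement_vector_nonzero[OF x0 W n spec[OF WB]] by (elim exE conjE)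
    obtain W2 where W2: "openin M W2" "x0 \<in> W2" "continuous_map (square W2) M contraction"
      and one: "\<forall>x\<in>W2. \<forall>y\<in>W2. contraction ((x, y), 1) = x"
      using contraction_local[OF x0] by (elim exE conjE)
    have "good (W1 \<inter> W2)"
      unfolding good_def
    proof (intro conjI)
      show "continuous_map (square (W1 \<inter> W2)) M contraction"
        by (rule continuous_map_from_subtopology_mono[OF W2(3)]) auto
      show "continuous_map (subtopology ?Q ((W1 \<inter> W2) \<times> (W1 \<inter> W2))) (tangent_bundle m \<A>) displacement_vector"
        by (rule continuous_map_from_subtopology_mono[OF displacement_vector_continuous[OF W(1) n spec[OF WB]]])
          (use W1(3) in auto)
      show "openin M (W1 \<inter> W2)" using W1(1) W2(1) by (rule openin_Int)
      show "\<forall>x\<in>W1 \<inter> W2. \<forall>y\<in>W1 \<inter> W2. contraction ((x, y), 1) = x" using one by blast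
      show "\<forall>x\<in>W1 \<inter> W2. \<forall>y\<in>W1 \<inter> W2. x \<noteq> y \<longrightarrow> displacement_vector (x, y) \<notin> range (tangent_zero \<A>)"
        by (intro ballI) (rule bspec[OF bspec[OF nz IntD1] IntD1])
    qed
    moreover have "x0 \<in> W1 \<inter> W2" using W1(2) W2(2) by (rule IntI)
    ultimately show ?thesis by (intro exI[of _ "W1 \<inter> W2"] conjI)
  qed
  define \<Omega> where "\<Omega> = \<Union>{W \<times> W | W. good W}"
  have good_open: "openin ?Q (W \<times> W)" if "good W" for W
    using that by (simp add: good_def openin_prod_Times_iff)
  have \<Omega>I: "q \<in> \<Omega>" if "good W" "q \<in> W \<times> W" for q W
    using that unfolding \<Omega>_def by (intro UnionI[of "W \<times> W"] CollectI exI[of _ W] conjI refl)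
  have \<Omega>D: "\<exists>W. good W \<and> q \<in> W \<times> W" if "q \<in> \<Omega>" for q
    using that unfolding \<Omega>_def by (elim UnionE CollectE exE conjE) (rule exI, rule conjI, assumption, simp)
  have "openin ?Q \<Omega>"
    unfolding \<Omega>_def using good_open by (intro openin_Union) auto
  moreover have "\<forall>x\<in>topspace M. (x, x) \<in> \<Omega>"
  proof
    fix x assume "x \<in> topspace M"
    from good[OF this] obtain W where "good W" "x \<in> W" by (elim exE conjE)
    then show "(x, x) \<in> \<Omega>" by (intro \<Omega>I[of W]) simp_all
  qed
  moreover have "continuous_map (prod_topology (subtopology ?Q \<Omega>) ?I) M contraction"
  proof (rule continuous_map_open_cover)
    fix p assume "p \<in> topspace (prod_topology (subtopology ?Q \<Omega>) ?I)"
    then have p: "fst p \<in> \<Omega>" "p \<in> topspace (prod_topology ?Q ?I)" by auto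
    from \<Omega>D[OF p(1)] obtain W where W: "good W" "fst p \<in> W \<times> W" by (elim exE conjE)
    have eq: "prod_topology (subtopology ?Q \<Omega>) ?I = subtopology (prod_topology ?Q ?I) (\<Omega> \<times> UNIV)"
      by (simp only: subtopology_Times subtopology_UNIV)
    let ?V = "(W \<times> W) \<times> topspace ?I"
    have "openin (prod_topology ?Q ?I) ?V"
      by (rule openin_prod_Times_iff[THEN iffD2, OF disjI2, OF disjI2, OF conjI, OF good_open[OF W(1)] openin_topspace])
    moreover have "?V \<subseteq> \<Omega> \<times> UNIV" using \<Omega>I[OF W(1)] by (intro Sigma_mono subsetI) simp_all
    ultimately have "openin (prod_topology (subtopology ?Q \<Omega>) ?I) ?V"
      unfolding eq openin_subtopology by blast
    moreover have "p \<in> ?V" using p W(2) by (cases p) auto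
    moreover have "continuous_map (subtopology (prod_topology (subtopology ?Q \<Omega>) ?I) ?V) M contraction"
      unfolding eq subtopology_subtopology using W(1) unfolding good_def
      by (elim conjE continuous_map_from_subtopology_mono) auto
    ultimately show "\<exists>V. openin (prod_topology (subtopology ?Q \<Omega>) ?I) V \<and> p \<in> V \<and>
        continuous_map (subtopology (prod_topology (subtopology ?Q \<Omega>) ?I) V) M contraction"
      by blast
  qed
  moreover have "continuous_map (subtopology ?Q \<Omega>) (tangent_bundle m \<A>) displacement_vector"
  proof (rule continuous_map_open_cover)
    fix p assume "p \<in> topspace (subtopology ?Q \<Omega>)"
    then have "p \<in> \<Omega>" by simp
    from \<Omega>D[OF this] obtain W where W: "good W" "p \<in> W \<times> W" by (elim exE conjE)
    have sub: "W \<times> W \<subseteq> \<Omega>" using \<Omega>I[OF W(1)] by (rule subsetI)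
    then have "openin (subtopology ?Q \<Omega>) (W \<times> W)"
      using good_open[OF W(1)] unfolding openin_subtopology by blast
    moreover have "continuous_map (subtopology (subtopology ?Q \<Omega>) (W \<times> W)) (tangent_bundle m \<A>) displacement_vector"
      unfolding subtopology_subtopology using W(1) unfolding good_def
      by (elim conjE) (erule continuous_map_from_subtopology_mono, auto)
    ultimately show "\<exists>V. openin (subtopology ?Q \<Omega>) V \<and> p \<in> V \<and>
        continuous_map (subtopology (subtopology ?Q \<Omega>) V) (tangent_bundle m \<A>) displacement_vector"
      using W(2) by blast
  qed
  moreover have "contraction ((x, y), 1) = x" if "(x, y) \<in> \<Omega>" for x y
    using \<Omega>D[OF that] by (elim exE conjE) (simp add: good_def)
  moreover have "displacement_vector (x, y) \<notin> range (tangent_zero \<A>)" if "(x, y) \<in> \<Omega>" "x \<noteq> y" for x y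
    using \<Omega>D[OF that(1)] that(2) by (elim exE conjE) (simp add: good_def)
  ultimately show ?thesis by (intro exI[of _ \<Omega>] conjI allI impI)
qed

lemma (in smooth_atlas) diagonal_neighbourhood:
  "\<exists>\<Omega> P \<phi>. openin (prod_topology M M) \<Omega> \<and> (\<forall>x\<in>topspace M. (x, x) \<in> \<Omega>) \<and>
    continuous_map (prod_topology (subtopology (prod_topology M M) \<Omega>) (top_of_set {0..1::real})) M P \<and>
    (\<forall>x y. (x, y) \<in> \<Omega> \<longrightarrow> P ((x, y), 0) = y) \<and>
    (\<forall>x y. (x, y) \<in> \<Omega> \<longrightarrow> P ((x, y), 1) = x) \<and> (\<forall>x s. P ((x, x), s) = x) \<and>
    continuous_map (subtopology (prod_topology M M) \<Omega>) (tangent_bundle m \<A>) \<phi> \<and>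
    (\<forall>x. \<phi> (x, x) = tangent_zero \<A> x) \<and>
    (\<forall>x y. (x, y) \<in> \<Omega> \<longrightarrow> x \<noteq> y \<longrightarrow> \<phi> (x, y) \<notin> range (tangent_zero \<A>))"
proof (cases "topspace M = {}")
  \<comment> \<open>The bumps are enumerated by points of \<open>M\<close>, so the empty manifold is
    treated apart.\<close>
  case True
  then show ?thesis
    by (intro exI[of _ "{}"] exI[of _ "\<lambda>p. snd (fst p)"] exI[of _ "\<lambda>p. tangent_zero \<A> (fst p)"])
      (simp add: continuous_map_on_empty)
next
  case False
  then obtain c B b where "bump_atlas m M \<A> c B b" using bump_atlas_exists by blast
  then interpret bump_atlas m M \<A> c B b .
  obtain \<Omega> where "openin (prod_topology M M) \<Omega>" "\<forall>x\<in>topspace M. (x, x) \<in> \<Omega>"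
    "continuous_map (prod_topology (subtopology (prod_topology M M) \<Omega>) (top_of_set {0..1})) M contraction"
    "\<forall>x y. (x, y) \<in> \<Omega> \<longrightarrow> contraction ((x, y), 1) = x"
    "continuous_map (subtopology (prod_topology M M) \<Omega>) (tangent_bundle m \<A>) displacement_vector"
    "\<forall>x y. (x, y) \<in> \<Omega> \<longrightarrow> x \<noteq> y \<longrightarrow> displacement_vector (x, y) \<notin> range (tangent_zero \<A>)"
    using diagonal_neighbourhood_bump by (elim exE conjE)
  then show ?thesis
    by (intro exI[of _ \<Omega>] exI[of _ contraction] exI[of _ displacement_vector] conjI)
      (simp_all add: contraction_start contraction_diag displacement_vector_diag)
qed

section \<open>Free loop spaces\<close>

lemma topspace_free_loop_space:
  "topspace (free_loop_space M) = {w \<in> extensional circle. continuous_map (top_of_set circle) M w}"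
proof (intro equalityI subsetI)
  fix w assume w: "w \<in> {w \<in> extensional circle. continuous_map (top_of_set circle) M w}"
  \<comment> \<open>The choice \<open>K = {}\<close> imposes no condition, so one generator is the
    full set of loops.\<close>
  have "openin (free_loop_space M) {w \<in> extensional (topspace (top_of_set circle)).
      continuous_map (top_of_set circle) M w \<and> w ` {} \<subseteq> {}}"
    unfolding free_loop_space_def mapping_space_def
    by (rule topology_generated_by_Basis, rule CollectI, rule exI[of _ "{}"], rule exI[of _ "{}"]) simp
  from openin_subset[OF this] w show "w \<in> topspace (free_loop_space M)"
    by auto
qed (auto simp: free_loop_space_def mapping_space_def)

text \<open>This rests on local compactness of the circle: \<open>w\<close> maps a closed ball
  around \<open>z\<close> in the circle into \<open>V\<close>, and the loops doing so form an open
  set of the compact-open topology.\<close>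

lemma continuous_map_loop_eval:
  "continuous_map (prod_topology (free_loop_space M) (top_of_set circle)) M (\<lambda>p. fst p (snd p))"
  unfolding continuous_map_def
proof (intro conjI allI impI)
  let ?L = "free_loop_space M"
  show "(\<lambda>p. fst p (snd p)) \<in> topspace (prod_topology ?L (top_of_set circle)) \<rightarrow> topspace M"
    by (auto simp: topspace_free_loop_space continuous_map_def)
  fix V assume V: "openin M V"
  show "openin (prod_topology ?L (top_of_set circle)) {p \<in> topspace (prod_topology ?L (top_of_set circle)). fst p (snd p) \<in> V}"
    unfolding openin_prod_topology_alt
  proof (intro allI impI)
    fix w z assume wz: "(w, z) \<in> {p \<in> topspace (prod_topology ?L (top_of_set circle)). fst p (snd p) \<in> V}"
    then have w: "w \<in> extensional circle" "continuous_map (top_of_set circle) M w" and z: "z \<in> circle" "w z \<in> V"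
      by (auto simp: topspace_free_loop_space)
    have "openin (top_of_set circle) {z \<in> topspace (top_of_set circle). w z \<in> V}"
      by (rule openin_continuous_map_preimage[OF w(2) V])
    then obtain T where T: "open T" "{z \<in> circle. w z \<in> V} = circle \<inter> T"
      by (auto simp: openin_open)
    then obtain e where e: "e > 0" "cball z e \<subseteq> T"
      using z open_contains_cball[of T] by blast
    let ?K = "circle \<inter> cball z e" and ?B = "circle \<inter> ball z e"
    let ?A = "{f \<in> extensional circle. continuous_map (top_of_set circle) M f \<and> f ` ?K \<subseteq> V}"
    have "compactin (top_of_set circle) ?K"
      by (simp add: compactin_subtopology compact_Int_closed)
    then have "openin ?L ?A"
      unfolding free_loop_space_def mapping_space_def using V by (intro topology_generated_by_Basis) auto
    moreover have "openin (top_of_set circle) ?B" by (simp add: openin_open_Int)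
    moreover have "w \<in> ?A" using w e T(2) by auto
    moreover have "z \<in> ?B" using z e by simp
    moreover have "?A \<times> ?B \<subseteq> {p \<in> topspace (prod_topology ?L (top_of_set circle)). fst p (snd p) \<in> V}"
      by (auto simp: topspace_free_loop_space)
    ultimately show "\<exists>U W. openin ?L U \<and> openin (top_of_set circle) W \<and> w \<in> U \<and> z \<in> W \<and>
        U \<times> W \<subseteq> {p \<in> topspace (prod_topology ?L (top_of_set circle)). fst p (snd p) \<in> V}"
      by (intro exI[of _ ?A] exI[of _ ?B]) simp
  qed
qed

section \<open>Loops as closed paths on the unit interval\<close>

definition circle_point :: "real \<Rightarrow> complex" where
  "circle_point s = cis (2 * pi * s)"

text \<open>With values in \<open>[0, 1)\<close>, this inverse of \<open>circle_point\<close> jumps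
  at \<open>1\<close>; continuity of loops is therefore deduced from the quotient map
  \<open>circle_point\<close>.\<close>

definition circle_param :: "complex \<Rightarrow> real" where
  "circle_param z = Arg2pi z / (2 * pi)"

lemma circle_point_in_circle [simp]: "circle_point s \<in> circle"
  by (simp add: circle_point_def)

lemma circle_point_0 [simp]: "circle_point 0 = 1" and circle_point_1 [simp]: "circle_point 1 = 1"
  by (simp_all add: circle_point_def)

lemma circle_param_bounds: "0 \<le> circle_param z" "circle_param z < 1"
  using Arg2pi[of z] by (simp_all add: circle_param_def)

lemma circle_point_param: "z \<in> circle \<Longrightarrow> circle_point (circle_param z) = z"
  using Arg2pi_eq[of z] by (simp add: circle_point_def circle_param_def cis_conv_exp)

lemma circle_param_point: "0 \<le> s \<Longrightarrow> s < 1 \<Longrightarrow> circle_param (circle_point s) = s"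
  unfolding circle_param_def circle_point_def
  by (subst Arg2pi_unique[of 1 "2 * pi * s"]) (auto simp: cis_conv_exp)

lemma circle_param_1 [simp]: "circle_param 1 = 0"
  using circle_param_point[of 0] by simp

lemma continuous_map_circle_point: "continuous_map euclideanreal (top_of_set circle) circle_point"
  unfolding continuous_map_in_subtopology
  by (auto simp: circle_point_def intro!: continuous_intros)

lemma quotient_map_circle_point: "quotient_map (top_of_set {0..1}) (top_of_set circle) circle_point"
proof (rule continuous_imp_quotient_map)
  show "continuous_map (top_of_set {0..1}) (top_of_set circle) circle_point"
    by (rule continuous_map_from_subtopology[OF continuous_map_circle_point])
  show "circle_point ` topspace (top_of_set {0..1}) = topspace (top_of_set circle)"
  proof (intro equalityI subsetI)
    fix z assume "z \<in> topspace (top_of_set circle)"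
    then show "z \<in> circle_point ` topspace (top_of_set {0..1})"
      using circle_point_param[of z] circle_param_bounds[of z]
      by (intro image_eqI[of _ _ "circle_param z"]) auto
  qed (use circle_point_in_circle in auto)
qed (auto simp: compact_space_subtopology Hausdorff_space_subtopology compactin_euclidean_iff)

text \<open>The exponential law for the compact-open topology: a compact set \<open>K\<close> in the
  circle has a compact preimage \<open>K'\<close> in \<open>[0, 1]\<close>, and the tube lemma turns
  an open set around \<open>{x} \<times> K'\<close> into a neighbourhood of
  \<open>x\<close>.\<close>

lemma continuous_map_into_free_loop_space:
  assumes F: "continuous_map (prod_topology X (top_of_set {0..1})) M F"
    and closed: "\<And>x. x \<in> topspace X \<Longrightarrow> F (x, 0) = F (x, 1)"
  shows "continuous_map X (free_loop_space M) (\<lambda>x. \<lambda>z\<in>circle. F (x, circle_param z))"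
proof -
  let ?loop = "\<lambda>x. \<lambda>z\<in>circle. F (x, circle_param z)"
  \<comment> \<open>For \<open>s = 1\<close> the parameter returns to \<open>0\<close>; this is
    where \<open>closed\<close> enters.\<close>
  have param: "F (x, circle_param (circle_point s)) = F (x, s)" if "x \<in> topspace X" "s \<in> {0..1}" for x s
    using that closed circle_param_point[of s] by (cases "s = 1") auto
  have loop: "continuous_map (top_of_set circle) M (?loop x)" if x: "x \<in> topspace X" for x
  proof (rule continuous_compose_quotient_map[OF quotient_map_circle_point])
    have "continuous_map (top_of_set {0..1}) (prod_topology X (top_of_set {0..1})) (\<lambda>s. (x, s))"
      using x by (auto simp: continuous_map_paired)
    from continuous_map_compose[OF this F]
    show "continuous_map (top_of_set {0..1}) M (?loop x \<circ> circle_point)"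
      by (rule continuous_map_eq) (use x param circle_point_in_circle in auto)
  qed
  show ?thesis
    unfolding free_loop_space_def mapping_space_def continuous_on_generated_topo_iff
  proof (intro conjI allI impI)
    show "?loop ` topspace X \<subseteq> \<Union> {{f \<in> extensional (topspace (top_of_set circle)). continuous_map (top_of_set circle) M f \<and> f ` K \<subseteq> U} |
        K U. compactin (top_of_set circle) K \<and> openin M U}"
      using topspace_free_loop_space[of M] loop unfolding free_loop_space_def mapping_space_def topology_generated_by_topspace by auto
    fix S assume "S \<in> {{f \<in> extensional (topspace (top_of_set circle)). continuous_map (top_of_set circle) M f \<and> f ` K \<subseteq> U} |
        K U. compactin (top_of_set circle) K \<and> openin M U}"
    then obtain K U where K: "compactin (top_of_set circle) K" and U: "openin M U"
      and S: "S = {f \<in> extensional circle. continuous_map (top_of_set circle) M f \<and> f ` K \<subseteq> U}"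
      by auto
    have Kc: "compact K" "K \<subseteq> circle" using K by (auto simp: compactin_subtopology)
    let ?I = "top_of_set {0..1::real}"
    define K' where "K' = {s \<in> {0..1}. circle_point s \<in> K}"
    have "closedin ?I {s \<in> topspace ?I. circle_point s \<in> K}"
      using Kc by (intro closedin_continuous_map_preimage[OF continuous_map_from_subtopology[OF continuous_map_circle_point]])
        (auto simp: closedin_subtopology intro!: exI[of _ K] compact_imp_closed)
    then have K': "compactin ?I K'"
      unfolding K'_def by (intro closedin_compact_space) (auto simp: compact_space_subtopology compactin_euclidean_iff)
    let ?W = "{p \<in> topspace (prod_topology X ?I). F p \<in> U}"
    have W: "openin (prod_topology X ?I) ?W"
      by (rule openin_continuous_map_preimage[OF F U])
    have S_iff: "?loop x \<in> S \<longleftrightarrow> {x} \<times> K' \<subseteq> ?W" if x: "x \<in> topspace X" for x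
    proof -
      have "?loop x ` K = (\<lambda>z. F (x, circle_param z)) ` K"
        using Kc(2) by (intro image_cong) auto
      moreover have "?loop x \<in> S \<longleftrightarrow> ?loop x ` K \<subseteq> U"
        unfolding S using loop[OF x] restrict_extensional by blast
      ultimately have "?loop x \<in> S \<longleftrightarrow> (\<forall>z\<in>K. F (x, circle_param z) \<in> U)"
        by (simp only: image_subset_iff)
      also have "\<dots> \<longleftrightarrow> (\<forall>s\<in>K'. F (x, s) \<in> U)"
      proof (intro iffI ballI)
        fix s assume "\<forall>z\<in>K. F (x, circle_param z) \<in> U" "s \<in> K'"
        then show "F (x, s) \<in> U" using param[OF x, of s] by (auto simp: K'_def)
      next
        fix z assume *: "\<forall>s\<in>K'. F (x, s) \<in> U" "z \<in> K"
        then have "circle_param z \<in> K'"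
          using Kc(2) circle_point_param[of z] circle_param_bounds[of z] by (auto simp: K'_def)
        with * show "F (x, circle_param z) \<in> U" by blast
      qed
      also have "\<dots> \<longleftrightarrow> {x} \<times> K' \<subseteq> ?W" using x by (auto simp: K'_def)
      finally show ?thesis .
    qed
    show "openin X (?loop -` S \<inter> topspace X)"
    proof (subst openin_subopen, intro ballI)
      fix x assume x': "x \<in> ?loop -` S \<inter> topspace X"
      then have x: "x \<in> topspace X" by (rule IntD2)
      from IntD1[OF x'] have "?loop x \<in> S" by (rule vimageD)
      with S_iff[OF x] have "{x} \<times> K' \<subseteq> ?W" by (rule iffD1)
      from tube_lemma_right[OF W K' x this] obtain A B
        where AB: "openin X A" "x \<in> A" "K' \<subseteq> B" "A \<times> B \<subseteq> ?W" by (elim exE conjE)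
      have "A \<subseteq> ?loop -` S \<inter> topspace X"
      proof
        fix y assume y: "y \<in> A"
        then have yX: "y \<in> topspace X" using AB(1) openin_subset by blast
        have "{y} \<times> K' \<subseteq> A \<times> B" using AB(3) y by blast
        then have "{y} \<times> K' \<subseteq> ?W" using AB(4) by (rule order.trans)
        with S_iff[OF yX] have "?loop y \<in> S" by (rule iffD2)
        then show "y \<in> ?loop -` S \<inter> topspace X" using yX by (intro IntI vimageI2)
      qed
      with AB(1,2) show "\<exists>T. openin X T \<and> x \<in> T \<and> T \<subseteq> ?loop -` S \<inter> topspace X"
        by (intro exI[of _ A] conjI)
    qed
  qed
qed

lemma topspace_relative_loop_space:
  "topspace (relative_loop_space N M g) =
    {(n, w). n \<in> topspace N \<and> w \<in> extensional circle \<and> continuous_map (top_of_set circle) M w \<and> g n = w 1}"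
  by (auto simp: relative_loop_space_def topspace_free_loop_space)

lemma continuous_map_relative_loop_fst:
  "continuous_map (relative_loop_space N M g) N fst"
  unfolding relative_loop_space_def by (intro continuous_map_from_subtopology continuous_map_fst)

lemma continuous_map_relative_loop_eval:
  assumes f: "continuous_map T (relative_loop_space N M g) f" and s: "continuous_map T euclideanreal s"
  shows "continuous_map T M (\<lambda>y. snd (f y) (circle_point (s y)))"
proof -
  have "continuous_map T (free_loop_space M) (snd \<circ> f)"
    using f by (auto simp: relative_loop_space_def continuous_map_in_subtopology intro: continuous_map_snd_of)
  moreover have "continuous_map T (top_of_set circle) (circle_point \<circ> s)"
    by (rule continuous_map_compose[OF s continuous_map_circle_point])
  ultimately have "continuous_map T (prod_topology (free_loop_space M) (top_of_set circle)) (\<lambda>y. (snd (f y), circle_point (s y)))"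
    by (simp add: continuous_map_paired o_def)
  from continuous_map_compose[OF this continuous_map_loop_eval] show ?thesis by (simp add: o_def)
qed

lemma continuous_map_into_relative_loop_space:
  assumes n: "continuous_map X N n" and F: "continuous_map (prod_topology X (top_of_set {0..1})) M F"
    and closed: "\<And>x. x \<in> topspace X \<Longrightarrow> F (x, 0) = g (n x) \<and> F (x, 1) = g (n x)"
  shows "continuous_map X (relative_loop_space N M g) (\<lambda>x. (n x, \<lambda>z\<in>circle. F (x, circle_param z)))"
  unfolding relative_loop_space_def continuous_map_in_subtopology continuous_map_paired
  using n closed continuous_map_into_free_loop_space[OF F] by auto

text \<open>
  The map \<open>r\<close> sends \<open>(t, (n, w))\<close> to the loop \<open>w\<close> restricted to \<open>[0, t]\<close> and closed by the
  path \<open>P\<close> from \<open>w t\<close> to \<open>w 0\<close>.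
\<close>

lemma close_initial_segment:
  fixes P :: "('a \<times> 'a) \<times> real \<Rightarrow> 'a" and M :: "'a topology" and N :: "'b topology" and g
  defines "R \<equiv> relative_loop_space N M g"
  defines "Z \<equiv> prod_topology (top_of_set {0..1::real}) R"
  defines "ends \<equiv> \<lambda>(t, x). (snd x 1, snd x (circle_point t))"
  assumes P: "continuous_map (prod_topology (subtopology (prod_topology M M) \<Omega>) (top_of_set {0..1})) M P"
    and P0: "\<And>x y. (x, y) \<in> \<Omega> \<Longrightarrow> P ((x, y), 0) = y" and P1: "\<And>x y. (x, y) \<in> \<Omega> \<Longrightarrow> P ((x, y), 1) = x"
    and Pdiag: "\<And>x s. x \<in> topspace M \<Longrightarrow> s \<in> {0..1} \<Longrightarrow> P ((x, x), s) = x"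
  shows "continuous_map Z (prod_topology M M) ends"
    and "\<exists>r. continuous_map (subtopology Z {z \<in> topspace Z. ends z \<in> \<Omega>}) R r \<and>
           (\<forall>x\<in>topspace R. r (0, x) = constant_loop_section g (fst x)) \<and>
           homotopic_with (\<lambda>_. True) R R (\<lambda>x. r (1, x)) id"
proof -
  let ?I = "top_of_set {0..1::real}"
  have fst_I: "continuous_map (prod_topology ?I X) euclideanreal fst" for X :: "'c topology"
    using continuous_map_fst[of ?I X] by (simp add: continuous_map_in_subtopology)
  have snd_I: "continuous_map (prod_topology X ?I) euclideanreal snd" for X :: "'c topology"
    using continuous_map_snd[of X ?I] by (simp add: continuous_map_in_subtopology)
  have eval: "continuous_map T M (\<lambda>y. snd (f y) (circle_point (s y)))"
    if "continuous_map T R f" "continuous_map T euclideanreal s" for T :: "'c topology" and f s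
    using that unfolding R_def by (rule continuous_map_relative_loop_eval)
  have snd_Z: "continuous_map Z R snd" unfolding Z_def by (rule continuous_map_snd)
  have fst_Z: "continuous_map Z euclideanreal fst" unfolding Z_def by (rule fst_I)
  have "continuous_map Z M (\<lambda>z. snd (snd z) (circle_point 0))" "continuous_map Z M (\<lambda>z. snd (snd z) (circle_point (fst z)))"
    by (intro eval snd_Z fst_Z; simp)+
  then show ends: "continuous_map Z (prod_topology M M) ends"
    by (simp add: ends_def case_prod_unfold continuous_map_paired)
  define U where "U = {z \<in> topspace Z. ends z \<in> \<Omega>}"
  let ?ZU = "subtopology Z U"
  let ?T = "prod_topology ?ZU ?I"
  \<comment> \<open>Half of the parameter interval for the segment of \<open>w\<close>, half for the
    closing path; they agree at \<open>1/2\<close> because \<open>P\<close> starts at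
    \<open>w t\<close>.\<close>
  define F where "F = (\<lambda>p :: (real \<times> 'b \<times> (complex \<Rightarrow> 'a)) \<times> real.
    if snd p \<le> 1/2 then snd (snd (fst p)) (circle_point (2 * snd p * fst (fst p)))
    else P (ends (fst p), 2 * snd p - 1))"
  have F: "continuous_map ?T M F"
    unfolding F_def
  proof (rule continuous_map_cases_le)
    show "continuous_map ?T euclideanreal snd" by (rule snd_I)
    show "continuous_map ?T euclideanreal (\<lambda>p. 1/2)" by simp
    have fstT: "continuous_map ?T Z fst"
      using continuous_map_fst[of ?ZU ?I] by (simp add: continuous_map_in_subtopology)
    have t: "continuous_map ?T euclideanreal (\<lambda>p. fst (fst p))"
      using continuous_map_compose[OF fstT fst_Z] by (simp add: o_def)
    have x: "continuous_map ?T R (\<lambda>p. snd (fst p))"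
      using continuous_map_compose[OF fstT snd_Z] by (simp add: o_def)
    have "continuous_map ?T M (\<lambda>p. snd (snd (fst p)) (circle_point (2 * snd p * fst (fst p))))"
      by (intro eval x continuous_map_real_mult t snd_I) simp
    then show "continuous_map (subtopology ?T {p \<in> topspace ?T. snd p \<le> 1/2}) M
        (\<lambda>p. snd (snd (fst p)) (circle_point (2 * snd p * fst (fst p))))"
      by (rule continuous_map_from_subtopology)
    let ?S = "subtopology ?T {p \<in> topspace ?T. 1/2 \<le> snd p}"
    have "continuous_map ?S (subtopology (prod_topology M M) \<Omega>) (\<lambda>p. ends (fst p))"
      using continuous_map_compose[OF fstT ends]
      by (auto simp: continuous_map_in_subtopology U_def o_def intro: continuous_map_from_subtopology)
    moreover have "continuous_map ?S ?I (\<lambda>p. 2 * snd p - 1)"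
      unfolding continuous_map_in_subtopology
      by (auto intro!: continuous_map_from_subtopology continuous_map_diff continuous_map_real_mult snd_I)
    ultimately have "continuous_map ?S (prod_topology (subtopology (prod_topology M M) \<Omega>) ?I) (\<lambda>p. (ends (fst p), 2 * snd p - 1))"
      by (simp add: continuous_map_paired)
    from continuous_map_compose[OF this P]
    show "continuous_map ?S M (\<lambda>p. P (ends (fst p), 2 * snd p - 1))" by (simp add: o_def)
    fix p assume p: "p \<in> topspace ?T" "snd p = 1/2"
    obtain z where "p = (z, 1/2)" using p(2) by (metis prod.collapse)
    moreover have "ends (fst p) \<in> \<Omega>" using p(1) by (auto simp: U_def)
    ultimately show "snd (snd (fst p)) (circle_point (2 * snd p * fst (fst p))) = P (ends (fst p), 2 * snd p - 1)"
      by (simp add: ends_def case_prod_unfold P0)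
  qed
  have base: "snd x 1 = g (fst x)" if "x \<in> topspace R" for x
    using that by (auto simp: R_def topspace_relative_loop_space)
  have param: "circle_param a \<in> {0..1}" for a
    using circle_param_bounds[of a] by simp
  let ?r = "\<lambda>z. (fst (snd z), \<lambda>a\<in>circle. F (z, circle_param a))"
  have r: "continuous_map ?ZU R ?r"
    unfolding R_def
  proof (rule continuous_map_into_relative_loop_space[OF _ F])
    have "continuous_map Z N (fst \<circ> snd)"
      using snd_Z continuous_map_relative_loop_fst unfolding R_def by (rule continuous_map_compose)
    then show "continuous_map ?ZU N (\<lambda>z. fst (snd z))"
      by (simp add: continuous_map_from_subtopology o_def)
    show "F (z, 0) = g (fst (snd z)) \<and> F (z, 1) = g (fst (snd z))" if "z \<in> topspace ?ZU" for z
    proof -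
      obtain t x where z: "z = (t, x)" by (cases z)
      with that have "x \<in> topspace R" "(snd x 1, snd x (circle_point t)) \<in> \<Omega>"
        by (simp_all add: U_def Z_def ends_def)
      with z base show ?thesis by (simp add: F_def ends_def P1)
    qed
  qed
  have pt: "snd x z \<in> topspace M" if "x \<in> topspace R" "z \<in> circle" for x z
    using that by (auto simp: R_def topspace_relative_loop_space continuous_map_def)
  \<comment> \<open>At \<open>t = 0\<close> both halves rest at the base point, the second because
    \<open>P\<close> is constant on the diagonal.\<close>
  have r0: "?r (0, x) = constant_loop_section g (fst x)" if x: "x \<in> topspace R" for x
  proof -
    have "F ((0, x), s) = g (fst x)" if "s \<in> {0..1}" for s
    proof (cases "s \<le> 1/2")
      case True
      then show ?thesis using x base by (simp add: F_def)
    next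
      case False
      then have "P ((snd x 1, snd x 1), 2 * s - 1) = snd x 1"
        using that pt[OF x, of 1] by (intro Pdiag) simp_all
      then show ?thesis using False x base by (simp add: F_def ends_def)
    qed
    then have "F ((0, x), circle_param a) = g (fst x)" for a
      using param by blast
    then show ?thesis
      by (simp add: constant_loop_section_def)
  qed
  have r1: "homotopic_with (\<lambda>_. True) R R id (\<lambda>x. ?r (1, x))"
  proof (subst homotopic_with, simp, intro exI conjI ballI)
    \<comment> \<open>At \<open>t = 1\<close> the closed segment runs through \<open>w\<close> at
      double speed and then rests. Raising the speed from \<open>1\<close> to \<open>2\<close>, with
      the argument cut off at \<open>1\<close>, connects \<open>w\<close> to it; the first
      coordinate of \<open>Z\<close> now serves as homotopy parameter.\<close>
    let ?H = "\<lambda>p :: (real \<times> 'b \<times> (complex \<Rightarrow> 'a)) \<times> real. snd (snd (fst p)) (circle_point (min 1 ((1 + fst (fst p)) * snd p)))"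
    let ?h = "\<lambda>z. (fst (snd z), \<lambda>a\<in>circle. ?H (z, circle_param a))"
    have fstT: "continuous_map (prod_topology Z ?I) Z fst" by (rule continuous_map_fst)
    have t: "continuous_map (prod_topology Z ?I) euclideanreal (\<lambda>p. fst (fst p))"
      using continuous_map_compose[OF fstT fst_Z] by (simp add: o_def)
    have x: "continuous_map (prod_topology Z ?I) R (\<lambda>p. snd (fst p))"
      using continuous_map_compose[OF fstT snd_Z] by (simp add: o_def)
    have H: "continuous_map (prod_topology Z ?I) M ?H"
      by (intro eval x continuous_map_real_min continuous_map_real_mult continuous_map_add t snd_I) simp_all
    have "continuous_map Z R ?h"
      unfolding R_def
    proof (rule continuous_map_into_relative_loop_space[OF _ H])
      have "continuous_map Z N (fst \<circ> snd)"
        using snd_Z continuous_map_relative_loop_fst unfolding R_def by (rule continuous_map_compose)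
      then show "continuous_map Z N (\<lambda>z. fst (snd z))"
        by (simp add: o_def)
      show "?H (z, 0) = g (fst (snd z)) \<and> ?H (z, 1) = g (fst (snd z))" if "z \<in> topspace Z" for z
      proof -
        obtain t x where z: "z = (t, x)" by (cases z)
        with that have "x \<in> topspace R" "0 \<le> t" by (simp_all add: Z_def)
        with z base show ?thesis by simp
      qed
    qed
    then show "continuous_map (prod_topology ?I R) R ?h" by (simp only: Z_def)
    fix x assume x: "x \<in> topspace R"
    show "?h (0, x) = id x"
    proof -
      have "snd x \<in> extensional circle"
        using x by (auto simp: R_def topspace_relative_loop_space)
      moreover have "min 1 (circle_param a) = circle_param a" for a
        using param[of a] by simp
      ultimately have "(\<lambda>a\<in>circle. snd x (circle_point (min 1 (circle_param a)))) = snd x"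
        by (intro extensionalityI[of _ circle]) (simp_all add: circle_point_param del: mem_sphere_0)
      then show ?thesis by simp
    qed
    have "?H ((1, x), s) = F ((1, x), s)" if "s \<in> {0..1}" for s
    proof (cases "s \<le> 1/2")
      case True
      then show ?thesis by (simp add: F_def)
    next
      case False
      then have "P ((snd x 1, snd x 1), 2 * s - 1) = snd x 1"
        using that pt[OF x, of 1] by (intro Pdiag) simp_all
      then show ?thesis using False by (simp add: F_def ends_def)
    qed
    then have "?H ((1, x), circle_param a) = F ((1, x), circle_param a)" for a
      using param by blast
    then show "?h (1, x) = ?r (1, x)" by (simp only: snd_conv fst_conv)
  qed simp
  show "\<exists>r. continuous_map (subtopology Z {z \<in> topspace Z. ends z \<in> \<Omega>}) R r \<and>
           (\<forall>x\<in>topspace R. r (0, x) = constant_loop_section g (fst x)) \<and>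
           homotopic_with (\<lambda>_. True) R R (\<lambda>x. r (1, x)) id"
  proof (intro exI[of _ ?r] conjI ballI)
    show "continuous_map (subtopology Z {z \<in> topspace Z. ends z \<in> \<Omega>}) R ?r"
      using r by (simp only: U_def)
    show "homotopic_with (\<lambda>_. True) R R (\<lambda>x. ?r (1, x)) id"
      by (rule homotopic_with_symD[OF r1])
  qed (rule r0)
qed

lemma continuous_map_constant_loop_section:
  assumes "continuous_map N M g"
  shows "continuous_map N (relative_loop_space N M g) (constant_loop_section g)"
proof -
  have "continuous_map (prod_topology N (top_of_set {0..1::real})) M (\<lambda>p. g (fst p))"
    using continuous_map_compose[OF continuous_map_fst assms] by (simp add: o_def)
  from continuous_map_into_relative_loop_space[OF continuous_map_id[unfolded id_def] this, of g]
  show ?thesis by (simp add: constant_loop_section_def[abs_def])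
qed

section \<open>Comparison of the two ends of the parameter interval\<close>

theorem theorem49:
  fixes h :: "('u, 'g) cohomology"
    and m l :: nat
    and M L N TM G :: "'u topology"
    and \<A> \<L> :: "'u chart set"
    and g g1 g2 :: "'u \<Rightarrow> 'u"
    and \<tau> :: "'u \<times> ('u chart \<Rightarrow> nat \<Rightarrow> real) \<Rightarrow> 'u"
    and \<kappa> :: "'u \<times> (complex \<Rightarrow> 'u) \<Rightarrow> 'u"
    and \<tau>' :: "'u \<Rightarrow> 'u \<times> ('u chart \<Rightarrow> nat \<Rightarrow> real)"
    and \<kappa>' :: "'u \<Rightarrow> 'u \<times> (complex \<Rightarrow> 'u)"
    and u e pe :: 'g
    and p \<sigma> :: "'u \<Rightarrow> 'u"
  assumes h: "multiplicative_cohomology h"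
    and M: "smooth_manifold m M \<A>"
    \<comment> \<open>\<open>TM\<close> and \<open>G\<close> are copies of the tangent bundle of \<open>M\<close> and of \<open>g\<^sup>*LM\<close> with points in \<open>'u\<close>\<close>
    and TM: "homeomorphic_maps (tangent_bundle m \<A>) TM \<tau> \<tau>'"
    and orientation: "thom_class h m M TM (fst \<circ> \<tau>') (\<tau> \<circ> tangent_zero \<A>) u"
    and e: "e = euler_class h m M TM (\<tau> \<circ> tangent_zero \<A>) u"
    and g: "continuous_map N M g"
    and G: "homeomorphic_maps (relative_loop_space N M g) G \<kappa> \<kappa>'"
    and p: "p = fst \<circ> \<kappa>'"
    and \<sigma>: "\<sigma> = \<kappa> \<circ> constant_loop_section g"
    and factorization: "\<forall>n\<in>topspace N. g n = g2 (g1 n)"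
    and L: "smooth_manifold l L \<L>"
    and g2: "smooth_map l L \<L> m M \<A> g2"
    and g1: "hurewicz_fibration N L g1 \<or> weak_equivalence_invariant h \<and> serre_fibration N L g1"
    and pe: "pe = Map h (int m) G {} N {} p (Map h (int m) N {} M {} g e)"
  shows "(\<forall>k. \<forall>b\<in>carrier (Grp h k G {}).
            Cup h k (int m) G {} {} b pe =
            Cup h k (int m) G {} {} (Map h k G {} N {} p (Map h k N {} G {} \<sigma> b)) pe) \<and>
         (\<forall>dimN :: int. (\<forall>i>dimN. carrier (Grp h i N {}) = {\<one>\<^bsub>Grp h i N {}\<^esub>}) \<longrightarrow>
            (\<forall>k>dimN - int m. \<forall>b\<in>carrier (Grp h k G {}).
               Cup h k (int m) G {} {} b pe = \<one>\<^bsub>Grp h (k + int m) G {}\<^esub>))"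
proof -
  interpret multiplicative_cohomology h by (rule h)
  interpret smooth_atlas m M \<A> by unfold_locales (rule M)
  let ?I = "top_of_set {0..1::real}" and ?R = "relative_loop_space N M g"
  let ?z = "\<tau> \<circ> tangent_zero \<A>"
  let ?B = "topspace TM - ?z ` topspace M"
  obtain \<Omega> P \<phi> where \<Omega>: "openin (prod_topology M M) \<Omega>" "\<forall>x\<in>topspace M. (x, x) \<in> \<Omega>"
    and P: "continuous_map (prod_topology (subtopology (prod_topology M M) \<Omega>) ?I) M P"
    and P0: "\<forall>x y. (x, y) \<in> \<Omega> \<longrightarrow> P ((x, y), 0) = y" and P1: "\<forall>x y. (x, y) \<in> \<Omega> \<longrightarrow> P ((x, y), 1) = x"
    and Pdiag: "\<forall>x s. P ((x, x), s) = x"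
    and \<phi>: "continuous_map (subtopology (prod_topology M M) \<Omega>) (tangent_bundle m \<A>) \<phi>"
    and \<phi>_diag: "\<forall>x. \<phi> (x, x) = tangent_zero \<A> x"
    and \<phi>_nz: "\<forall>x y. (x, y) \<in> \<Omega> \<longrightarrow> x \<noteq> y \<longrightarrow> \<phi> (x, y) \<notin> range (tangent_zero \<A>)"
    using diagonal_neighbourhood by (elim exE conjE)
  have \<tau>: "continuous_map (tangent_bundle m \<A>) TM \<tau>"
    and \<tau>_inv: "v \<in> topspace (tangent_bundle m \<A>) \<Longrightarrow> \<tau>' (\<tau> v) = v" for v
    using TM by (simp_all add: homeomorphic_maps_def)
  have \<kappa>: "continuous_map ?R G \<kappa>" and \<kappa>': "continuous_map G ?R \<kappa>'"
    and \<kappa>_inv: "x \<in> topspace ?R \<Longrightarrow> \<kappa>' (\<kappa> x) = x" and \<kappa>'_inv: "y \<in> topspace G \<Longrightarrow> \<kappa> (\<kappa>' y) = y" for x y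
    using G by (simp_all add: homeomorphic_maps_def)
  have u: "u \<in> carrier (Grp h (int m) TM ?B)"
    using orientation by (simp add: thom_class_def)

  have p_cont: "continuous_map G N p"
    unfolding p using \<kappa>' continuous_map_relative_loop_fst by (rule continuous_map_compose)
  have \<sigma>_cont: "continuous_map N G \<sigma>"
    unfolding \<sigma> using continuous_map_constant_loop_section[OF g] \<kappa> by (rule continuous_map_compose)
  \<comment> \<open>The diagonal followed by \<open>\<phi>\<close> is the zero section, which
    thereby inherits continuity.\<close>
  have "continuous_map M (subtopology (prod_topology M M) \<Omega>) (\<lambda>x. (x, x))"
    using \<Omega>(2) by (auto simp: continuous_map_in_subtopology continuous_map_paired)
  from continuous_map_compose[OF this \<phi>]
  have zero_cont: "continuous_map M (tangent_bundle m \<A>) (tangent_zero \<A>)"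
    using \<phi>_diag by (simp add: o_def)
  have z_pair: "pair_map M {} TM ?B ?z"
    using continuous_map_compose[OF zero_cont \<tau>] by (auto simp: pair_map_def)
  have p_pair: "pair_map G {} N {} p" and \<sigma>_pair: "pair_map N {} G {} \<sigma>" and g_pair: "pair_map N {} M {} g"
    using p_cont \<sigma>_cont g by (simp_all add: pair_map_def)
  have gp_pair: "pair_map G {} M {} (g \<circ> p)"
    using continuous_map_compose[OF p_cont g] by (simp add: pair_map_def)
  have e_closed: "e \<in> carrier (Grp h (int m) M {})"
    unfolding e euler_class_def by (rule Map_closed[OF z_pair u])
  \<comment> \<open>As one pullback of the Thom class, \<open>pe\<close> takes the form in which it
    reappears at \<open>t = 0\<close> and \<open>t = 1\<close>.\<close>
  have pe_eq: "pe = Map h (int m) G {} TM ?B (?z \<circ> (g \<circ> p)) u"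
    unfolding pe Map_comp[OF p_pair g_pair e_closed, symmetric]
    unfolding e euler_class_def by (rule Map_comp[OF gp_pair z_pair u, symmetric])

  define ends where "ends = (\<lambda>(t, x :: 'u \<times> (complex \<Rightarrow> 'u)). (snd x 1, snd x (circle_point t)))"
  let ?Z = "prod_topology ?I ?R"
  have ends: "continuous_map ?Z (prod_topology M M) ends"
    unfolding ends_def by (rule close_initial_segment(1)[OF P]) (use P0 P1 Pdiag in auto)
  have "\<exists>r. continuous_map (subtopology ?Z {z \<in> topspace ?Z. ends z \<in> \<Omega>}) ?R r \<and>
      (\<forall>x\<in>topspace ?R. r (0, x) = constant_loop_section g (fst x)) \<and>
      homotopic_with (\<lambda>_. True) ?R ?R (\<lambda>x. r (1, x)) id"
    unfolding ends_def by (rule close_initial_segment(2)[OF P]) (use P0 P1 Pdiag in auto)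
  then obtain r where r: "continuous_map (subtopology ?Z {z \<in> topspace ?Z. ends z \<in> \<Omega>}) ?R r"
    and r0: "\<forall>x\<in>topspace ?R. r (0, x) = constant_loop_section g (fst x)"
    and r1: "homotopic_with (\<lambda>_. True) ?R ?R (\<lambda>x. r (1, x)) id"
    by (elim exE conjE)

  \<comment> \<open>The product of \<open>[0, 1]\<close> with the loop space is copied into
    \<open>'u\<close> by coding a time together with the copy \<open>\<kappa> x\<close> of a
    loop.\<close>
  obtain code :: "real \<times> 'u \<Rightarrow> 'u" where code: "inj code" using inj_real_prod by blast
  define \<zeta> where "\<zeta> = (\<lambda>(t, x). code (t, \<kappa> x))"
  have "inj_on \<zeta> (topspace ?Z)"
  proof (rule inj_onI)
    fix y z assume y: "y \<in> topspace ?Z" and z: "z \<in> topspace ?Z"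
      and eq: "\<zeta> y = \<zeta> z"
    have "code (fst y, \<kappa> (snd y)) = code (fst z, \<kappa> (snd z))"
      using eq by (simp add: \<zeta>_def case_prod_unfold)
    from injD[OF code this] have "fst y = fst z" "\<kappa> (snd y) = \<kappa> (snd z)" by simp_all
    moreover have "snd y \<in> topspace ?R" "snd z \<in> topspace ?R" using y z by auto
    ultimately show "y = z" using \<kappa>_inv by (metis prod_eq_iff)
  qed
  then obtain Z \<zeta>' where Z: "homeomorphic_maps ?Z Z \<zeta> \<zeta>'"
    using homeomorphic_copy by blast
  have \<zeta>: "continuous_map ?Z Z \<zeta>" and \<zeta>': "continuous_map Z ?Z \<zeta>'"
    and \<zeta>_inv: "x \<in> topspace ?Z \<Longrightarrow> \<zeta>' (\<zeta> x) = x" for x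
    using Z unfolding homeomorphic_maps_def by blast+
  define E where "E = ends \<circ> \<zeta>'"
  have E: "continuous_map Z (prod_topology M M) E"
    unfolding E_def using \<zeta>' ends by (rule continuous_map_compose)
  define U where "U = {y \<in> topspace Z. E y \<in> \<Omega>}"
  define D where "D = {y \<in> topspace Z. fst (E y) = snd (E y)}"
  have U: "openin Z U" unfolding U_def by (rule openin_continuous_map_preimage[OF E \<Omega>(1)])
  have D: "closedin Z D"
    unfolding D_def using Hausdorff E
    by (intro closedin_continuous_maps_eq[where Y = M]) (simp_all add: continuous_map_fst_of[unfolded o_def] continuous_map_snd_of[unfolded o_def])
  have DU: "D \<subseteq> U"
  proof
    fix y assume y: "y \<in> D"
    then have "E y \<in> topspace (prod_topology M M)"
      using continuous_map_image_subset_topspace[OF E] by (auto simp: D_def)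
    with y \<Omega>(2) show "y \<in> U" by (cases "E y") (auto simp: D_def U_def)
  qed
  \<comment> \<open>Inclusions of the slices at time \<open>t\<close>. Varying \<open>t\<close>
    gives a homotopy between the end slices, although the slices in between may leave
    \<open>U\<close>.\<close>
  define i where "i = (\<lambda>t x. \<zeta> (t, \<kappa>' x))"
  have \<kappa>'_top: "\<kappa>' x \<in> topspace ?R" if "x \<in> topspace G" for x
    using continuous_map_image_subset_topspace[OF \<kappa>'] that by blast
  have \<zeta>'_i: "\<zeta>' (i t x) = (t, \<kappa>' x)" if "x \<in> topspace G" "t \<in> {0..1}" for t x
    unfolding i_def using that \<kappa>'_top by (intro \<zeta>_inv) auto
  have i_homotopic: "homotopic_with (\<lambda>_. True) G Z (i 0) (i 1)"
  proof -
    have "continuous_map (prod_topology ?I G) ?R (\<kappa>' \<circ> snd)"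
      by (rule continuous_map_compose[OF continuous_map_snd \<kappa>'])
    then have "continuous_map (prod_topology ?I G) ?Z (\<lambda>q. (fst q, \<kappa>' (snd q)))"
      by (simp add: continuous_map_paired continuous_map_fst o_def)
    from continuous_map_compose[OF this \<zeta>]
    have "continuous_map (prod_topology ?I G) Z (\<lambda>q. i (fst q) (snd q))"
      by (simp add: i_def o_def)
    then show ?thesis
      unfolding homotopic_with_def by (intro exI[of _ "\<lambda>q. i (fst q) (snd q)"]) simp
  qed
  \<comment> \<open>As \<open>circle_point\<close> is \<open>1\<close> at both ends, the two
    evaluations coincide there, so the end slices lie entirely in \<open>D\<close>.\<close>
  have E_i: "E (i t x) = (g (p x), g (p x))" if "x \<in> topspace G" "t = 0 \<or> t = 1" for t x
  proof -
    have "E (i t x) = ends (t, \<kappa>' x)" using \<zeta>'_i[of x t] that by (auto simp: E_def)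
    moreover have "snd (\<kappa>' x) 1 = g (p x)"
      using \<kappa>'_top[OF that(1)] by (auto simp: topspace_relative_loop_space p)
    ultimately show ?thesis using that(2) by (auto simp: ends_def)
  qed
  have i_cont: "continuous_map G Z (i 0)" "continuous_map G Z (i 1)"
    using homotopic_with_imp_continuous_maps[OF i_homotopic] by auto
  have iD: "i t \<in> topspace G \<rightarrow> D" if "t = 0 \<or> t = 1" for t
  proof
    fix x assume x: "x \<in> topspace G"
    have "i t x \<in> topspace Z"
      using that x i_cont[THEN continuous_map_image_subset_topspace] by blast
    then show "i t x \<in> D" using E_i[OF x that] by (simp add: D_def)
  qed
  have \<zeta>'_U: "continuous_map (subtopology Z U) (subtopology ?Z {z \<in> topspace ?Z. ends z \<in> \<Omega>}) \<zeta>'"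
    using \<zeta>' continuous_map_image_subset_topspace[OF \<zeta>']
    by (auto simp: continuous_map_in_subtopology U_def E_def intro: continuous_map_from_subtopology)
  define \<rho> where "\<rho> = \<kappa> \<circ> (r \<circ> \<zeta>')"
  have \<rho>: "continuous_map (subtopology Z U) G \<rho>"
    unfolding \<rho>_def by (rule continuous_map_compose[OF continuous_map_compose[OF \<zeta>'_U r] \<kappa>])
  define \<Phi> where "\<Phi> = \<tau> \<circ> (\<phi> \<circ> E)"
  have E_U: "continuous_map (subtopology Z U) (subtopology (prod_topology M M) \<Omega>) E"
    using E by (auto simp: continuous_map_in_subtopology U_def intro: continuous_map_from_subtopology)
  have \<phi>E: "continuous_map (subtopology Z U) (tangent_bundle m \<A>) (\<phi> \<circ> E)"
    by (rule continuous_map_compose[OF E_U \<phi>])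
  \<comment> \<open>Off \<open>D\<close> the evaluation points differ, so \<open>\<phi>\<close>
    avoids the zero section; injectivity of \<open>\<tau>\<close> carries this over to the copy
    \<open>TM\<close>.\<close>
  have \<Phi>: "pair_map (subtopology Z U) (U - D) TM ?B \<Phi>"
    unfolding pair_map_def
  proof (intro conjI)
    show \<Phi>_cont: "continuous_map (subtopology Z U) TM \<Phi>"
      unfolding \<Phi>_def by (rule continuous_map_compose[OF \<phi>E \<tau>])
    show "U - D \<subseteq> topspace (subtopology Z U)" by (auto simp: U_def)
    show "\<Phi> \<in> U - D \<rightarrow> ?B"
    proof
      fix y assume y: "y \<in> U - D"
      then have yU: "y \<in> topspace (subtopology Z U)" by (auto simp: U_def)
      have "\<Phi> y \<in> topspace TM"
        using continuous_map_image_subset_topspace[OF \<Phi>_cont] yU by blast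
      moreover have "\<Phi> y \<noteq> ?z x" if x: "x \<in> topspace M" for x
      proof
        assume "\<Phi> y = ?z x"
        then have "\<tau>' (\<tau> (\<phi> (E y))) = \<tau>' (\<tau> (tangent_zero \<A> x))" by (simp add: \<Phi>_def)
        moreover have "\<phi> (E y) \<in> topspace (tangent_bundle m \<A>)"
          using continuous_map_image_subset_topspace[OF \<phi>E] yU by auto
        moreover have "tangent_zero \<A> x \<in> topspace (tangent_bundle m \<A>)"
          using continuous_map_image_subset_topspace[OF zero_cont] x by blast
        ultimately have "\<phi> (E y) = tangent_zero \<A> x" by (simp only: \<tau>_inv)
        moreover have "\<phi> (E y) \<notin> range (tangent_zero \<A>)"
          using \<phi>_nz y by (cases "E y") (auto simp: U_def D_def)
        ultimately show False by simp
      qed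
      ultimately show "\<Phi> y \<in> ?B" by blast
    qed
  qed simp
  have \<Phi>_i: "Map h (int m) G {} TM ?B (\<Phi> \<circ> i t) u = pe" if t: "t = 0 \<or> t = 1" for t
    unfolding pe_eq
  proof (rule Map_cong[symmetric, OF _ _ u])
    show "pair_map G {} TM ?B (?z \<circ> (g \<circ> p))"
      using z_pair gp_pair by (auto simp: pair_map_def intro: continuous_map_compose)
    show "(?z \<circ> (g \<circ> p)) x = (\<Phi> \<circ> i t) x" if "x \<in> topspace G" for x
      using E_i[OF that t] \<phi>_diag by (simp add: \<Phi>_def)
  qed
  have main: "Cup h k (int m) G {} {} b pe =
      Cup h k (int m) G {} {} (Map h k G {} N {} p (Map h k N {} G {} \<sigma> b)) pe"
    if b: "b \<in> carrier (Grp h k G {})" for k b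
  proof -
    have "Cup h k (int m) G {} {} (Map h k G {} G {} (\<rho> \<circ> i 0) b) pe =
        Cup h k (int m) G {} {} (Map h k G {} G {} (\<rho> \<circ> i 1) b) pe"
      using Cup_supported_homotopy[OF D U DU i_homotopic iD iD \<rho> b \<Phi> u] \<Phi>_i by simp
    moreover have "Map h k G {} G {} (\<rho> \<circ> i 0) b = Map h k G {} N {} p (Map h k N {} G {} \<sigma> b)"
      unfolding Map_comp[OF p_pair \<sigma>_pair b, symmetric]
    proof (rule Map_cong[symmetric, OF _ _ b])
      show "pair_map G {} G {} (\<sigma> \<circ> p)"
        using continuous_map_compose[OF p_cont \<sigma>_cont] by (simp add: pair_map_def)
      show "(\<sigma> \<circ> p) x = (\<rho> \<circ> i 0) x" if "x \<in> topspace G" for x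
        using \<zeta>'_i[OF that, of 0] r0 \<kappa>'_top[OF that] by (simp add: \<rho>_def \<sigma> p)
    qed
    \<comment> \<open>Unlike at \<open>t = 0\<close>, where the maps agree pointwise, the map at
      \<open>t = 1\<close> is the identity only up to the homotopy \<open>r1\<close>.\<close>
    moreover have "Map h k G {} G {} (\<rho> \<circ> i 1) b = b"
    proof -
      have "homotopic_with (\<lambda>_. True) G G (\<kappa> \<circ> ((\<lambda>x. r (1, x)) \<circ> \<kappa>')) (\<kappa> \<circ> (id \<circ> \<kappa>'))"
        by (rule homotopic_with_compose_continuous_map_left[OF
              homotopic_with_compose_continuous_map_right[OF r1 \<kappa>'] \<kappa>]) auto
      then have "homotopic_with (\<lambda>_. True) G G (\<rho> \<circ> i 1) id"
        by (rule homotopic_with_eq) (simp_all add: \<rho>_def \<zeta>'_i \<kappa>'_inv)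
      then have "Map h k G {} G {} (\<rho> \<circ> i 1) b = Map h k G {} G {} id b"
        using b by (intro homotopy) auto
      then show ?thesis using b by (simp add: Map_id)
    qed
    ultimately show ?thesis by simp
  qed
  moreover have "Cup h k (int m) G {} {} b pe = \<one>\<^bsub>Grp h (k + int m) G {}\<^esub>"
    if dim: "\<forall>i>dimN. carrier (Grp h i N {}) = {\<one>\<^bsub>Grp h i N {}\<^esub>}" and k: "k > dimN - int m"
      and b: "b \<in> carrier (Grp h k G {})" for dimN k :: int and b
  proof -
    \<comment> \<open>By the first assertion and naturality, the product is pulled back along
      \<open>p\<close> from a class on \<open>N\<close> of degree \<open>k + int m > dimN\<close>,
      which is zero.\<close>
    let ?sb = "Map h k N {} G {} \<sigma> b" and ?ge = "Map h (int m) N {} M {} g e"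
    have sb: "?sb \<in> carrier (Grp h k N {})" by (rule Map_closed[OF \<sigma>_pair b])
    have ge: "?ge \<in> carrier (Grp h (int m) N {})" by (rule Map_closed[OF g_pair e_closed])
    have triad: "cup_triad X {} {}" for X :: "'u topology" by (simp add: cup_triad_def)
    have "Cup h k (int m) N {} {} ?sb ?ge \<in> carrier (Grp h (k + int m) N {})"
      using Cup_hom_left[OF triad ge] sb by (auto simp: hom_def)
    then have zero: "Cup h k (int m) N {} {} ?sb ?ge = \<one>\<^bsub>Grp h (k + int m) N {}\<^esub>"
      using dim k by simp
    have "Cup h k (int m) G {} {} b pe = Map h (k + int m) G {} N {} p (Cup h k (int m) N {} {} ?sb ?ge)"
      using main[OF b] Cup_natural[OF triad triad p_pair p_pair sb ge] by (simp add: pe)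
    then show ?thesis unfolding zero by (simp only: Map_one[OF p_pair])
  qed
  ultimately show ?thesis by blast
qed

end
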